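(* Under the standing assumptions on $\Omega,p,\Psi$ listed in the context, let $\lambda>0$ and let $g\in L^\infty(\Omega)$ satisfy $0\le g\le\lambda$ a.e. on $\Omega$. Then the problem $$-\operatorname{div}\mathbf a(x,\nabla V(x))+\lambda V(x)=g(x)\ \text{in }\Omega,\qquad\frac{\partial V}{\partial\nu}=0\ \text{on }\partial\Omega$$ admits a unique weak solution $V\in W^{1,p(x)}(\Omega)$, and it satisfies $0\le V\le1$ a.e. on $\Omega$.
   Context: Variable exponent spaces: for a measurable bounded $q:\Omega\to[1,\infty)$, $L^{q(x)}(\Omega)$ is the space of measurable $u:\Omega\to\mathbb R$ with $\int_\Omega|u(x)|^{q(x)}dx<\infty$, with the Luxemburg norm $\inf\{t>0:\int_\Omega|u(x)/t|^{q(x)}dx\le1\}$; $W^{1,q(x)}(\Omega)=\{u\in L^{q(x)}(\Omega): |\nabla u|\in L^{q(x)}(\Omega)\}$ (weak gradient) with norm $\|u\|_{L^{q(x)}(\Omega)}+\||\nabla u|\|_{L^{q(x)}(\Omega)}$. Standing assumptions. - $\Omega\subset\mathbb R^N$, $N\ge2$, is an open, bounded, connected Lipschitz domain. - $p:\overline\Omega\to(1,\infty)$ is either log-Hölder continuous (there is $C>0$ with $|p(x)-p(y)|\le C/(-\log|x-y|)$ whenever $0<|x-y|<1/2$) with $p^-:=\min_{\overline\Omega}p\ge\frac{2N}{N+2}$, or continuous with $p^->\frac{2N}{N+2}$. Put $p'(x)=\frac{p(x)}{p(x)-1}$. (In both cases $W^{1,p(x)}(\Omega)$ embeds continuously in $L^2(\Omega)$.)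 - $\Psi:\overline\Omega\times(0,\infty)\to(0,\infty)$; $\Psi(\cdot,s)$ is measurable for each $s>0$; $\Psi(x,\cdot)$ is locally absolutely continuous on $(0,\infty)$ for a.a. $x\in\Omega$; $\lim_{s\to0^+}\Psi(x,s)s=0$ for each $x\in\Omega$; for a.a. $x\in\Omega$ the function $(0,\infty)\ni s\mapsto\Psi(x,s)s$ is strictly increasing. - $\mathbf a:\overline\Omega\times\mathbb R^N\to\mathbb R^N$ is $\mathbf a(x,\xi)=\Psi(x,|\xi|)\xi$ for $\xi\ne0$, $\mathbf a(x,0)=0$; $\Phi:\overline\Omega\times\mathbb R\to[0,\infty)$ is $\Phi(x,s)=\Psi(x,|s|)|s|$ for $s\neq0$, $\Phi(x,0)=0$; $A(x,\xi)=\int_0^{|\xi|}\Phi(x,s)\,ds$. - For every $v\in L^{p(x)}(\Omega)$ one has $\Phi(\cdot,v(\cdot))\in L^{p'(x)}(\Omega)$. - There are constants $\delta>0$, $\tilde\delta\ge0$ with $\int_\Omega A(x,\nabla v)\,dx\ge\delta\int_\Omega|\nabla v|^{p(x)}dx-\tilde\delta$ for all $v\in W^{1,p(x)}(\Omega)$. A weak solution of the problem is a function $V\in W^{1,p(x)}(\Omega)$ such that $$\int_\Omega\mathbf a(x,\nabla V)\cdot\nabla\phi\,dx+\lambda\int_\Omega V\phi\,dx=\int_\Omega g\phi\,dx\qquad\text{for all }\phi\in W^{1,p(x)}(\Omega).$$ *)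

theory Defs
  imports "HOL-Analysis.Analysis"
begin

text \<open>
  Functions on \<open>\<Omega>\<close> (or on its closure) are total functions on the ambient Euclidean space
  whose values elsewhere are irrelevant; they are identified when they agree almost
  everywhere with respect to \<^term>\<open>lebesgue_on \<Omega>\<close>.
\<close>

text \<open>
  Near every boundary point the domain is, after an orthogonal change of coordinates with
  last axis \<open>e\<close>, the set strictly above the graph of a Lipschitz function of the remaining
  coordinates.
\<close>

definition lipschitz_domain :: "'a::euclidean_space set \<Rightarrow> bool" where
  "lipschitz_domain \<Omega> \<longleftrightarrow> open \<Omega> \<and> connected \<Omega> \<and> \<Omega> \<noteq> {} \<and>
     (\<forall>z\<in>frontier \<Omega>. \<exists>r>0. \<exists>e \<gamma> L. norm e = 1 \<and> L-lipschitz_on {y. y \<bullet> e = 0} \<gamma> \<and>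
        \<Omega> \<inter> ball z r = {x \<in> ball z r. x \<bullet> e > \<gamma> (x - (x \<bullet> e) *\<^sub>R e)})"

definition var_Lp :: "'a::euclidean_space set \<Rightarrow> ('a \<Rightarrow> real) \<Rightarrow> ('a \<Rightarrow> real) set" where
  "var_Lp \<Omega> q = {u. u \<in> borel_measurable (lebesgue_on \<Omega>) \<and>
                     integrable (lebesgue_on \<Omega>) (\<lambda>x. \<bar>u x\<bar> powr q x)}"

definition L_infty :: "'a::euclidean_space set \<Rightarrow> ('a \<Rightarrow> real) set" where
  "L_infty \<Omega> = {u. u \<in> borel_measurable (lebesgue_on \<Omega>) \<and>
                   (\<exists>C. AE x in lebesgue_on \<Omega>. \<bar>u x\<bar> \<le> C)}"

definition conj_exponent :: "('a \<Rightarrow> real) \<Rightarrow> 'a \<Rightarrow> real" where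
  "conj_exponent p x = p x / (p x - 1)"

definition log_Holder_on :: "'a::metric_space set \<Rightarrow> ('a \<Rightarrow> real) \<Rightarrow> bool" where
  "log_Holder_on S p \<longleftrightarrow> (\<exists>C>0. \<forall>x\<in>S. \<forall>y\<in>S. 0 < dist x y \<and> dist x y < 1/2 \<longrightarrow>
     \<bar>p x - p y\<bar> \<le> C / (- ln (dist x y)))"

primrec C_k :: "nat \<Rightarrow> ('a::euclidean_space \<Rightarrow> real) \<Rightarrow> bool" where
  "C_k 0 f \<longleftrightarrow> continuous_on UNIV f"
| "C_k (Suc k) f \<longleftrightarrow> (\<forall>x. f differentiable at x) \<and>
     (\<forall>b\<in>Basis. C_k k (\<lambda>x. frechet_derivative f (at x) b))"

definition test_functions :: "'a::euclidean_space set \<Rightarrow> ('a \<Rightarrow> real) set" where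
  "test_functions \<Omega> = {\<phi>. (\<forall>k. C_k k \<phi>) \<and> compact (closure {x. \<phi> x \<noteq> 0}) \<and>
                           closure {x. \<phi> x \<noteq> 0} \<subseteq> \<Omega>}"

text \<open>
  Weak gradients are determined only almost everywhere, so, as for \<^const>\<open>has_derivative\<close>,
  the gradient is a relation between \<open>u\<close> and its gradient field \<open>G\<close>.
\<close>

definition has_weak_gradient ::
  "'a::euclidean_space set \<Rightarrow> ('a \<Rightarrow> real) \<Rightarrow> ('a \<Rightarrow> 'a) \<Rightarrow> bool" where
  "has_weak_gradient \<Omega> u G \<longleftrightarrow>
     u \<in> borel_measurable (lebesgue_on \<Omega>) \<and> G \<in> borel_measurable (lebesgue_on \<Omega>) \<and>
     (\<forall>K. compact K \<and> K \<subseteq> \<Omega> \<longrightarrow> integrable (lebesgue_on K) u \<and> integrable (lebesgue_on K) G) \<and>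
     (\<forall>\<phi>\<in>test_functions \<Omega>. \<forall>b\<in>Basis.
        (\<integral>x. u x * frechet_derivative \<phi> (at x) b \<partial>lebesgue_on \<Omega>)
          = - (\<integral>x. (G x \<bullet> b) * \<phi> x \<partial>lebesgue_on \<Omega>))"

text \<open>\<open>W1 \<Omega> q u G\<close>: the function \<open>u\<close> lies in $W^{1,q(x)}(\Omega)$ and \<open>\<nabla>u = G\<close>.\<close>

definition W1 ::
  "'a::euclidean_space set \<Rightarrow> ('a \<Rightarrow> real) \<Rightarrow> ('a \<Rightarrow> real) \<Rightarrow> ('a \<Rightarrow> 'a) \<Rightarrow> bool" where
  "W1 \<Omega> q u G \<longleftrightarrow> u \<in> var_Lp \<Omega> q \<and> has_weak_gradient \<Omega> u G \<and> (\<lambda>x. norm (G x)) \<in> var_Lp \<Omega> q"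

definition abs_cont_on_interval :: "real \<Rightarrow> real \<Rightarrow> (real \<Rightarrow> real) \<Rightarrow> bool" where
  "abs_cont_on_interval a b f \<longleftrightarrow> (\<forall>\<epsilon>>0. \<exists>\<eta>>0. \<forall>D. finite D \<and>
     (\<forall>(c, d)\<in>D. a \<le> c \<and> c \<le> d \<and> d \<le> b) \<and>
     pairwise (\<lambda>I J. {fst I<..<snd I} \<inter> {fst J<..<snd J} = {}) D \<and>
     (\<Sum>(c, d)\<in>D. d - c) < \<eta> \<longrightarrow> (\<Sum>(c, d)\<in>D. \<bar>f d - f c\<bar>) < \<epsilon>)"

definition loc_abs_cont_pos :: "(real \<Rightarrow> real) \<Rightarrow> bool" where
  "loc_abs_cont_pos f \<longleftrightarrow> (\<forall>a b. 0 < a \<and> a \<le> b \<longrightarrow> abs_cont_on_interval a b f)"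

definition flux :: "('a \<Rightarrow> real \<Rightarrow> real) \<Rightarrow> 'a \<Rightarrow> 'a::euclidean_space \<Rightarrow> 'a" where
  "flux \<Psi> x \<xi> = (if \<xi> = 0 then 0 else \<Psi> x (norm \<xi>) *\<^sub>R \<xi>)"

definition Phi_of :: "('a \<Rightarrow> real \<Rightarrow> real) \<Rightarrow> 'a \<Rightarrow> real \<Rightarrow> real" where
  "Phi_of \<Psi> x s = (if s = 0 then 0 else \<Psi> x \<bar>s\<bar> * \<bar>s\<bar>)"

definition A_of :: "('a \<Rightarrow> real \<Rightarrow> real) \<Rightarrow> 'a \<Rightarrow> 'a::euclidean_space \<Rightarrow> real" where
  "A_of \<Psi> x \<xi> = integral {0..norm \<xi>} (Phi_of \<Psi> x)"

text \<open>
  Since the Bochner integral of a non-integrable function is \<open>0\<close> by convention, the existence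
  of the three integrals in the weak formulation is stated explicitly. The homogeneous Neumann
  condition is encoded by testing against all of $W^{1,p(x)}(\Omega)$.
\<close>

definition weak_solution ::
  "'a::euclidean_space set \<Rightarrow> ('a \<Rightarrow> real) \<Rightarrow> ('a \<Rightarrow> real \<Rightarrow> real) \<Rightarrow> real \<Rightarrow> ('a \<Rightarrow> real)
     \<Rightarrow> ('a \<Rightarrow> real) \<Rightarrow> bool" where
  "weak_solution \<Omega> p \<Psi> \<Lambda> g V \<longleftrightarrow> (\<exists>G. W1 \<Omega> p V G \<and>
     (\<forall>\<phi> H. W1 \<Omega> p \<phi> H \<longrightarrow>
        integrable (lebesgue_on \<Omega>) (\<lambda>x. flux \<Psi> x (G x) \<bullet> H x) \<and>
        integrable (lebesgue_on \<Omega>) (\<lambda>x. V x * \<phi> x) \<and>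
        integrable (lebesgue_on \<Omega>) (\<lambda>x. g x * \<phi> x) \<and>
        (\<integral>x. flux \<Psi> x (G x) \<bullet> H x \<partial>lebesgue_on \<Omega>) + \<Lambda> * (\<integral>x. V x * \<phi> x \<partial>lebesgue_on \<Omega>)
          = (\<integral>x. g x * \<phi> x \<partial>lebesgue_on \<Omega>)))"

end

theory Submission
  imports Defs "HOL-Real_Asymp.Real_Asymp"
begin

text \<open>
  The solution is the minimiser of \<open>\<integral> A(x, \<nabla>v) + \<Lambda>/2 v\<^sup>2 - g v\<close>. Truncating \<open>v\<close> to \<open>[0, 1]\<close>
  does not increase this functional, because \<open>0 \<le> g/\<Lambda> \<le> 1\<close> and the gradient of a truncation
  is that of \<open>v\<close> or \<open>0\<close>; so it suffices to minimise among functions with values in \<open>[0, 1]\<close>,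
  and neither the embedding into \<open>L\<^sup>2\<close> nor the regularity of the boundary enters. Weak
  compactness is replaced by a choice of minimising sequence: among the near-minimisers, take
  those that nearly minimise the strictly convex integral of \<open>sqrt (1 + v\<^sup>2 + |\<nabla>v|\<^sup>2)\<close> as well.
  They converge in \<open>L\<^sup>1\<close> together with their gradients, and Fatou's lemma applies. Truncating
  the test functions makes the Euler-Lagrange equation hold for all of \<open>W\<^sup>1\<^sup>,\<^sup>p\<^sup>(\<^sup>x\<^sup>)\<close>. For
  uniqueness, test with the difference of two solutions and use that the flux is monotone.

  The gradient of a truncation comes from a chain rule, which rests on the convergence of
  difference quotients to the weak derivative, in \<open>L\<^sup>1\<close> on compact subsets.
\<close>

text \<open>The potential is convex in the gradient without a known rate, so near-minimisers of the
  energy may be far apart. The bracket has an explicit midpoint gap, which controls the distance of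
  two functions where both are bounded. Large values are handled by \<open>p x \<ge> pm > 1\<close>:
  coercivity bounds the modular of the gradient along a minimising sequence, hence a moment of order
  \<open>pm\<close> of the bracket, so little mass sits at large values. Values in
  \<open>[0, 1]\<close> make the lower order term bounded on both sides, which is why coercivity of
  the potential alone gives that bound.

  The positive part is not differentiable, so the chain rule is stated for differentiable functions
  and applied to regularisations. Its proof works with translates and a discrete integration by
  parts, in place of an approximation of \<open>u\<close> by smooth functions.

  The Euler-Lagrange equation is reached without differentiating the energy: the flux at a perturbed
  gradient bounds the energy increment from above, and continuity of the flux lets the perturbation
  tend to 0.\<close>

lemma integrable_bounded_mult_left:
  fixes f h :: "'a \<Rightarrow> real"
  assumes h: "h \<in> borel_measurable M" "AE x in M. \<bar>h x\<bar> \<le> c" and f: "integrable M f"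
  shows "integrable M (\<lambda>x. h x * f x)"
proof (rule Bochner_Integration.integrable_bound)
  show "integrable M (\<lambda>x. c * f x)"
    using f by simp
  show "AE x in M. norm (h x * f x) \<le> norm (c * f x)"
    using h(2) by eventually_elim (auto simp: abs_mult intro!: mult_right_mono)
qed (use h(1) f in \<open>auto dest!: borel_measurable_integrable\<close>)

lemma integrable_bounded_mult_right:
  fixes f h :: "'a \<Rightarrow> real"
  assumes "h \<in> borel_measurable M" "AE x in M. \<bar>h x\<bar> \<le> c" "integrable M f"
  shows "integrable M (\<lambda>x. f x * h x)"
  using integrable_bounded_mult_left[OF assms] by (simp only: mult.commute)

section \<open>Smooth bump functions\<close>

text \<open>Class \<open>C_k (Suc k)\<close> asks only for partial derivatives of class
  \<open>C_k k\<close>, so lower smoothness must be recovered. The product rule uses it, since one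
  factor there stays undifferentiated.\<close>

lemma C_k_Suc_imp: "C_k (Suc k) f \<Longrightarrow> C_k k f"
proof (induction k arbitrary: f)
  case 0
  then show ?case
    by (auto simp: continuous_on_eq_continuous_at intro: differentiable_imp_continuous_within)
qed auto

lemma C_k_const [simp]: "C_k k (\<lambda>x. c)"
  by (induction k arbitrary: c) (auto simp: frechet_derivative_const)

lemma C_k_add:
  fixes f g :: "'a::euclidean_space \<Rightarrow> real"
  shows "C_k k f \<Longrightarrow> C_k k g \<Longrightarrow> C_k k (\<lambda>x. f x + g x)"
proof (induction k arbitrary: f g)
  case (Suc k)
  have "frechet_derivative (\<lambda>x. f x + g x) (at x) =
      (\<lambda>y. frechet_derivative f (at x) y + frechet_derivative g (at x) y)" for x
    using Suc.prems
    by (intro frechet_derivative_at[symmetric] has_derivative_add) (auto simp: frechet_derivative_works)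
  with Suc show ?case
    by (auto intro: differentiable_add)
qed (auto intro: continuous_intros)

lemma C_k_mult:
  fixes f g :: "'a::euclidean_space \<Rightarrow> real"
  shows "C_k k f \<Longrightarrow> C_k k g \<Longrightarrow> C_k k (\<lambda>x. f x * g x)"
proof (induction k arbitrary: f g)
  case (Suc k)
  have "frechet_derivative (\<lambda>x. f x * g x) (at x) =
      (\<lambda>y. f x * frechet_derivative g (at x) y + frechet_derivative f (at x) y * g x)" for x
    using Suc.prems
    by (intro frechet_derivative_at[symmetric] has_derivative_mult) (auto simp: frechet_derivative_works)
  moreover have "C_k k f" "C_k k g"
    using Suc.prems by (auto intro: C_k_Suc_imp)
  ultimately show ?case
    using Suc by (auto intro: C_k_add)
qed (auto intro: continuous_intros)

lemma C_k_diff: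
  fixes f g :: "'a::euclidean_space \<Rightarrow> real"
  assumes "C_k k f" "C_k k g"
  shows "C_k k (\<lambda>x. f x - g x)"
  using C_k_add[OF assms(1) C_k_mult[OF C_k_const[of _ "-1"] assms(2)]] by simp

lemma C_k_prod:
  fixes f :: "'i \<Rightarrow> 'a::euclidean_space \<Rightarrow> real"
  shows "(\<And>i. i \<in> I \<Longrightarrow> C_k k (f i)) \<Longrightarrow> C_k k (\<lambda>x. \<Prod>i\<in>I. f i x)"
  by (induction I rule: infinite_finite_induct) (auto intro: C_k_mult)

lemma has_derivative_translate:
  fixes f :: "'a::euclidean_space \<Rightarrow> real"
  assumes "f differentiable at (x + a)"
  shows "((\<lambda>x. f (x + a)) has_derivative frechet_derivative f (at (x + a))) (at x)"
proof -
  have "((\<lambda>x. x + a) has_derivative (\<lambda>y. y)) (at x)"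
    by (auto intro!: derivative_eq_intros)
  from has_derivative_compose[OF this assms[unfolded frechet_derivative_works]]
  show ?thesis .
qed

lemma frechet_derivative_translate:
  fixes f :: "'a::euclidean_space \<Rightarrow> real"
  assumes "f differentiable at (x + a)"
  shows "frechet_derivative (\<lambda>x. f (x + a)) (at x) = frechet_derivative f (at (x + a))"
  by (rule frechet_derivative_at[symmetric, OF has_derivative_translate[OF assms]])

lemma C_k_translate:
  fixes f :: "'a::euclidean_space \<Rightarrow> real"
  shows "C_k k f \<Longrightarrow> C_k k (\<lambda>x. f (x + a))"
proof (induction k arbitrary: f)
  case 0
  then have "continuous_on UNIV f"
    by simp
  then have "continuous_on UNIV (\<lambda>x. f (x + a))"
    by (rule continuous_on_compose2) (auto intro: continuous_on_add continuous_on_const continuous_on_id)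
  then show ?case
    by simp
next
  case (Suc k)
  then show ?case
    by (auto simp: frechet_derivative_translate intro!: differentiableI[OF has_derivative_translate])
qed

text \<open>
  The functions \<open>t\<^sup>-\<^sup>m exp (-1/t)\<close>, extended by \<open>0\<close> to the left, are taken together because
  their linear span is closed under differentiation.
\<close>

definition flat_exp :: "nat \<Rightarrow> real \<Rightarrow> real" where
  "flat_exp m t = (if t \<le> 0 then 0 else exp (- (1 / t)) / t ^ m)"

lemma flat_exp_tendsto_0: "(flat_exp m \<longlongrightarrow> 0) (at_right 0)"
proof -
  have "((\<lambda>t::real. exp (- (1 / t)) / t ^ m) \<longlongrightarrow> 0) (at_right 0)"
    by real_asymp
  then show ?thesis
    by (rule tendsto_cong[THEN iffD1, rotated])
       (auto simp: flat_exp_def eventually_at_filter)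
qed

text \<open>The two terms come from differentiating the exponential and the power. At
  \<open>t = 0\<close> the decay of the exponential decides: dividing by \<open>h > 0\<close> only
  raises \<open>m\<close> by one.\<close>

lemma flat_exp_has_derivative:
  "(flat_exp m has_real_derivative flat_exp (m + 2) t - real m * flat_exp (m + 1) t) (at t)"
proof -
  consider "t < 0" | "t = 0" | "t > 0" by linarith
  then show ?thesis
  proof cases
    case 1
    have "((\<lambda>t. 0::real) has_real_derivative 0) (at t)"
      by simp
    then have "(flat_exp m has_real_derivative 0) (at t)"
      by (rule has_field_derivative_transform_within_open[where S="{..<0}"])
         (use 1 in \<open>auto simp: flat_exp_def\<close>)
    with 1 show ?thesis by (simp add: flat_exp_def)
  next
    case 2
    have "((\<lambda>h. flat_exp m h / h) \<longlongrightarrow> 0) (at 0)"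
    proof (rule filterlim_split_at)
      show "((\<lambda>h. flat_exp m h / h) \<longlongrightarrow> 0) (at_left 0)"
        by (rule tendsto_eventually) (auto simp: eventually_at_filter flat_exp_def)
      show "((\<lambda>h. flat_exp m h / h) \<longlongrightarrow> 0) (at_right 0)"
        using flat_exp_tendsto_0[of "Suc m"]
        by (rule tendsto_cong[THEN iffD1, rotated])
           (auto simp: flat_exp_def eventually_at_filter)
    qed
    with 2 show ?thesis
      by (simp add: has_field_derivative_iff flat_exp_def)
  next
    case 3
    have "((\<lambda>t. exp (- (1 / t)) / t ^ m) has_real_derivative
        flat_exp (m + 2) t - real m * flat_exp (m + 1) t) (at t)"
      using 3
      \<comment> \<open>The power rule produces the natural number exponent \<open>m - 1\<close>,
        hence the split into zero and successor.\<close>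
      apply (cases m)
       apply (auto intro!: derivative_eq_intros
          simp: flat_exp_def field_simps power2_eq_square power_add)
      subgoal for n by (cases n) auto
      done
    then show ?thesis
      by (rule has_field_derivative_transform_within_open[where S="{0<..}"])
         (use 3 in \<open>auto simp: flat_exp_def\<close>)
  qed
qed

text \<open>Affine arguments suffice because a box bump is a product of functions of single
  coordinates. The induction generalises over \<open>m\<close>, as each differentiation raises
  it.\<close>

lemma C_k_flat_exp_affine:
  fixes v :: "'a::euclidean_space"
  shows "C_k k (\<lambda>x. flat_exp m (x \<bullet> v + c))"
proof (induction k arbitrary: m)
  case 0
  have "isCont (flat_exp m) t" for t
    using flat_exp_has_derivative by (rule DERIV_isCont)
  then have "continuous_on UNIV (flat_exp m)"
    by (simp add: continuous_on_eq_continuous_at)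
  then show ?case
    by (auto intro!: continuous_on_compose2[of UNIV "flat_exp m"] continuous_intros)
next
  case (Suc k)
  have D: "((\<lambda>x. flat_exp m (x \<bullet> v + c)) has_derivative (\<lambda>y. (y \<bullet> v) *
      (flat_exp (m + 2) (x \<bullet> v + c) - real m * flat_exp (m + 1) (x \<bullet> v + c)))) (at x)" for x
  proof -
    have "((\<lambda>x. x \<bullet> v + c) has_derivative (\<lambda>y. y \<bullet> v)) (at x)"
      by (auto intro!: derivative_eq_intros)
    from has_derivative_compose[OF this flat_exp_has_derivative[unfolded has_field_derivative_def]]
    show ?thesis
      by (simp add: mult.commute)
  qed
  then have "frechet_derivative (\<lambda>x. flat_exp m (x \<bullet> v + c)) (at x) = (\<lambda>y. (y \<bullet> v) *
      (flat_exp (m + 2) (x \<bullet> v + c) - real m * flat_exp (m + 1) (x \<bullet> v + c)))" for x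
    by (intro frechet_derivative_at[symmetric])
  then show ?case
    using Suc D by (auto intro!: C_k_mult C_k_diff differentiableI)
qed

lemma flat_exp_0_bounds: "0 \<le> flat_exp 0 t" "flat_exp 0 t \<le> 1"
  by (auto simp: flat_exp_def)

lemma flat_exp_0_scaled_tendsto:
  "(\<lambda>n. flat_exp 0 (real n * t)) \<longlonglongrightarrow> (if t > 0 then 1 else 0)"
proof (cases "t > 0")
  case True
  have "(\<lambda>n. exp (- (1 / (real n * t)))) \<longlonglongrightarrow> 1"
    using True by real_asymp
  then show ?thesis
    using True
    by (rule_tac tendsto_cong[THEN iffD1, rotated])
       (auto simp: flat_exp_def eventually_sequentially mult_le_0_iff intro!: exI[of _ 1])
qed (auto simp: flat_exp_def mult_nonneg_nonpos)

text \<open>Each factor is positive exactly where its argument is, so the product lives inside the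
  open box. The steepness \<open>n\<close> makes the bumps tend to the indicator of the box, which
  avoids mollification.\<close>

definition box_bump :: "'a::euclidean_space \<Rightarrow> 'a \<Rightarrow> nat \<Rightarrow> 'a \<Rightarrow> real" where
  "box_bump l r n x = (\<Prod>b\<in>Basis. flat_exp 0 (real n * (x \<bullet> b - l \<bullet> b)) *
     flat_exp 0 (real n * (r \<bullet> b - x \<bullet> b)))"

lemma box_bump_bounds: "0 \<le> box_bump l r n x" "box_bump l r n x \<le> 1"
  unfolding box_bump_def
  by (auto intro!: prod_nonneg prod_le_1 mult_nonneg_nonneg mult_le_one flat_exp_0_bounds)

lemma box_bump_support: "box_bump l r n x \<noteq> 0 \<Longrightarrow> x \<in> box l r"
proof -
  assume "box_bump l r n x \<noteq> 0"
  then have *: "flat_exp 0 (real n * (x \<bullet> b - l \<bullet> b)) \<noteq> 0"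
    "flat_exp 0 (real n * (r \<bullet> b - x \<bullet> b)) \<noteq> 0" if "b \<in> Basis" for b
    using that by (auto simp: box_bump_def)
  have "l \<bullet> b < x \<bullet> b \<and> x \<bullet> b < r \<bullet> b" if "b \<in> Basis" for b
    using *[OF that] by (auto simp: flat_exp_def mult_le_0_iff split: if_splits)
  then show ?thesis
    by (auto simp: box_def)
qed

lemma box_bump_tendsto_indicator: "(\<lambda>n. box_bump l r n x) \<longlonglongrightarrow> indicator (box l r) x"
proof -
  have "(\<lambda>n. box_bump l r n x) \<longlonglongrightarrow>
      (\<Prod>b\<in>Basis. (if x \<bullet> b - l \<bullet> b > 0 then 1 else 0) *
         (if r \<bullet> b - x \<bullet> b > 0 then 1 else 0 :: real))"
    unfolding box_bump_def
    by (intro tendsto_prod tendsto_mult flat_exp_0_scaled_tendsto)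
  moreover have "(\<Prod>b\<in>Basis. (if x \<bullet> b - l \<bullet> b > 0 then 1 else 0) *
      (if r \<bullet> b - x \<bullet> b > 0 then 1 else 0 :: real)) = indicator (box l r) x"
    by (auto simp: box_def indicator_def intro!: prod.neutral)
  ultimately show ?thesis
    by simp
qed

lemma box_bump_test_function:
  assumes "cbox l r \<subseteq> \<Omega>"
  shows "box_bump l r n \<in> test_functions \<Omega>"
proof -
  have "closure {x. box_bump l r n x \<noteq> 0} \<subseteq> cbox l r"
    using box_bump_support[of l r n] box_subset_cbox[of l r]
    by (intro closure_minimal) (auto dest: subsetD)
  moreover from this have "compact (closure {x. box_bump l r n x \<noteq> 0})"
    by (auto intro: bounded_subset[OF bounded_cbox] simp: compact_eq_bounded_closed)
  moreover have "C_k k (\<lambda>x. box_bump l r n x)" for k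
  proof -
    have "C_k k (\<lambda>x. \<Prod>b\<in>Basis. flat_exp 0 (x \<bullet> (real n *\<^sub>R b) + (- (real n * (l \<bullet> b)))) *
        flat_exp 0 (x \<bullet> (- (real n *\<^sub>R b)) + real n * (r \<bullet> b)))"
      by (intro C_k_prod C_k_mult C_k_flat_exp_affine)
    moreover have "box_bump l r n x = (\<Prod>b\<in>Basis.
        flat_exp 0 (x \<bullet> (real n *\<^sub>R b) + (- (real n * (l \<bullet> b)))) *
        flat_exp 0 (x \<bullet> (- (real n *\<^sub>R b)) + real n * (r \<bullet> b)))" for x
      unfolding box_bump_def by (simp add: right_diff_distrib)
    ultimately show ?thesis
      by simp
  qed
  ultimately show ?thesis
    using assms unfolding test_functions_def by (intro CollectI conjI allI) auto
qed

section \<open>Test functions and the fundamental lemma\<close>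

lemma test_function_props:
  assumes "\<phi> \<in> test_functions \<Omega>"
  shows test_function_continuous: "continuous_on UNIV \<phi>"
    and test_function_differentiable: "\<phi> differentiable at x"
    and test_function_derivative_continuous:
      "b \<in> Basis \<Longrightarrow> continuous_on UNIV (\<lambda>x. frechet_derivative \<phi> (at x) b)"
    and test_function_support_compact: "compact (closure {x. \<phi> x \<noteq> 0})"
    and test_function_support: "closure {x. \<phi> x \<noteq> 0} \<subseteq> \<Omega>"
proof -
  have "C_k 0 \<phi>" "C_k 1 \<phi>"
    using assms by (auto simp: test_functions_def simp del: C_k.simps)
  then show "continuous_on UNIV \<phi>" "\<phi> differentiable at x"
    "b \<in> Basis \<Longrightarrow> continuous_on UNIV (\<lambda>x. frechet_derivative \<phi> (at x) b)"
    by auto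
  show "compact (closure {x. \<phi> x \<noteq> 0})" "closure {x. \<phi> x \<noteq> 0} \<subseteq> \<Omega>"
    using assms by (auto simp: test_functions_def)
qed

lemma test_function_derivative_eq_0:
  assumes "\<phi> \<in> test_functions \<Omega>" "x \<notin> closure {x. \<phi> x \<noteq> 0}"
  shows "frechet_derivative \<phi> (at x) = (\<lambda>_. 0)"
proof (rule frechet_derivative_at[symmetric])
  show "(\<phi> has_derivative (\<lambda>_. 0)) (at x)"
  proof (rule has_derivative_transform_within_open)
    show "((\<lambda>_. 0) has_derivative (\<lambda>_. 0)) (at x)" "open (- closure {x. \<phi> x \<noteq> 0})"
      by auto
  qed (use assms closure_subset[of "{x. \<phi> x \<noteq> 0}"] in auto)
qed

lemma bounded_if_compact_support:
  fixes f :: "'a::euclidean_space \<Rightarrow> real"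
  assumes "continuous_on UNIV f" "compact K" "\<And>x. x \<notin> K \<Longrightarrow> f x = 0"
  obtains B where "B \<ge> 0" "\<And>x. \<bar>f x\<bar> \<le> B"
proof -
  have "compact (f ` K)"
    using assms by (intro compact_continuous_image) (auto intro: continuous_on_subset)
  then obtain B where B: "B > 0" "\<forall>y\<in>f ` K. norm y \<le> B"
    using bounded_pos compact_imp_bounded by blast
  have "\<bar>f x\<bar> \<le> B" for x
    using B assms(3)[of x] by (cases "x \<in> K") auto
  with B(1) show ?thesis
    by (intro that[of B]) auto
qed

lemma test_function_bounded:
  assumes "\<phi> \<in> test_functions \<Omega>"
  obtains B where "B \<ge> 0" "\<And>x. \<bar>\<phi> x\<bar> \<le> B"
  using bounded_if_compact_support[OF test_function_continuous[OF assms]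
      test_function_support_compact[OF assms]] closure_subset[of "{x. \<phi> x \<noteq> 0}"]
  by (metis (mono_tags, lifting) mem_Collect_eq subsetD)

lemma test_function_derivative_bounded:
  assumes "\<phi> \<in> test_functions \<Omega>" "b \<in> Basis"
  obtains B where "B \<ge> 0" "\<And>x. \<bar>frechet_derivative \<phi> (at x) b\<bar> \<le> B"
  using bounded_if_compact_support[OF test_function_derivative_continuous[OF assms]
      test_function_support_compact[OF assms(1)]] test_function_derivative_eq_0[OF assms(1)]
  by metis

lemma test_function_translate:
  fixes \<phi> :: "'a::euclidean_space \<Rightarrow> real"
  assumes "\<phi> \<in> test_functions S" "\<And>x. x \<in> S \<Longrightarrow> x - a \<in> \<Omega>"
  shows "(\<lambda>x. \<phi> (x + a)) \<in> test_functions \<Omega>"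
proof -
  have "{x. \<phi> (x + a) \<noteq> 0} = (\<lambda>x. - a + x) ` {x. \<phi> x \<noteq> 0}"
    by (auto simp: image_iff intro!: exI[of _ "_ + a"])
  then have "closure {x. \<phi> (x + a) \<noteq> 0} = (\<lambda>x. - a + x) ` closure {x. \<phi> x \<noteq> 0}"
    by (metis closure_translation)
  moreover from this have "compact (closure {x. \<phi> (x + a) \<noteq> 0})"
    using compact_translation[OF test_function_support_compact[OF assms(1)]] by metis
  ultimately show ?thesis
    using assms test_function_support[OF assms(1)]
    by (auto simp: test_functions_def C_k_translate simp del: compact_closure)
qed

text \<open>Box bumps turn the hypothesis into vanishing integrals over all closed boxes in
  \<open>S\<close>. The Lebesgue differentiation theorem then gives \<open>w x = 0\<close> at almost
  every point, since small cubes at \<open>x\<close> stay inside the open set.\<close>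

lemma separation_by_test_functions:
  fixes w :: "'a::euclidean_space \<Rightarrow> real"
  assumes S: "open S" and w: "integrable lborel w"
    and 0: "\<And>\<phi>. \<phi> \<in> test_functions S \<Longrightarrow> (\<integral>x. w x * \<phi> x \<partial>lborel) = 0"
  shows "AE x in lborel. x \<in> S \<longrightarrow> w x = 0"
proof -
  have [measurable]: "w \<in> borel_measurable borel"
    using w by (auto dest: borel_measurable_integrable)
  have box0: "integral (cbox l r) w = 0" if "cbox l r \<subseteq> S" for l r
  proof -
    have meas: "box_bump l r n \<in> borel_measurable borel" for n
      using test_function_continuous[OF box_bump_test_function[OF that]]
      by (rule borel_measurable_continuous_onI)
    have "(\<lambda>n. \<integral>x. w x * box_bump l r n x \<partial>lborel)
        \<longlonglongrightarrow> (\<integral>x. w x * indicator (box l r) x \<partial>lborel)"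
    proof (rule integral_dominated_convergence)
      show "integrable lborel (\<lambda>x. \<bar>w x\<bar>)"
        using w by auto
      show "AE x in lborel. norm (w x * box_bump l r n x) \<le> \<bar>w x\<bar>" for n
        by (auto simp: abs_mult box_bump_bounds intro!: mult_left_le)
    qed (use meas in \<open>auto intro!: tendsto_mult box_bump_tendsto_indicator\<close>)
    then have "(\<integral>x. w x * indicator (box l r) x \<partial>lborel) = 0"
      using 0[OF box_bump_test_function[OF that]] by (simp add: LIMSEQ_const_iff)
    moreover have "set_integrable lborel (box l r) w"
      using w unfolding set_integrable_def
      by (intro integrable_mult_indicator) auto
    ultimately have "integral (box l r) w = 0"
      by (subst set_borel_integral_eq_integral(2)[symmetric])
         (auto simp: set_lebesgue_integral_def mult.commute)
    then show ?thesis
      by (simp add: integral_open_interval)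
  qed
  have int: "w integrable_on cbox l r" for l r
    using integrable_on_lborel[OF w] by (rule integrable_on_subcbox) auto
  \<comment> \<open>Lebesgue differentiation with cubes that have \<open>x\<close> as their lower
    corner.\<close>
  obtain N where N: "negligible N" "\<And>x e. x \<notin> N \<Longrightarrow> 0 < e \<Longrightarrow> \<exists>d>0. \<forall>h. 0 < h \<and> h < d \<longrightarrow>
      norm (integral (cbox x (x + h *\<^sub>R One)) w /\<^sub>R h ^ DIM('a) - w x) < e"
    using integrable_ccontinuous_explicit[OF int] by metis
  have "w x = 0" if x: "x \<in> S" "x \<notin> N" for x
  proof (rule ccontr)
    assume "w x \<noteq> 0"
    with N(2)[OF x(2), of "\<bar>w x\<bar>"] obtain d where d: "d > 0"
      "\<And>h. 0 < h \<Longrightarrow> h < d \<Longrightarrow>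
        norm (integral (cbox x (x + h *\<^sub>R One)) w /\<^sub>R h ^ DIM('a) - w x) < \<bar>w x\<bar>"
      by auto
    obtain e where e: "e > 0" "ball x e \<subseteq> S"
      using S x(1) openE by blast
    \<comment> \<open>The first bound stays below the differentiation threshold. The second keeps
      the cube in the ball, as the Euclidean norm is at most the sum of \<open>DIM('a)\<close>
      coordinates of size at most \<open>h\<close>.\<close>
    define h where "h = min (d / 2) (e / (2 * real DIM('a)))"
    have h: "h > 0" "h < d" "h * real DIM('a) < e"
      using d e by (auto simp: h_def min_def field_simps split: if_splits)
    have "cbox x (x + h *\<^sub>R One) \<subseteq> ball x e"
    proof
      fix y assume "y \<in> cbox x (x + h *\<^sub>R One)"
      then have "\<bar>(y - x) \<bullet> b\<bar> \<le> h" if "b \<in> Basis" for b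
        using that by (auto simp: mem_box inner_diff_left inner_add_left inner_sum_left
            inner_Basis abs_le_iff if_distrib sum.If_cases dest!: bspec[OF _ that])
      then have "norm (y - x) \<le> (\<Sum>b\<in>(Basis::'a set). h)"
        by (intro order.trans[OF norm_le_l1] sum_mono)
      then show "y \<in> ball x e"
        using h by (simp add: dist_norm norm_minus_commute mult.commute)
    qed
    then show False
      using d(2)[OF h(1,2)] box0[of x "x + h *\<^sub>R One"] e(2) by simp
  qed
  moreover have "AE x in lebesgue. x \<notin> N"
    using N(1) by (simp add: negligible_iff_null_sets AE_not_in)
  ultimately have "AE x in lebesgue. x \<in> S \<longrightarrow> w x = 0"
    by (auto elim: eventually_mono)
  then show ?thesis
    by (simp add: AE_completion_iff)
qed

section \<open>Continuity of translations in L1\<close>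

lemma integral_lborel_translate:
  fixes f :: "'a::euclidean_space \<Rightarrow> 'b::{banach, second_countable_topology}"
  assumes [measurable]: "f \<in> borel_measurable borel"
  shows "(\<integral>x. f (x + a) \<partial>lborel) = (\<integral>x. f x \<partial>lborel)"
    "integrable lborel (\<lambda>x. f (x + a)) \<longleftrightarrow> integrable lborel f"
proof -
  have *: "lborel = distr lborel borel (\<lambda>x. x + a)"
  proof -
    have "(+) a = (\<lambda>x. x + a)"
      by (simp add: fun_eq_iff add.commute)
    then show ?thesis
      using lborel_distr_plus[of a] by simp
  qed
  have "(\<integral>x. f x \<partial>lborel) = (\<integral>x. f x \<partial>distr lborel borel (\<lambda>x. x + a))"
    using * by simp
  also have "\<dots> = (\<integral>x. f (x + a) \<partial>lborel)"
    by (rule integral_distr) auto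
  finally show "(\<integral>x. f (x + a) \<partial>lborel) = (\<integral>x. f x \<partial>lborel)" ..
  have "integrable lborel f \<longleftrightarrow> integrable (distr lborel borel (\<lambda>x. x + a)) f"
    using * by simp
  also have "\<dots> \<longleftrightarrow> integrable lborel (\<lambda>x. f (x + a))"
    by (rule integrable_distr_eq) auto
  finally show "integrable lborel (\<lambda>x. f (x + a)) \<longleftrightarrow> integrable lborel f" ..
qed

lemma integrable_indicator_cball:
  "integrable lborel (indicator (cball c r) :: 'a::euclidean_space \<Rightarrow> real)"
  using emeasure_lborel_cball_finite[of c r] by (intro integrable_real_indicator) auto

lemma integrable_lborel_if_bounded_support:
  fixes h :: "'a::euclidean_space \<Rightarrow> real"
  assumes [measurable]: "h \<in> borel_measurable borel"
    and "\<And>x. \<bar>h x\<bar> \<le> B * indicator (cball 0 r) x"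
  shows "integrable lborel h"
proof (rule Bochner_Integration.integrable_bound)
  show "integrable lborel (\<lambda>x::'a. B * indicator (cball 0 r) x)"
    by (intro integrable_mult_right integrable_indicator_cball)
qed (use assms(2) in \<open>auto intro!: AE_I2 order.trans[OF assms(2)]\<close>)

text \<open>Clipping values by \<open>cl k\<close> and cutting off by \<open>\<rho> k\<close> gives
  a bounded approximation of \<open>w\<close> with bounded support. Continuous functions converging
  almost everywhere to \<open>w\<close> come with no integrable majorant, but the same clipping and
  cut-off provides one.\<close>

lemma L1_approximation_by_continuous:
  fixes w :: "'a::euclidean_space \<Rightarrow> real"
  assumes w: "integrable lborel w" and "e > 0"
  obtains h B r where "continuous_on UNIV h" "\<And>x. \<bar>h x\<bar> \<le> B * indicator (cball 0 r) x"
    "(\<integral>x. \<bar>w x - h x\<bar> \<partial>lborel) < e"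
proof -
  have [measurable]: "w \<in> borel_measurable borel"
    using w by (auto dest: borel_measurable_integrable)
  define cl :: "nat \<Rightarrow> real \<Rightarrow> real" where "cl k t = max (- real k) (min (real k) t)" for k t
  define \<rho> :: "nat \<Rightarrow> 'a \<Rightarrow> real" where "\<rho> k x = max 0 (min 1 (real k + 1 - norm x))" for k x
  have cl: "\<bar>cl k t\<bar> \<le> real k" "\<bar>cl k t\<bar> \<le> \<bar>t\<bar>" for k t
    by (auto simp: cl_def)
  have \<rho>: "0 \<le> \<rho> k x" "\<rho> k x \<le> indicator (cball 0 (real k + 1)) x" "\<rho> k x \<le> 1" for k x
    by (auto simp: \<rho>_def indicator_def)
  have [measurable]: "cl k \<in> borel_measurable borel" "\<rho> k \<in> borel_measurable borel" for k
    by (auto simp: cl_def[abs_def] \<rho>_def[abs_def])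
  have bnd: "\<bar>cl k s * \<rho> k x\<bar> \<le> real k * indicator (cball 0 (real k + 1)) x" for k s x
    using cl(1) \<rho>(1,2) by (auto simp: abs_mult intro!: mult_mono)
  have "(\<lambda>k. \<integral>x. \<bar>w x - cl k (w x) * \<rho> k x\<bar> \<partial>lborel) \<longlonglongrightarrow> (\<integral>x. 0 \<partial>(lborel :: 'a measure))"
  proof (rule integral_dominated_convergence)
    show "integrable lborel (\<lambda>x. 2 * \<bar>w x\<bar>)"
      using w by auto
    show "AE x in lborel. norm \<bar>w x - cl k (w x) * \<rho> k x\<bar> \<le> 2 * \<bar>w x\<bar>" for k
    proof (rule AE_I2)
      fix x
      have "\<bar>cl k (w x) * \<rho> k x\<bar> \<le> \<bar>w x\<bar> * 1"
        unfolding abs_mult using cl(2) \<rho>(1,3) by (intro mult_mono) auto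
      then show "norm \<bar>w x - cl k (w x) * \<rho> k x\<bar> \<le> 2 * \<bar>w x\<bar>"
        by simp
    qed
    show "AE x in lborel. (\<lambda>k. \<bar>w x - cl k (w x) * \<rho> k x\<bar>) \<longlonglongrightarrow> 0"
    proof (rule AE_I2, rule tendsto_eventually)
      fix x
      obtain k0 :: nat where "max \<bar>w x\<bar> (norm x) < real k0"
        using reals_Archimedean2 by blast
      then have "\<forall>k\<ge>k0. \<bar>w x - cl k (w x) * \<rho> k x\<bar> = 0"
        by (auto simp: cl_def \<rho>_def)
      then show "eventually (\<lambda>k. \<bar>w x - cl k (w x) * \<rho> k x\<bar> = 0) sequentially"
        unfolding eventually_sequentially by blast
    qed
  qed auto
  then have "eventually (\<lambda>k. (\<integral>x. \<bar>w x - cl k (w x) * \<rho> k x\<bar> \<partial>lborel) < e / 2) sequentially"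
    using \<open>e > 0\<close> by (intro order_tendstoD) auto
  then obtain k where k: "(\<integral>x. \<bar>w x - cl k (w x) * \<rho> k x\<bar> \<partial>lborel) < e / 2"
    by (auto simp: eventually_sequentially)
  \<comment> \<open>Measurability in the sense of the gauge integral supplies continuous functions
    that converge to \<open>w\<close> off a negligible set.\<close>
  have "w \<in> borel_measurable lebesgue"
    by (simp add: measurable_completion)
  then have "w measurable_on UNIV"
    by (rule lebesgue_measurable_imp_measurable_on) simp
  then obtain N g where N: "negligible N" and g: "\<And>n. continuous_on UNIV (g n)"
    and lim: "\<And>x. x \<notin> N \<Longrightarrow> (\<lambda>n. g n x) \<longlonglongrightarrow> w x"
    by (auto simp: measurable_on_def)
  have [measurable]: "g n \<in> borel_measurable borel" for n
    using g by (rule borel_measurable_continuous_onI)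
  have "AE x in lborel. x \<notin> N"
    using N AE_completion_iff[of "\<lambda>x. x \<notin> N" lborel]
    by (simp add: negligible_iff_null_sets AE_not_in)
  then have ae: "AE x in lborel. (\<lambda>n. cl k (g n x)) \<longlonglongrightarrow> cl k (w x)"
    by eventually_elim (auto simp: cl_def intro!: tendsto_intros lim)
  have "(\<lambda>n. \<integral>x. \<bar>cl k (w x) * \<rho> k x - cl k (g n x) * \<rho> k x\<bar> \<partial>lborel)
      \<longlonglongrightarrow> (\<integral>x. 0 \<partial>(lborel :: 'a measure))"
  proof (rule integral_dominated_convergence)
    show "integrable lborel (\<lambda>x::'a. 2 * (real k * indicator (cball 0 (real k + 1)) x))"
      by (intro integrable_mult_right integrable_indicator_cball)
    show "AE x in lborel. norm \<bar>cl k (w x) * \<rho> k x - cl k (g n x) * \<rho> k x\<bar>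
        \<le> 2 * (real k * indicator (cball 0 (real k + 1)) x)" for n
    proof (rule AE_I2)
      fix x
      show "norm \<bar>cl k (w x) * \<rho> k x - cl k (g n x) * \<rho> k x\<bar>
        \<le> 2 * (real k * indicator (cball 0 (real k + 1)) x)"
        using bnd[of k "w x" x] bnd[of k "g n x" x] unfolding real_norm_def by linarith
    qed
    show "AE x in lborel. (\<lambda>n. \<bar>cl k (w x) * \<rho> k x - cl k (g n x) * \<rho> k x\<bar>) \<longlonglongrightarrow> 0"
      using ae
    proof eventually_elim
      case (elim x)
      have "(\<lambda>n. \<bar>cl k (w x) * \<rho> k x - cl k (g n x) * \<rho> k x\<bar>)
          \<longlonglongrightarrow> \<bar>cl k (w x) * \<rho> k x - cl k (w x) * \<rho> k x\<bar>"
        by (intro tendsto_intros elim)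
      then show ?case by simp
    qed
  qed auto
  then have "eventually (\<lambda>n. (\<integral>x. \<bar>cl k (w x) * \<rho> k x - cl k (g n x) * \<rho> k x\<bar> \<partial>lborel) < e / 2)
      sequentially"
    using \<open>e > 0\<close> by (intro order_tendstoD) auto
  then obtain n where n: "(\<integral>x. \<bar>cl k (w x) * \<rho> k x - cl k (g n x) * \<rho> k x\<bar> \<partial>lborel) < e / 2"
    by (auto simp: eventually_sequentially)
  have i1: "integrable lborel (\<lambda>x. cl k (f x) * \<rho> k x)"
    if "f \<in> borel_measurable borel" for f :: "'a \<Rightarrow> real"
    by (rule integrable_lborel_if_bounded_support[OF _ bnd]) (use that in measurable)
  have "(\<integral>x. \<bar>w x - cl k (g n x) * \<rho> k x\<bar> \<partial>lborel) \<le>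
      (\<integral>x. \<bar>w x - cl k (w x) * \<rho> k x\<bar> + \<bar>cl k (w x) * \<rho> k x - cl k (g n x) * \<rho> k x\<bar> \<partial>lborel)"
    by (intro integral_mono integrable_abs Bochner_Integration.integrable_add Bochner_Integration.integrable_diff w i1)
       auto
  also have "\<dots> = (\<integral>x. \<bar>w x - cl k (w x) * \<rho> k x\<bar> \<partial>lborel) +
      (\<integral>x. \<bar>cl k (w x) * \<rho> k x - cl k (g n x) * \<rho> k x\<bar> \<partial>lborel)"
    by (intro Bochner_Integration.integral_add integrable_abs Bochner_Integration.integrable_diff w i1)
       auto
  also have "\<dots> < e"
    using k n by simp
  finally have *: "(\<integral>x. \<bar>w x - cl k (g n x) * \<rho> k x\<bar> \<partial>lborel) < e" .
  have "continuous_on UNIV (\<lambda>x. cl k (g n x) * \<rho> k x)"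
    unfolding cl_def \<rho>_def by (intro continuous_intros g)
  from this bnd * show thesis
    by (rule that)
qed

text \<open>Dominated convergence settles the case of a continuous \<open>h\<close> of bounded
  support close to \<open>w\<close>; the two remaining errors are equal, because the integral is
  translation invariant.\<close>

lemma L1_translation_tendsto:
  fixes w :: "'a::euclidean_space \<Rightarrow> real"
  assumes w: "integrable lborel w" and y: "y \<longlonglongrightarrow> 0"
  shows "(\<lambda>n. \<integral>x. \<bar>w (x + y n) - w x\<bar> \<partial>lborel) \<longlonglongrightarrow> 0"
proof (rule LIMSEQ_I)
  fix e :: real assume "e > 0"
  have [measurable]: "w \<in> borel_measurable borel"
    using w by (auto dest: borel_measurable_integrable)
  have wt: "integrable lborel (\<lambda>x. w (x + a))" for a
    using w by (simp add: integral_lborel_translate)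
  obtain h B r where h: "continuous_on UNIV h" "\<And>x. \<bar>h x\<bar> \<le> B * indicator (cball 0 r) x"
    and le: "(\<integral>x. \<bar>w x - h x\<bar> \<partial>lborel) < e / 3"
    using L1_approximation_by_continuous[OF w, of "e / 3"] \<open>e > 0\<close> by auto
  have [measurable]: "h \<in> borel_measurable borel"
    using h(1) by (rule borel_measurable_continuous_onI)
  have hi: "integrable lborel h"
    using h(2) by (intro integrable_lborel_if_bounded_support) auto
  have ht: "integrable lborel (\<lambda>x. h (x + a))" for a
    using hi by (simp add: integral_lborel_translate)
  \<comment> \<open>Shifts of length below 1 keep the support of the translated \<open>h\<close> in
    the ball of radius \<open>r + 1\<close>, which yields a common majorant.\<close>
  obtain n0 where n0: "\<And>n. n \<ge> n0 \<Longrightarrow> norm (y n) < 1"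
    using LIMSEQ_D[OF y, of 1] by auto
  have B: "0 \<le> B * indicator (cball 0 r) x" for x :: 'a
    using h(2)[of x] by linarith
  have "(\<lambda>n. \<integral>x. \<bar>h (x + y (n + n0)) - h x\<bar> \<partial>lborel) \<longlonglongrightarrow> (\<integral>x. 0 \<partial>(lborel :: 'a measure))"
  proof (rule integral_dominated_convergence)
    show "integrable lborel (\<lambda>x::'a. 2 * (\<bar>B\<bar> * indicator (cball 0 (r + 1)) x))"
      by (intro integrable_mult_right integrable_indicator_cball)
    show "AE x in lborel. norm \<bar>h (x + y (n + n0)) - h x\<bar>
        \<le> 2 * (\<bar>B\<bar> * indicator (cball 0 (r + 1)) x)" for n
    proof (rule AE_I2)
      fix x :: 'a
      have "norm x \<le> norm (x + y (n + n0)) + norm (y (n + n0))"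
        using norm_triangle_ineq4[of "x + y (n + n0)" "y (n + n0)"] by simp
      then have "\<bar>h (x + y (n + n0))\<bar> \<le> \<bar>B\<bar> * indicator (cball 0 (r + 1)) x"
        using h(2)[of "x + y (n + n0)"] n0[of "n + n0"]
        by (auto split: split_indicator split_indicator_asm)
      moreover have "\<bar>h x\<bar> \<le> \<bar>B\<bar> * indicator (cball 0 (r + 1)) x"
        using h(2)[of x] by (auto split: split_indicator split_indicator_asm)
      ultimately show "norm \<bar>h (x + y (n + n0)) - h x\<bar>
          \<le> 2 * (\<bar>B\<bar> * indicator (cball 0 (r + 1)) x)"
        unfolding real_norm_def by linarith
    qed
    show "AE x in lborel. (\<lambda>n. \<bar>h (x + y (n + n0)) - h x\<bar>) \<longlonglongrightarrow> 0"
    proof (rule AE_I2)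
      fix x
      have "(\<lambda>n. x + y (n + n0)) \<longlonglongrightarrow> x + 0"
        by (intro tendsto_add tendsto_const LIMSEQ_ignore_initial_segment y)
      then have "(\<lambda>n. h (x + y (n + n0))) \<longlonglongrightarrow> h (x + 0)"
        by (rule continuous_on_tendsto_compose[OF h(1)]) auto
      then have "(\<lambda>n. \<bar>h (x + y (n + n0)) - h x\<bar>) \<longlonglongrightarrow> \<bar>h (x + 0) - h x\<bar>"
        by (intro tendsto_intros)
      then show "(\<lambda>n. \<bar>h (x + y (n + n0)) - h x\<bar>) \<longlonglongrightarrow> 0"
        by simp
    qed
  qed auto
  then have "eventually (\<lambda>n. (\<integral>x. \<bar>h (x + y (n + n0)) - h x\<bar> \<partial>lborel) < e / 3) sequentially"
    using \<open>e > 0\<close> by (intro order_tendstoD) auto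
  then obtain n1 where n1: "\<And>n. n \<ge> n1 \<Longrightarrow> (\<integral>x. \<bar>h (x + y (n + n0)) - h x\<bar> \<partial>lborel) < e / 3"
    by (auto simp: eventually_sequentially)
  have "norm ((\<integral>x. \<bar>w (x + y n) - w x\<bar> \<partial>lborel) - 0) < e" if n: "n \<ge> n0 + n1" for n
  proof -
    have "(\<integral>x. \<bar>w (x + y n) - w x\<bar> \<partial>lborel) \<le>
      (\<integral>x. \<bar>w (x + y n) - h (x + y n)\<bar> + (\<bar>h (x + y n) - h x\<bar> + \<bar>w x - h x\<bar>) \<partial>lborel)"
      by (intro integral_mono integrable_abs Bochner_Integration.integrable_add
          Bochner_Integration.integrable_diff w wt hi ht) auto
    also have "\<dots> = (\<integral>x. \<bar>w (x + y n) - h (x + y n)\<bar> \<partial>lborel) +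
        ((\<integral>x. \<bar>h (x + y n) - h x\<bar> \<partial>lborel) + (\<integral>x. \<bar>w x - h x\<bar> \<partial>lborel))"
      by (subst Bochner_Integration.integral_add,
          intro integrable_abs Bochner_Integration.integrable_diff w wt hi ht,
          intro Bochner_Integration.integrable_add integrable_abs
            Bochner_Integration.integrable_diff w wt hi ht,
          subst Bochner_Integration.integral_add)
         (intro integrable_abs Bochner_Integration.integrable_diff w wt hi ht refl)+
    also have "(\<integral>x. \<bar>w (x + y n) - h (x + y n)\<bar> \<partial>lborel) = (\<integral>x. \<bar>w x - h x\<bar> \<partial>lborel)"
      by (rule integral_lborel_translate(1)) auto
    also have "(\<integral>x. \<bar>h (x + y n) - h x\<bar> \<partial>lborel) < e / 3"
      using n1[of "n - n0"] n by simp
    finally show ?thesis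
      using le by (simp add: integral_nonneg_AE)
  qed
  then show "\<exists>no. \<forall>n\<ge>no. norm ((\<integral>x. \<bar>w (x + y n) - w x\<bar> \<partial>lborel) - 0) < e"
    by blast
qed

section \<open>Difference quotients\<close>

text \<open>The uniform probability on \<open>[0, 1]\<close>, as a density on the whole line:
  measurability stays Borel on the line, and averages along a segment can be exchanged with
  integrals over space by Fubini.\<close>

definition unit_interval :: "real measure" where
  "unit_interval = density lborel (\<lambda>s. ennreal (indicator {0..1} s))"

lemma sets_unit_interval [measurable_cong, simp]: "sets unit_interval = sets borel"
  and space_unit_interval [simp]: "space unit_interval = UNIV"
  by (simp_all add: unit_interval_def)

lemma integral_unit_interval:
  fixes f :: "real \<Rightarrow> real"
  assumes [measurable]: "f \<in> borel_measurable borel"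
  shows "(\<integral>s. f s \<partial>unit_interval) = (\<integral>s. f s * indicator {0..1} s \<partial>lborel)"
  unfolding unit_interval_def by (subst integral_density) (auto simp: mult.commute)

lemma AE_unit_interval: "AE s in unit_interval. 0 \<le> s \<and> s \<le> 1"
  unfolding unit_interval_def by (subst AE_density) (auto intro!: AE_I2 split: split_indicator_asm)

lemma finite_measure_unit_interval: "finite_measure unit_interval"
  by (rule finite_measureI) (simp add: unit_interval_def emeasure_density ennreal_indicator)

interpretation unit_interval: finite_measure unit_interval
  by (rule finite_measure_unit_interval)

interpretation unit_lborel: pair_sigma_finite unit_interval "lborel :: 'a::euclidean_space measure"
  by unfold_locales

lemma measure_unit_interval [simp]: "measure unit_interval UNIV = 1"
  by (simp add: measure_def unit_interval_def emeasure_density ennreal_indicator)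

text \<open>This justifies exchanging a segment average with a space integral. With
  \<open>c = 0\<close> only the test function is shifted, with \<open>d = 0\<close> only the
  integrand; translation invariance bounds the inner integral by the same number for every
  \<open>s\<close>.\<close>

lemma integrable_shifts:
  fixes u \<psi> :: "'a::euclidean_space \<Rightarrow> real"
  assumes u: "integrable lborel u" and [measurable]: "\<psi> \<in> borel_measurable borel"
    and B: "\<And>x. \<bar>\<psi> x\<bar> \<le> B"
  shows "integrable (unit_interval \<Otimes>\<^sub>M lborel)
    (\<lambda>(s, x). u (x + (c * s) *\<^sub>R b) * \<psi> (x + (d * s) *\<^sub>R b))"
proof (rule unit_lborel.Fubini_integrable)
  have [measurable]: "u \<in> borel_measurable borel"
    using u by (auto dest: borel_measurable_integrable)
  show "(\<lambda>(s, x). u (x + (c * s) *\<^sub>R b) * \<psi> (x + (d * s) *\<^sub>R b))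
      \<in> borel_measurable (unit_interval \<Otimes>\<^sub>M lborel)"
    by measurable
  have ui: "integrable lborel (\<lambda>x. u (x + a))" for a
    using u by (simp add: integral_lborel_translate)
  have int: "integrable lborel (\<lambda>x. u (x + (c * s) *\<^sub>R b) * \<psi> (x + (d * s) *\<^sub>R b))" for s
    by (rule integrable_bounded_mult_right[OF _ _ ui, where c=B]) (use B in auto)
  then show "AE s in unit_interval. integrable lborel
      (\<lambda>x. case (s, x) of (s, x) \<Rightarrow> u (x + (c * s) *\<^sub>R b) * \<psi> (x + (d * s) *\<^sub>R b))"
    by simp
  show "integrable unit_interval (\<lambda>s. \<integral>x. norm (case (s, x) of
      (s, x) \<Rightarrow> u (x + (c * s) *\<^sub>R b) * \<psi> (x + (d * s) *\<^sub>R b)) \<partial>lborel)"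
  proof (rule unit_interval.integrable_const_bound)
    have "(\<integral>x. \<bar>u (x + (c * s) *\<^sub>R b) * \<psi> (x + (d * s) *\<^sub>R b)\<bar> \<partial>lborel) \<le>
        (\<integral>x. B * \<bar>u (x + (c * s) *\<^sub>R b)\<bar> \<partial>lborel)" for s
      using B by (intro integral_mono integrable_abs integrable_mult_right int ui)
        (auto simp: abs_mult mult.commute[of B] intro!: mult_left_mono)
    also have "\<dots> s = B * (\<integral>x. \<bar>u x\<bar> \<partial>lborel)" for s
      using integral_lborel_translate(1)[of "\<lambda>x. \<bar>u x\<bar>" "(c * s) *\<^sub>R b"] by simp
    finally show "AE s in unit_interval. norm (\<integral>x. norm (case (s, x) of
        (s, x) \<Rightarrow> u (x + (c * s) *\<^sub>R b) * \<psi> (x + (d * s) *\<^sub>R b)) \<partial>lborel)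
        \<le> B * (\<integral>x. \<bar>u x\<bar> \<partial>lborel)"
      by (auto simp: abs_mult)
  qed measurable
qed

text \<open>One component of a weak gradient, phrased with Borel functions on the whole space, where
  translation invariance and Fubini are at hand. Values of \<open>u\<close> and \<open>g\<close>
  outside \<open>\<Omega>\<close> do not enter, because test functions vanish there.\<close>

definition weak_partial ::
  "'a::euclidean_space set \<Rightarrow> 'a \<Rightarrow> ('a \<Rightarrow> real) \<Rightarrow> ('a \<Rightarrow> real) \<Rightarrow> bool" where
  "weak_partial \<Omega> b u g \<longleftrightarrow> (\<forall>\<phi>\<in>test_functions \<Omega>.
     (\<integral>x. u x * frechet_derivative \<phi> (at x) b \<partial>lborel) = - (\<integral>x. g x * \<phi> x \<partial>lborel))"

text \<open>The fundamental theorem of calculus along the segment from \<open>x\<close> to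
  \<open>x + t *\<^sub>R b\<close>, rescaled to \<open>[0, 1]\<close>.\<close>

lemma test_function_increment:
  assumes \<phi>: "\<phi> \<in> test_functions \<Omega>" and b: "b \<in> Basis"
  shows "\<phi> (x + t *\<^sub>R b) - \<phi> x =
    t * (\<integral>s. frechet_derivative \<phi> (at (x + (t * s) *\<^sub>R b)) b \<partial>unit_interval)"
proof -
  have cont: "continuous_on UNIV (\<lambda>s. frechet_derivative \<phi> (at (x + (t * s) *\<^sub>R b)) b)"
    by (rule continuous_on_compose2[OF test_function_derivative_continuous[OF \<phi> b]])
       (auto intro!: continuous_intros)
  then have [measurable]:
    "(\<lambda>s. frechet_derivative \<phi> (at (x + (t * s) *\<^sub>R b)) b) \<in> borel_measurable borel"
    by (rule borel_measurable_continuous_onI)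
  have "((\<lambda>s. \<phi> (x + (t * s) *\<^sub>R b)) has_real_derivative
      t * frechet_derivative \<phi> (at (x + (t * s) *\<^sub>R b)) b) (at s)" for s
  proof -
    have "((\<lambda>s. x + (t * s) *\<^sub>R b) has_derivative (\<lambda>h. (t * h) *\<^sub>R b)) (at s)"
      by (auto intro!: derivative_eq_intros)
    from has_derivative_compose[OF this
        test_function_differentiable[OF \<phi>, unfolded frechet_derivative_works]]
    moreover have "(\<lambda>h. frechet_derivative \<phi> (at (x + (t * s) *\<^sub>R b)) ((t * h) *\<^sub>R b)) =
        (*) (t * frechet_derivative \<phi> (at (x + (t * s) *\<^sub>R b)) b)"
      unfolding linear_cmul[OF linear_frechet_derivative[OF test_function_differentiable[OF \<phi>]]]
      by (simp add: fun_eq_iff)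
    ultimately show ?thesis
      by (simp add: has_field_derivative_def)
  qed
  then have "(\<integral>s. (t * frechet_derivative \<phi> (at (x + (t * s) *\<^sub>R b)) b) * indicator {0..1} s \<partial>lborel)
      = \<phi> (x + (t * 1) *\<^sub>R b) - \<phi> (x + (t * 0) *\<^sub>R b)"
    using cont by (intro integral_FTC_Icc_real)
      (auto simp: continuous_on_eq_continuous_at intro!: continuous_intros)
  then show ?thesis
    by (simp add: integral_unit_interval mult.assoc)
qed

text \<open>The smooth increment formula is passed to \<open>u\<close> by duality: the shift is
  moved to the test function, whose increment is an average of its derivatives, and the weak
  derivative is used for each shifted test function. The fundamental lemma then removes the test
  function.\<close>

lemma weak_partial_increment:
  fixes u g :: "'a::euclidean_space \<Rightarrow> real"
  assumes weak: "weak_partial \<Omega> b u g" and b: "b \<in> Basis" and S: "open S"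
    and u: "integrable lborel u" and g: "integrable lborel g"
    and shift: "\<And>x s. x \<in> S \<Longrightarrow> 0 \<le> s \<Longrightarrow> s \<le> 1 \<Longrightarrow> x + (t * s) *\<^sub>R b \<in> \<Omega>"
  shows "AE x in lborel. x \<in> S \<longrightarrow>
    u (x + t *\<^sub>R b) - u x = t * (\<integral>s. g (x + (t * s) *\<^sub>R b) \<partial>unit_interval)"
proof -
  have [measurable]: "u \<in> borel_measurable borel" "g \<in> borel_measurable borel"
    using u g by (auto dest: borel_measurable_integrable)
  define I where "I x = (\<integral>s. g (x + (t * s) *\<^sub>R b) \<partial>unit_interval)" for x
  have I: "integrable lborel I"
    unfolding I_def
    using unit_lborel.integrable_snd[OF integrable_shifts[OF g, of "\<lambda>_. 1" 1 t b 0]] by simp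
  have [measurable]: "I \<in> borel_measurable borel"
    using I by (auto dest: borel_measurable_integrable)
  have ut: "integrable lborel (\<lambda>x. u (x + a))" for a
    using u by (simp add: integral_lborel_translate)
  have "AE x in lborel. x \<in> S \<longrightarrow> u (x + t *\<^sub>R b) - u x - t * I x = 0"
  proof (rule separation_by_test_functions[OF S])
    show "integrable lborel (\<lambda>x. u (x + t *\<^sub>R b) - u x - t * I x)"
      by (intro Bochner_Integration.integrable_diff ut u integrable_mult_right I)
    fix \<phi> assume \<phi>: "\<phi> \<in> test_functions S"
    define \<psi> where "\<psi> x = frechet_derivative \<phi> (at x) b" for x
    have meas [measurable]: "\<phi> \<in> borel_measurable borel" "\<psi> \<in> borel_measurable borel"
      using test_function_continuous[OF \<phi>] test_function_derivative_continuous[OF \<phi> b]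
      by (auto simp: \<psi>_def[abs_def] intro: borel_measurable_continuous_onI)
    obtain B where B: "\<And>x. \<bar>\<phi> x\<bar> \<le> B"
      using test_function_bounded[OF \<phi>] by metis
    obtain C where C: "\<And>x. \<bar>\<psi> x\<bar> \<le> C"
      using test_function_derivative_bounded[OF \<phi> b] unfolding \<psi>_def by metis
    have i\<phi>: "integrable lborel (\<lambda>x. f x * \<phi> (x + a))" if f: "integrable lborel f" for f a
      by (rule integrable_bounded_mult_right[OF _ _ f, where c=B]) (use B in auto)
    \<comment> \<open>Substituting \<open>x - t *\<^sub>R b\<close> for \<open>x\<close> moves the
      shift onto the test function with the opposite sign.\<close>
    have "(\<integral>x. u (x + t *\<^sub>R b) * \<phi> x \<partial>lborel) = (\<integral>x. u x * \<phi> (x + (- t) *\<^sub>R b) \<partial>lborel)"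
      using integral_lborel_translate(1)[of "\<lambda>x. u (x + t *\<^sub>R b) * \<phi> x" "- (t *\<^sub>R b)"] by simp
    then have "(\<integral>x. u (x + t *\<^sub>R b) * \<phi> x \<partial>lborel) - (\<integral>x. u x * \<phi> x \<partial>lborel) =
        (\<integral>x. u x * (\<phi> (x + (- t) *\<^sub>R b) - \<phi> x) \<partial>lborel)"
      using i\<phi>[OF u, of "- (t *\<^sub>R b)"] i\<phi>[OF u, of 0] by (simp add: algebra_simps)
    also have "\<dots> = (\<integral>x. (- t) * (\<integral>s. u x * \<psi> (x + (- t * s) *\<^sub>R b) \<partial>unit_interval) \<partial>lborel)"
      unfolding test_function_increment[OF \<phi> b, of _ "- t"] \<psi>_def by (simp add: mult_ac)
    also have "\<dots> = (- t) * (\<integral>x. (\<integral>s. u x * \<psi> (x + (- t * s) *\<^sub>R b) \<partial>unit_interval) \<partial>lborel)"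
      by (rule integral_mult_right_zero)
    also have "(\<integral>x. (\<integral>s. u x * \<psi> (x + (- t * s) *\<^sub>R b) \<partial>unit_interval) \<partial>lborel) =
        (\<integral>s. (\<integral>x. u x * \<psi> (x + (- t * s) *\<^sub>R b) \<partial>lborel) \<partial>unit_interval)"
      using integrable_shifts[OF u meas(2) C, where c=0 and b=b and d="- t"]
      by (intro unit_lborel.Fubini_integral) simp
    also have "\<dots> = (\<integral>s. - (\<integral>x. g (x + (t * s) *\<^sub>R b) * \<phi> x \<partial>lborel) \<partial>unit_interval)"
    proof (rule integral_cong_AE)
      show "AE s in unit_interval. (\<integral>x. u x * \<psi> (x + (- t * s) *\<^sub>R b) \<partial>lborel) =
          - (\<integral>x. g (x + (t * s) *\<^sub>R b) * \<phi> x \<partial>lborel)"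
        using AE_unit_interval
      proof eventually_elim
        case (elim s)
        \<comment> \<open>Its support is that of \<open>\<phi>\<close> moved by
          \<open>(t * s) *\<^sub>R b\<close>, hence inside \<open>\<Omega>\<close> by the assumption
          \<open>shift\<close>.\<close>
        have *: "(\<lambda>x. \<phi> (x + (- t * s) *\<^sub>R b)) \<in> test_functions \<Omega>"
          using shift elim by (intro test_function_translate[OF \<phi>]) auto
        have "(\<integral>x. u x * \<psi> (x + (- t * s) *\<^sub>R b) \<partial>lborel) =
            - (\<integral>x. g x * \<phi> (x + (- t * s) *\<^sub>R b) \<partial>lborel)"
          using weak[unfolded weak_partial_def, rule_format, OF *]
          by (simp only: frechet_derivative_translate[OF test_function_differentiable[OF \<phi>]] \<psi>_def)
        also have "(\<integral>x. g x * \<phi> (x + (- t * s) *\<^sub>R b) \<partial>lborel) =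
            (\<integral>x. g (x + (t * s) *\<^sub>R b) * \<phi> x \<partial>lborel)"
          using integral_lborel_translate(1)[of "\<lambda>x. g x * \<phi> (x + (- t * s) *\<^sub>R b)" "(t * s) *\<^sub>R b"]
          by simp
        finally show ?case .
      qed
    qed measurable
    also have "\<dots> = - (\<integral>x. (\<integral>s. g (x + (t * s) *\<^sub>R b) * \<phi> x \<partial>unit_interval) \<partial>lborel)"
      using unit_lborel.Fubini_integral[of "\<lambda>s x. g (x + (t * s) *\<^sub>R b) * \<phi> x"]
        integrable_shifts[OF g meas(1) B, where c=t and b=b and d=0] by simp
    also have "\<dots> = - (\<integral>x. I x * \<phi> x \<partial>lborel)"
      by (simp add: I_def)
    finally have "(\<integral>x. u (x + t *\<^sub>R b) * \<phi> x \<partial>lborel) - (\<integral>x. u x * \<phi> x \<partial>lborel) =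
        t * (\<integral>x. I x * \<phi> x \<partial>lborel)"
      by simp
    then show "(\<integral>x. (u (x + t *\<^sub>R b) - u x - t * I x) * \<phi> x \<partial>lborel) = 0"
      using i\<phi>[OF u, of 0] i\<phi>[OF ut[of "t *\<^sub>R b"], of 0] i\<phi>[OF I, of 0]
      by (simp add: left_diff_distrib mult.assoc)
  qed
  then show ?thesis
    by eventually_elim (simp add: I_def)
qed

text \<open>Near \<open>K\<close> the quotient equals the average of \<open>g\<close> along a short
  segment, so the error is at most an average of L1 distances between \<open>g\<close> and its
  translates, which vanish with \<open>t\<close>.\<close>

lemma L1_difference_quotient_tendsto:
  fixes u g :: "'a::euclidean_space \<Rightarrow> real"
  assumes weak: "weak_partial \<Omega> b u g" and b: "b \<in> Basis"
    and u: "integrable lborel u" and g: "integrable lborel g"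
    and "open \<Omega>" "compact K" "K \<subseteq> \<Omega>"
    and t: "t \<longlonglongrightarrow> 0" "\<And>n. t n > 0"
  shows "(\<lambda>n. \<integral>x. indicator K x * \<bar>(u (x + t n *\<^sub>R b) - u x) / t n - g x\<bar> \<partial>lborel) \<longlonglongrightarrow> 0"
proof (rule tendsto_sandwich[where f="\<lambda>_. 0"])
  have [measurable]: "u \<in> borel_measurable borel" "g \<in> borel_measurable borel" "K \<in> sets borel"
    using u g \<open>compact K\<close> by (auto dest: borel_measurable_integrable compact_imp_closed)
  define \<omega> where "\<omega> y = (\<integral>x. \<bar>g (x + y) - g x\<bar> \<partial>lborel)" for y
  have gt: "integrable lborel (\<lambda>x. g (x + a))" for a
    using g by (simp add: integral_lborel_translate)
  obtain e where e: "e > 0" "(\<Union>x\<in>K. ball x e) \<subseteq> \<Omega>"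
    using compact_subset_open_imp_ball_epsilon_subset assms(5-7) by metis
  \<comment> \<open>Half of the room around \<open>K\<close> is kept in reserve: points of
    \<open>S\<close> shifted by less than \<open>e / 2\<close> are still within \<open>e\<close> of
    \<open>K\<close>.\<close>
  define S where "S = (\<Union>x\<in>K. ball x (e / 2))"
  have S: "open S" "K \<subseteq> S"
    using e by (auto simp: S_def)
  have i: "integrable (unit_interval \<Otimes>\<^sub>M lborel) (\<lambda>(s, x). \<bar>g (x + (c * s) *\<^sub>R b) - g x\<bar>)" for c
    using integrable_abs[OF Bochner_Integration.integrable_diff[OF
        integrable_shifts[OF g, of "\<lambda>_. 1" 1 c b 0] integrable_shifts[OF g, of "\<lambda>_. 1" 1 0 b 0]]]
    by (simp add: case_prod_unfold)
  show "eventually (\<lambda>n. (\<integral>x. indicator K x * \<bar>(u (x + t n *\<^sub>R b) - u x) / t n - g x\<bar> \<partial>lborel) \<le>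
      (\<integral>s. \<omega> ((t n * s) *\<^sub>R b) \<partial>unit_interval)) sequentially"
    using order_tendstoD(2)[OF t(1) half_gt_zero[OF e(1)]]
  proof eventually_elim
    case n: (elim n)
    have "AE x in lborel. x \<in> S \<longrightarrow>
        u (x + t n *\<^sub>R b) - u x = t n * (\<integral>s. g (x + (t n * s) *\<^sub>R b) \<partial>unit_interval)"
    proof (rule weak_partial_increment[OF weak b S(1) u g])
      fix x :: 'a and s :: real
      assume "x \<in> S" and s: "0 \<le> s" "s \<le> 1"
      then obtain z where z: "z \<in> K" "dist z x < e / 2"
        by (auto simp: S_def)
      have "dist x (x + (t n * s) *\<^sub>R b) = t n * s"
        using b t(2)[of n] s by (simp add: dist_norm)
      also have "\<dots> \<le> t n"
        using t(2)[of n] s by (simp add: mult_left_le)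
      finally have "dist z (x + (t n * s) *\<^sub>R b) < e"
        using z n dist_triangle[of z "x + (t n * s) *\<^sub>R b" x] by simp
      with z e show "x + (t n * s) *\<^sub>R b \<in> \<Omega>"
        by (auto simp: subset_iff)
    qed
    moreover have "AE x in lborel. integrable unit_interval (\<lambda>s. g (x + (t n * s) *\<^sub>R b))"
      using unit_lborel.AE_integrable_snd[OF integrable_shifts[OF g, of "\<lambda>_. 1" 1 "t n" b 0]] by simp
    ultimately have ae: "AE x in lborel. indicator K x * \<bar>(u (x + t n *\<^sub>R b) - u x) / t n - g x\<bar>
        \<le> (\<integral>s. \<bar>g (x + (t n * s) *\<^sub>R b) - g x\<bar> \<partial>unit_interval)"
    proof eventually_elim
      case (elim x)
      show ?case
      proof (cases "x \<in> K")
        case True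
        \<comment> \<open>The constant \<open>g x\<close> enters the average because
          \<open>unit_interval\<close> has total mass 1.\<close>
        then have "\<bar>(u (x + t n *\<^sub>R b) - u x) / t n - g x\<bar> =
            \<bar>(\<integral>s. g (x + (t n * s) *\<^sub>R b) - g x \<partial>unit_interval)\<bar>"
          using elim S(2) t(2)[of n] by (auto simp: unit_interval.integrable_const)
        also have "\<dots> \<le> (\<integral>s. \<bar>g (x + (t n * s) *\<^sub>R b) - g x\<bar> \<partial>unit_interval)"
          by (rule integral_abs_bound)
        finally show ?thesis using True by simp
      qed simp
    qed
    have "(\<integral>x. indicator K x * \<bar>(u (x + t n *\<^sub>R b) - u x) / t n - g x\<bar> \<partial>lborel) \<le>
        (\<integral>x. (\<integral>s. \<bar>g (x + (t n * s) *\<^sub>R b) - g x\<bar> \<partial>unit_interval) \<partial>lborel)"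
      using ae by (intro integral_mono_AE' unit_lborel.integrable_snd i) auto
    also have "\<dots> = (\<integral>s. \<omega> ((t n * s) *\<^sub>R b) \<partial>unit_interval)"
      unfolding \<omega>_def by (rule unit_lborel.Fubini_integral[OF i])
    finally show ?case .
  qed
  have \<omega>: "\<bar>\<omega> y\<bar> \<le> 2 * (\<integral>x. \<bar>g x\<bar> \<partial>lborel)" for y
  proof -
    have "\<bar>\<omega> y\<bar> = \<omega> y"
      by (simp add: \<omega>_def integral_nonneg_AE)
    also have "\<dots> \<le> (\<integral>x. \<bar>g (x + y)\<bar> + \<bar>g x\<bar> \<partial>lborel)"
      unfolding \<omega>_def
      by (intro integral_mono integrable_abs Bochner_Integration.integrable_diff
          Bochner_Integration.integrable_add g gt) auto
    also have "\<dots> = 2 * (\<integral>x. \<bar>g x\<bar> \<partial>lborel)"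
      using integral_lborel_translate(1)[of "\<lambda>x. \<bar>g x\<bar>" y] gt[of y] g by simp
    finally show ?thesis .
  qed
  have [measurable]: "(\<lambda>s. \<omega> ((c * s) *\<^sub>R b)) \<in> borel_measurable borel" for c
    unfolding \<omega>_def by measurable
  have "(\<lambda>n. \<integral>s. \<omega> ((t n * s) *\<^sub>R b) \<partial>unit_interval) \<longlonglongrightarrow> (\<integral>s. 0 \<partial>unit_interval)"
  proof (rule integral_dominated_convergence)
    show "integrable unit_interval (\<lambda>s. 2 * (\<integral>x. \<bar>g x\<bar> \<partial>lborel))"
      by (rule unit_interval.integrable_const)
    show "AE s in unit_interval. (\<lambda>n. \<omega> ((t n * s) *\<^sub>R b)) \<longlonglongrightarrow> 0"
    proof (rule AE_I2)
      fix s
      have "(\<lambda>n. (t n * s) *\<^sub>R b) \<longlonglongrightarrow> (0 * s) *\<^sub>R b"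
        by (intro tendsto_intros t)
      then show "(\<lambda>n. \<omega> ((t n * s) *\<^sub>R b)) \<longlonglongrightarrow> 0"
        unfolding \<omega>_def by (intro L1_translation_tendsto[OF g]) simp
    qed
    show "AE s in unit_interval. norm (\<omega> ((t n * s) *\<^sub>R b)) \<le> 2 * (\<integral>x. \<bar>g x\<bar> \<partial>lborel)" for n
      using \<omega> by auto
  qed measurable
  then show "(\<lambda>n. \<integral>s. \<omega> ((t n * s) *\<^sub>R b) \<partial>unit_interval) \<longlonglongrightarrow> 0"
    by simp
qed (auto intro!: always_eventually integral_nonneg_AE)

text \<open>A discrete chain rule carries the proof: the quotient of \<open>f (u x)\<close> is
  \<open>m n x * D n x\<close>, where \<open>m\<close> is a difference quotient of \<open>f\<close>
  between two values of \<open>u\<close>, and \<open>D\<close> is that of \<open>u\<close>. As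
  \<open>m\<close> is bounded by 1, convergence of \<open>D\<close> to \<open>g\<close> in L1 on the
  support of \<open>\<phi>\<close> is enough, while \<open>m\<close> need only converge almost
  everywhere. A discrete integration by parts brings in the derivative of
  \<open>\<phi>\<close>.\<close>

lemma weak_partial_chain_rule:
  fixes u g :: "'a::euclidean_space \<Rightarrow> real"
  assumes weak: "weak_partial \<Omega> b u g" and b: "b \<in> Basis" and \<Omega>: "open \<Omega>"
    and u: "integrable lborel u" and g: "integrable lborel g"
    and f: "\<And>s. (f has_real_derivative f' s) (at s)" "\<And>s. \<bar>f' s\<bar> \<le> 1" "f 0 = 0"
    and f'[measurable]: "f' \<in> borel_measurable borel"
  shows "weak_partial \<Omega> b (\<lambda>x. f (u x)) (\<lambda>x. f' (u x) * g x)"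
  unfolding weak_partial_def
proof
  fix \<phi> assume \<phi>: "\<phi> \<in> test_functions \<Omega>"
  define \<psi> where "\<psi> x = frechet_derivative \<phi> (at x) b" for x
  define K where "K = closure {x. \<phi> x \<noteq> 0}"
  define t where "t n = inverse (real (Suc n))" for n
  have K: "compact K" "K \<subseteq> \<Omega>" "\<And>x. x \<notin> K \<Longrightarrow> \<phi> x = 0"
    using test_function_support_compact[OF \<phi>] test_function_support[OF \<phi>]
      closure_subset[of "{x. \<phi> x \<noteq> 0}"] by (auto simp: K_def)
  have t: "t \<longlonglongrightarrow> 0" "\<And>n. t n > 0"
    unfolding t_def[abs_def] by (rule LIMSEQ_inverse_real_of_nat) simp
  have "continuous_on UNIV f"
    using f(1) by (meson DERIV_isCont continuous_at_imp_continuous_on)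
  then have [measurable]: "f \<in> borel_measurable borel"
    by (rule borel_measurable_continuous_onI)
  have [measurable]: "\<phi> \<in> borel_measurable borel" "\<psi> \<in> borel_measurable borel"
      "u \<in> borel_measurable borel" "g \<in> borel_measurable borel" "K \<in> sets borel"
    using test_function_continuous[OF \<phi>] test_function_derivative_continuous[OF \<phi> b] u g K(1)
    by (auto simp: \<psi>_def[abs_def] intro: borel_measurable_continuous_onI
        dest: borel_measurable_integrable compact_imp_closed)
  obtain B where B: "B \<ge> 0" "\<And>x. \<bar>\<phi> x\<bar> \<le> B"
    using test_function_bounded[OF \<phi>] by metis
  obtain C where C: "C \<ge> 0" "\<And>x. \<bar>\<psi> x\<bar> \<le> C"
    using test_function_derivative_bounded[OF \<phi> b] unfolding \<psi>_def by metis
  have lip: "\<bar>f s - f r\<bar> \<le> \<bar>s - r\<bar>" for s r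
    using field_differentiable_bound[of UNIV f f' 1 s r] f by auto
  then have f_le: "\<bar>f s\<bar> \<le> \<bar>s\<bar>" for s
    using f(3) by (metis diff_zero)
  have ut: "integrable lborel (\<lambda>x. u (x + a))" for a
    using u by (simp add: integral_lborel_translate)
  have i\<phi>: "integrable lborel (\<lambda>x. h x * \<phi> x)" if h: "integrable lborel h" for h
    by (rule integrable_bounded_mult_right[OF _ _ h, where c=B]) (use B in auto)

  define D where "D n x = (u (x + t n *\<^sub>R b) - u x) / t n" for n x
  \<comment> \<open>Where \<open>u\<close> does not change, any value keeps the product formula
    \<open>mD\<close> true; \<open>f' (u x)\<close> is chosen so that the limit is right there as
    well.\<close>
  define m where "m n x = (if u (x + t n *\<^sub>R b) = u x then f' (u x) else
    (f (u (x + t n *\<^sub>R b)) - f (u x)) / (u (x + t n *\<^sub>R b) - u x))" for n x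
  have [measurable]: "D n \<in> borel_measurable borel" "m n \<in> borel_measurable borel" for n
    by (auto simp: D_def[abs_def] m_def[abs_def])
  have m_le: "\<bar>m n x\<bar> \<le> 1" for n x
    using lip[of "u (x + t n *\<^sub>R b)" "u x"] f(2) by (auto simp: m_def divide_le_eq_1 abs_divide)
  have mD: "(f (u (x + t n *\<^sub>R b)) - f (u x)) / t n = m n x * D n x" for n x
    using t(2)[of n] by (auto simp: m_def D_def)
  have Di: "integrable lborel (D n)" for n
    unfolding D_def[abs_def] by (intro integrable_divide Bochner_Integration.integrable_diff u ut)
  have lim1: "(\<lambda>n. \<integral>x. indicator K x * \<bar>D n x - g x\<bar> \<partial>lborel) \<longlonglongrightarrow> 0"
    unfolding D_def by (rule L1_difference_quotient_tendsto[OF weak b u g \<Omega> K(1,2) t])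

  have iK: "integrable lborel (\<lambda>x. indicator K x * h x)" if "integrable lborel h"
    for h :: "'a \<Rightarrow> real"
    using integrable_mult_indicator[of K lborel h] that by simp
  \<comment> \<open>The increment of \<open>u\<close> is \<open>t n\<close> times its quotient, so
    it tends to 0 in L1 on \<open>K\<close>. Almost everywhere convergence, which is what the limit
    of \<open>m\<close> requires, then holds along a subsequence \<open>r\<close>.\<close>
  have "(\<lambda>n. \<integral>x. norm (indicator K x * (u (x + t n *\<^sub>R b) - u x)) \<partial>lborel) \<longlonglongrightarrow> 0"
  proof (rule tendsto_sandwich[where f="\<lambda>_. 0"])
    have "(\<lambda>n. t n * (\<integral>x. indicator K x * \<bar>D n x - g x\<bar> \<partial>lborel) + t n * (\<integral>x. \<bar>g x\<bar> \<partial>lborel))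
        \<longlonglongrightarrow> 0 * 0 + 0 * (\<integral>x. \<bar>g x\<bar> \<partial>lborel)"
      by (intro tendsto_intros t lim1)
    then show "(\<lambda>n. t n * (\<integral>x. indicator K x * \<bar>D n x - g x\<bar> \<partial>lborel) +
        t n * (\<integral>x. \<bar>g x\<bar> \<partial>lborel)) \<longlonglongrightarrow> 0"
      by simp
    have "(\<integral>x. norm (indicator K x * (u (x + t n *\<^sub>R b) - u x)) \<partial>lborel) \<le>
        (\<integral>x. t n * (indicator K x * \<bar>D n x - g x\<bar>) + t n * \<bar>g x\<bar> \<partial>lborel)" for n
    proof (rule integral_mono)
      show "integrable lborel (\<lambda>x. norm (indicator K x * (u (x + t n *\<^sub>R b) - u x)))"
        by (intro integrable_norm iK Bochner_Integration.integrable_diff u ut)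
      show "integrable lborel (\<lambda>x. t n * (indicator K x * \<bar>D n x - g x\<bar>) + t n * \<bar>g x\<bar>)"
        by (intro Bochner_Integration.integrable_add integrable_mult_right iK integrable_abs
            Bochner_Integration.integrable_diff Di g)
      fix x
      have "\<bar>D n x\<bar> \<le> \<bar>D n x - g x\<bar> + \<bar>g x\<bar>"
        by linarith
      then have "t n * \<bar>D n x\<bar> \<le> t n * \<bar>D n x - g x\<bar> + t n * \<bar>g x\<bar>"
        using t(2)[of n] by (metis distrib_left less_imp_le mult_left_mono)
      moreover have "t n * \<bar>D n x\<bar> = \<bar>u (x + t n *\<^sub>R b) - u x\<bar>"
        using t(2)[of n] by (simp add: D_def abs_divide)
      moreover have "0 \<le> t n * \<bar>g x\<bar>"
        using t(2)[of n] by simp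
      ultimately show "norm (indicator K x * (u (x + t n *\<^sub>R b) - u x)) \<le>
          t n * (indicator K x * \<bar>D n x - g x\<bar>) + t n * \<bar>g x\<bar>"
        by (auto split: split_indicator)
    qed
    also have "\<dots> n = t n * (\<integral>x. indicator K x * \<bar>D n x - g x\<bar> \<partial>lborel) +
        t n * (\<integral>x. \<bar>g x\<bar> \<partial>lborel)" for n
      by (subst Bochner_Integration.integral_add)
         (auto intro!: integrable_mult_right iK integrable_abs Bochner_Integration.integrable_diff Di g)
    finally show "\<forall>\<^sub>F n in sequentially. (\<integral>x. norm (indicator K x * (u (x + t n *\<^sub>R b) - u x)) \<partial>lborel)
        \<le> t n * (\<integral>x. indicator K x * \<bar>D n x - g x\<bar> \<partial>lborel) + t n * (\<integral>x. \<bar>g x\<bar> \<partial>lborel)"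
      by (intro always_eventually allI)
  qed (auto intro!: always_eventually integral_nonneg_AE)
  then obtain r where r: "strict_mono r"
    "AE x in lborel. (\<lambda>n. indicator K x * (u (x + t (r n) *\<^sub>R b) - u x)) \<longlonglongrightarrow> 0"
    using tendsto_L1_AE_subseq[of lborel "\<lambda>n x. indicator K x * (u (x + t n *\<^sub>R b) - u x)"]
      iK[OF Bochner_Integration.integrable_diff[OF ut u]] by auto
  have mlim: "AE x in lborel. (\<lambda>n. m (r n) x * g x * \<phi> x) \<longlonglongrightarrow> f' (u x) * g x * \<phi> x"
    using r(2)
  proof eventually_elim
    case (elim x)
    show ?case
    proof (cases "x \<in> K")
      case True
      \<comment> \<open>Differentiability of \<open>f\<close> at \<open>u x\<close> says that this
        completed quotient is continuous at 0, which treats vanishing and nonvanishing increments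
        alike.\<close>
      define q where "q h = (if h = 0 then f' (u x) else (f (u x + h) - f (u x)) / h)" for h
      have "(q \<longlongrightarrow> q 0) (at 0)"
        using f(1)[of "u x"] unfolding DERIV_def
        by (subst tendsto_cong[where g="\<lambda>h. (f (u x + h) - f (u x)) / h"])
           (auto simp: q_def eventually_at_filter)
      then have "isCont q 0"
        by (simp add: isCont_def)
      moreover have "(\<lambda>n. u (x + t (r n) *\<^sub>R b) - u x) \<longlonglongrightarrow> 0"
        using elim True by simp
      ultimately have "(\<lambda>n. q (u (x + t (r n) *\<^sub>R b) - u x)) \<longlonglongrightarrow> q 0"
        by (rule isCont_tendsto_compose)
      moreover have "q (u (x + t (r n) *\<^sub>R b) - u x) = m (r n) x" for n
        by (simp add: q_def m_def)
      ultimately have "(\<lambda>n. m (r n) x) \<longlonglongrightarrow> f' (u x)"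
        by (simp add: q_def)
      then show ?thesis
        by (intro tendsto_intros)
    qed (simp add: K(3))
  qed
  have L1: "(\<lambda>n. \<integral>x. m (r n) x * g x * \<phi> x \<partial>lborel) \<longlonglongrightarrow> (\<integral>x. f' (u x) * g x * \<phi> x \<partial>lborel)"
  proof (rule integral_dominated_convergence[OF _ _ _ mlim])
    show "integrable lborel (\<lambda>x. \<bar>g x * \<phi> x\<bar>)"
      by (intro integrable_abs i\<phi> g)
    show "AE x in lborel. norm (m (r n) x * g x * \<phi> x) \<le> \<bar>g x * \<phi> x\<bar>" for n
      using m_le by (auto simp: abs_mult mult.assoc intro!: mult_left_le_one_le)
  qed measurable
  have bounded_mult: "integrable lborel (\<lambda>x. m n x * h x)" if h: "integrable lborel h" for n h
    by (rule integrable_bounded_mult_left[OF _ _ h, where c=1]) (use m_le in auto)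
  \<comment> \<open>The coefficient \<open>m\<close> is merely bounded here; the decay comes from
    \<open>D - g\<close> alone.\<close>
  have L2: "(\<lambda>n. \<integral>x. m (r n) x * ((D (r n) x - g x) * \<phi> x) \<partial>lborel) \<longlonglongrightarrow> 0"
  proof (rule Lim_null_comparison)
    have "(\<lambda>n. B * (\<integral>x. indicator K x * \<bar>D (r n) x - g x\<bar> \<partial>lborel)) \<longlonglongrightarrow> B * 0"
      using LIMSEQ_subseq_LIMSEQ[OF lim1 r(1)] by (intro tendsto_intros) (simp add: o_def)
    then show "(\<lambda>n. B * (\<integral>x. indicator K x * \<bar>D (r n) x - g x\<bar> \<partial>lborel)) \<longlonglongrightarrow> 0"
      by simp
    have "norm (\<integral>x. m n x * ((D n x - g x) * \<phi> x) \<partial>lborel) \<le>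
        (\<integral>x. norm (m n x * ((D n x - g x) * \<phi> x)) \<partial>lborel)" for n
      by (rule integral_norm_bound)
    also have "\<dots> n \<le> (\<integral>x. B * (indicator K x * \<bar>D n x - g x\<bar>) \<partial>lborel)" for n
    proof (rule integral_mono)
      show "integrable lborel (\<lambda>x. norm (m n x * ((D n x - g x) * \<phi> x)))"
        by (intro integrable_norm bounded_mult i\<phi> Bochner_Integration.integrable_diff Di g)
      show "integrable lborel (\<lambda>x. B * (indicator K x * \<bar>D n x - g x\<bar>))"
        by (intro integrable_mult_right iK integrable_abs Bochner_Integration.integrable_diff Di g)
      fix x
      have "\<bar>m n x\<bar> * (\<bar>D n x - g x\<bar> * \<bar>\<phi> x\<bar>) \<le> 1 * (\<bar>D n x - g x\<bar> * (B * indicator K x))"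
        using m_le B K(3)[of x] by (intro mult_mono) (auto split: split_indicator)
      then show "norm (m n x * ((D n x - g x) * \<phi> x)) \<le> B * (indicator K x * \<bar>D n x - g x\<bar>)"
        by (simp add: abs_mult mult_ac)
    qed
    finally show "\<forall>\<^sub>F n in sequentially. norm (\<integral>x. m (r n) x * ((D (r n) x - g x) * \<phi> x) \<partial>lborel)
        \<le> B * (\<integral>x. indicator K x * \<bar>D (r n) x - g x\<bar> \<partial>lborel)"
      by (intro always_eventually allI) simp
  qed
  have fi: "integrable lborel (\<lambda>x. f (u (x + a)))" for a
    by (rule Bochner_Integration.integrable_bound[OF ut[of a]]) (use f_le in auto)
  \<comment> \<open>The other side of the discrete integration by parts: the backward quotient of
    \<open>\<phi>\<close> tends to \<open>- \<psi>\<close> and is bounded by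
    \<open>C\<close>.\<close>
  have L3: "(\<lambda>n. \<integral>x. f (u x) * ((\<phi> (x + (- t n) *\<^sub>R b) - \<phi> x) / t n) \<partial>lborel)
      \<longlonglongrightarrow> (\<integral>x. f (u x) * (- \<psi> x) \<partial>lborel)"
  proof (rule integral_dominated_convergence)
    show "integrable lborel (\<lambda>x. C * \<bar>u x\<bar>)"
      using u by simp
    have incr: "(\<phi> (x + (- t n) *\<^sub>R b) - \<phi> x) / t n =
        - (\<integral>s. \<psi> (x + (- t n * s) *\<^sub>R b) \<partial>unit_interval)" for x n
      unfolding test_function_increment[OF \<phi> b] \<psi>_def using t(2)[of n] by simp
    have "\<bar>\<integral>s. \<psi> (x + (- t n * s) *\<^sub>R b) \<partial>unit_interval\<bar> \<le> C" for x n
    proof -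
      have int: "integrable unit_interval (\<lambda>s. \<psi> (x + (- t n * s) *\<^sub>R b))"
        using C(2) by (intro unit_interval.integrable_const_bound[where B=C]) auto
      have "\<bar>\<integral>s. \<psi> (x + (- t n * s) *\<^sub>R b) \<partial>unit_interval\<bar> \<le>
          (\<integral>s. \<bar>\<psi> (x + (- t n * s) *\<^sub>R b)\<bar> \<partial>unit_interval)"
        by (rule integral_abs_bound)
      also have "\<dots> \<le> (\<integral>s. C \<partial>unit_interval)"
        using C(2) int by (intro integral_mono) auto
      finally show ?thesis by simp
    qed
    then show "AE x in lborel. norm (f (u x) * ((\<phi> (x + (- t n) *\<^sub>R b) - \<phi> x) / t n)) \<le> C * \<bar>u x\<bar>" for n
      unfolding incr using C(1) f_le
      by (auto simp: abs_mult mult.commute[of C] intro!: mult_mono)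
    have "(\<lambda>n. (\<phi> (x + (- t n) *\<^sub>R b) - \<phi> x) / t n) \<longlonglongrightarrow> - \<psi> x" for x
    proof -
      have "((\<lambda>h. \<phi> (x + h *\<^sub>R b)) has_real_derivative \<psi> x) (at 0)"
      proof -
        have "((\<lambda>h. x + h *\<^sub>R b) has_derivative (\<lambda>h. h *\<^sub>R b)) (at 0)"
          by (auto intro!: derivative_eq_intros)
        from has_derivative_compose[OF this
            test_function_differentiable[OF \<phi>, unfolded frechet_derivative_works]]
        show ?thesis
          unfolding linear_cmul[OF linear_frechet_derivative[OF test_function_differentiable[OF \<phi>]]]
          by (simp add: has_field_derivative_def \<psi>_def mult.commute[of _ "frechet_derivative \<phi> (at x) b"])
      qed
      then have "((\<lambda>h. (\<phi> (x + h *\<^sub>R b) - \<phi> x) / h) \<longlongrightarrow> \<psi> x) (at 0)"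
        by (simp add: DERIV_def)
      moreover have "filterlim (\<lambda>n. - t n) (at 0) sequentially"
        unfolding filterlim_at using t(2) tendsto_minus[OF t(1)]
        by (auto simp: less_imp_neq[THEN not_sym])
      ultimately have "(\<lambda>n. (\<phi> (x + (- t n) *\<^sub>R b) - \<phi> x) / (- t n)) \<longlonglongrightarrow> \<psi> x"
        by (rule filterlim_compose)
      then show ?thesis
        using tendsto_minus by fastforce
    qed
    then show "AE x in lborel. (\<lambda>n. f (u x) * ((\<phi> (x + (- t n) *\<^sub>R b) - \<phi> x) / t n))
        \<longlonglongrightarrow> f (u x) * (- \<psi> x)"
      by (intro AE_I2 tendsto_intros)
  qed measurable
  \<comment> \<open>Discrete integration by parts: a translation moves the shift from
    \<open>\<phi>\<close> to \<open>f (u x)\<close>, and then \<open>D\<close> is split into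
    \<open>g\<close> and the error.\<close>
  have eq: "(\<integral>x. f (u x) * ((\<phi> (x + (- t n) *\<^sub>R b) - \<phi> x) / t n) \<partial>lborel) =
      (\<integral>x. m n x * g x * \<phi> x \<partial>lborel) + (\<integral>x. m n x * ((D n x - g x) * \<phi> x) \<partial>lborel)" for n
  proof -
    have i2: "integrable lborel (\<lambda>x. f (u x) * \<phi> (x + (- t n) *\<^sub>R b))"
      using integral_lborel_translate(2)[of "\<lambda>x. f (u (x + t n *\<^sub>R b)) * \<phi> x" "- (t n *\<^sub>R b)"]
        i\<phi>[OF fi] by simp
    have "(\<integral>x. f (u x) * ((\<phi> (x + (- t n) *\<^sub>R b) - \<phi> x) / t n) \<partial>lborel) =
        (\<integral>x. (f (u x) * \<phi> (x + (- t n) *\<^sub>R b) - f (u x) * \<phi> x) / t n \<partial>lborel)"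
      by (simp add: right_diff_distrib)
    also have "\<dots> = ((\<integral>x. f (u x) * \<phi> (x + (- t n) *\<^sub>R b) \<partial>lborel) -
        (\<integral>x. f (u x) * \<phi> x \<partial>lborel)) / t n"
      using i2 i\<phi>[OF fi[of 0]] by simp
    also have "(\<integral>x. f (u x) * \<phi> (x + (- t n) *\<^sub>R b) \<partial>lborel) =
        (\<integral>x. f (u (x + t n *\<^sub>R b)) * \<phi> x \<partial>lborel)"
      using integral_lborel_translate(1)[of "\<lambda>x. f (u (x + t n *\<^sub>R b)) * \<phi> x" "- (t n *\<^sub>R b)"] by simp
    also have "(\<dots> - (\<integral>x. f (u x) * \<phi> x \<partial>lborel)) / t n =
        (\<integral>x. ((f (u (x + t n *\<^sub>R b)) - f (u x)) / t n) * \<phi> x \<partial>lborel)"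
      using i\<phi>[OF fi[of 0]] i\<phi>[OF fi] by (simp add: left_diff_distrib diff_divide_distrib)
    also have "\<dots> = (\<integral>x. m n x * (g x * \<phi> x) + m n x * ((D n x - g x) * \<phi> x) \<partial>lborel)"
      unfolding mD by (simp add: algebra_simps)
    also have "\<dots> = (\<integral>x. m n x * (g x * \<phi> x) \<partial>lborel) +
        (\<integral>x. m n x * ((D n x - g x) * \<phi> x) \<partial>lborel)"
      by (intro Bochner_Integration.integral_add bounded_mult i\<phi>
          Bochner_Integration.integrable_diff Di g)
    finally show ?thesis
      by (simp add: mult.assoc)
  qed
  have "(\<lambda>n. \<integral>x. f (u x) * ((\<phi> (x + (- t (r n)) *\<^sub>R b) - \<phi> x) / t (r n)) \<partial>lborel)
      \<longlonglongrightarrow> (\<integral>x. f' (u x) * g x * \<phi> x \<partial>lborel) + 0"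
    unfolding eq by (intro tendsto_add L1 L2)
  moreover have "(\<lambda>n. \<integral>x. f (u x) * ((\<phi> (x + (- t (r n)) *\<^sub>R b) - \<phi> x) / t (r n)) \<partial>lborel)
      \<longlonglongrightarrow> (\<integral>x. f (u x) * (- \<psi> x) \<partial>lborel)"
    using LIMSEQ_subseq_LIMSEQ[OF L3 r(1)] by (simp add: o_def)
  ultimately have "(\<integral>x. f (u x) * (- \<psi> x) \<partial>lborel) = (\<integral>x. f' (u x) * g x * \<phi> x \<partial>lborel)"
    using LIMSEQ_unique by fastforce
  then show "(\<integral>x. f (u x) * frechet_derivative \<phi> (at x) b \<partial>lborel) =
      - (\<integral>x. f' (u x) * g x * \<phi> x \<partial>lborel)"
    by (simp add: \<psi>_def)
qed

section \<open>Chain rule and truncation\<close>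

lemma borel_imp_measurable_lebesgue_on:
  "f \<in> borel_measurable borel \<Longrightarrow> f \<in> borel_measurable (lebesgue_on S)"
  by (intro measurable_restrict_space1 measurable_completion) simp

lemma integrable_lebesgue_on_subset:
  fixes f :: "'a::euclidean_space \<Rightarrow> 'b::{banach, second_countable_topology}"
  assumes "integrable (lebesgue_on S) f" "S \<in> sets lebesgue" "T \<in> sets lebesgue" "T \<subseteq> S"
  shows "integrable (lebesgue_on T) f"
proof -
  have "integrable lebesgue (\<lambda>x. indicator T x *\<^sub>R (indicator S x *\<^sub>R f x))"
    using assms by (intro integrable_mult_indicator[OF assms(3)]) (simp add: integrable_restrict_space)
  moreover have "(\<lambda>x. indicator T x *\<^sub>R (indicator S x *\<^sub>R f x)) = (\<lambda>x. indicator T x *\<^sub>R f x)"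
    using assms(4) by (auto simp: fun_eq_iff split: split_indicator)
  ultimately show ?thesis
    using assms by (simp add: integrable_restrict_space del: scaleR_scaleR)
qed

text \<open>Lebesgue measure is the completion of the Borel one, so the extension of
  \<open>F\<close> by zero agrees with a Borel function off a null set. This carries functions on
  \<open>\<Omega>\<close> into the setting of \<open>weak_partial\<close>.\<close>

lemma borel_representative:
  fixes F :: "'a::euclidean_space \<Rightarrow> real"
  assumes F: "integrable (lebesgue_on \<Omega>) F" and \<Omega>: "\<Omega> \<in> sets lebesgue"
  obtains F0 where "integrable lborel F0" "AE x in lebesgue. F0 x = indicator \<Omega> x * F x"
proof -
  have i: "integrable lebesgue (\<lambda>x. indicator \<Omega> x * F x)"
    using F \<Omega> by (simp add: integrable_restrict_space)
  then have "(\<lambda>x. indicator \<Omega> x * F x) \<in> borel_measurable lebesgue"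
    by auto
  then obtain F0 where F0: "F0 \<in> borel_measurable lborel" "AE x in lborel. indicator \<Omega> x * F x = F0 x"
    using completion_ex_borel_measurable_real by blast
  have ae: "AE x in lebesgue. F0 x = indicator \<Omega> x * F x"
    using AE_completion[OF F0(2)] by eventually_elim simp
  have "integrable lebesgue F0"
    using i by (rule integrable_cong_AE_imp)
      (use F0(1) ae in \<open>auto intro: measurable_completion elim: eventually_mono\<close>)
  with F0(1) ae show thesis
    by (intro that[of F0]) (auto simp: integrable_completion)
qed

lemma integral_representative:
  fixes F F0 :: "'a::euclidean_space \<Rightarrow> real"
  assumes F0: "F0 \<in> borel_measurable borel" and \<Omega>: "\<Omega> \<in> sets lebesgue"
    and ae: "AE x in lebesgue. F0 x = indicator \<Omega> x * F x"
  shows "(\<integral>x. F0 x \<partial>lborel) = (\<integral>x. F x \<partial>lebesgue_on \<Omega>)"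
proof -
  have m: "F0 \<in> borel_measurable lebesgue"
    using F0 by (intro measurable_completion) simp
  have "(\<integral>x. F0 x \<partial>lborel) = (\<integral>x. F0 x \<partial>lebesgue)"
    using F0 by (simp add: integral_completion)
  also have "\<dots> = (\<integral>x. indicator \<Omega> x * F x \<partial>lebesgue)"
    using m ae borel_measurable_AE[OF m ae] by (intro integral_cong_AE) auto
  also have "\<dots> = (\<integral>x. F x \<partial>lebesgue_on \<Omega>)"
    using \<Omega> by (simp add: integral_restrict_space)
  finally show ?thesis .
qed

lemma weak_partial_representative_iff:
  assumes \<Omega>: "\<Omega> \<in> sets lebesgue" and b: "b \<in> Basis"
    and u0: "u0 \<in> borel_measurable borel" "AE x in lebesgue. u0 x = indicator \<Omega> x * u x"
    and g0: "g0 \<in> borel_measurable borel" "AE x in lebesgue. g0 x = indicator \<Omega> x * g x"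
  shows "weak_partial \<Omega> b u0 g0 \<longleftrightarrow> (\<forall>\<phi>\<in>test_functions \<Omega>.
    (\<integral>x. u x * frechet_derivative \<phi> (at x) b \<partial>lebesgue_on \<Omega>) = - (\<integral>x. g x * \<phi> x \<partial>lebesgue_on \<Omega>))"
  unfolding weak_partial_def
proof (intro ball_cong refl)
  fix \<phi> assume \<phi>: "\<phi> \<in> test_functions \<Omega>"
  have m: "\<phi> \<in> borel_measurable borel" "(\<lambda>x. frechet_derivative \<phi> (at x) b) \<in> borel_measurable borel"
    using test_function_continuous[OF \<phi>] test_function_derivative_continuous[OF \<phi> b]
    by (auto intro: borel_measurable_continuous_onI)
  have "(\<integral>x. u0 x * frechet_derivative \<phi> (at x) b \<partial>lborel) =
      (\<integral>x. u x * frechet_derivative \<phi> (at x) b \<partial>lebesgue_on \<Omega>)"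
    by (rule integral_representative[OF borel_measurable_times[OF u0(1) m(2)] \<Omega>])
       (use u0(2) in eventually_elim, simp)
  moreover have "(\<integral>x. g0 x * \<phi> x \<partial>lborel) = (\<integral>x. g x * \<phi> x \<partial>lebesgue_on \<Omega>)"
    by (rule integral_representative[OF borel_measurable_times[OF g0(1) m(1)] \<Omega>])
       (use g0(2) in eventually_elim, simp)
  ultimately show "((\<integral>x. u0 x * frechet_derivative \<phi> (at x) b \<partial>lborel) = - (\<integral>x. g0 x * \<phi> x \<partial>lborel)) =
      ((\<integral>x. u x * frechet_derivative \<phi> (at x) b \<partial>lebesgue_on \<Omega>) = - (\<integral>x. g x * \<phi> x \<partial>lebesgue_on \<Omega>))"
    by simp
qed

text \<open>Integrability on all of \<open>\<Omega>\<close> settles the measurability and local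
  integrability clauses, which leaves the identity with test functions.\<close>

lemma has_weak_gradient_iff_if_integrable:
  assumes \<Omega>: "\<Omega> \<in> sets lebesgue"
    and u: "integrable (lebesgue_on \<Omega>) u" and G: "integrable (lebesgue_on \<Omega>) G"
  shows "has_weak_gradient \<Omega> u G \<longleftrightarrow> (\<forall>\<phi>\<in>test_functions \<Omega>. \<forall>b\<in>Basis.
    (\<integral>x. u x * frechet_derivative \<phi> (at x) b \<partial>lebesgue_on \<Omega>) =
      - (\<integral>x. (G x \<bullet> b) * \<phi> x \<partial>lebesgue_on \<Omega>))"
proof -
  have "integrable (lebesgue_on K) u \<and> integrable (lebesgue_on K) G" if "compact K \<and> K \<subseteq> \<Omega>" for K
    using that u G \<Omega> by (auto intro!: integrable_lebesgue_on_subset[of \<Omega>] lmeasurable_compact fmeasurableD)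
  then show ?thesis
    using u G by (auto simp: has_weak_gradient_def dest: borel_measurable_integrable)
qed

text \<open>The Borel chain rule is applied to each component. Since \<open>f 0 = 0\<close>,
  applying \<open>f\<close> to the representative of \<open>u\<close> still gives 0 almost
  everywhere outside \<open>\<Omega>\<close>, so the result represents
  \<open>f (u x)\<close>.\<close>

lemma has_weak_gradient_chain_rule:
  fixes u :: "'a::euclidean_space \<Rightarrow> real"
  assumes \<Omega>: "open \<Omega>" and grad: "has_weak_gradient \<Omega> u G"
    and u: "integrable (lebesgue_on \<Omega>) u" and G: "integrable (lebesgue_on \<Omega>) G"
    and f: "\<And>s. (f has_real_derivative f' s) (at s)" "\<And>s. \<bar>f' s\<bar> \<le> 1" "f 0 = 0"
    and f'[measurable]: "f' \<in> borel_measurable borel"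
  shows "has_weak_gradient \<Omega> (\<lambda>x. f (u x)) (\<lambda>x. f' (u x) *\<^sub>R G x)"
    "integrable (lebesgue_on \<Omega>) (\<lambda>x. f (u x))"
    "integrable (lebesgue_on \<Omega>) (\<lambda>x. f' (u x) *\<^sub>R G x)"
proof -
  have S: "\<Omega> \<in> sets lebesgue"
    using \<Omega> by (simp add: borel_open)
  have "continuous_on UNIV f"
    using f(1) by (meson DERIV_isCont continuous_at_imp_continuous_on)
  then have [measurable]: "f \<in> borel_measurable borel"
    by (rule borel_measurable_continuous_onI)
  have [measurable]: "u \<in> borel_measurable (lebesgue_on \<Omega>)" "G \<in> borel_measurable (lebesgue_on \<Omega>)"
    using u G by (auto dest: borel_measurable_integrable)
  have "\<bar>f s - f r\<bar> \<le> \<bar>s - r\<bar>" for s r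
    using field_differentiable_bound[of UNIV f f' 1 s r] f by auto
  then have f_le: "\<bar>f s\<bar> \<le> \<bar>s\<bar>" for s
    using f(3) by (metis diff_zero)
  show iu: "integrable (lebesgue_on \<Omega>) (\<lambda>x. f (u x))"
    by (rule Bochner_Integration.integrable_bound[OF u]) (use f_le in auto)
  show iG: "integrable (lebesgue_on \<Omega>) (\<lambda>x. f' (u x) *\<^sub>R G x)"
    by (rule Bochner_Integration.integrable_bound[OF G]) (use f(2) in \<open>auto intro!: mult_left_le_one_le\<close>)
  show "has_weak_gradient \<Omega> (\<lambda>x. f (u x)) (\<lambda>x. f' (u x) *\<^sub>R G x)"
    unfolding has_weak_gradient_iff_if_integrable[OF S iu iG]
  proof (intro ballI)
    fix \<phi> b assume \<phi>: "\<phi> \<in> test_functions \<Omega>" and b: "b \<in> (Basis :: 'a set)"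
    obtain u0 where u0: "integrable lborel u0" "AE x in lebesgue. u0 x = indicator \<Omega> x * u x"
      using borel_representative[OF u S] .
    obtain g0 where g0: "integrable lborel g0" "AE x in lebesgue. g0 x = indicator \<Omega> x * (G x \<bullet> b)"
      using borel_representative[OF integrable_inner_left[OF G] S, of b] .
    have [measurable]: "u0 \<in> borel_measurable borel" "g0 \<in> borel_measurable borel"
      using u0(1) g0(1) by (auto dest: borel_measurable_integrable)
    have "weak_partial \<Omega> b u0 g0"
      using grad weak_partial_representative_iff[OF S b _ u0(2) _ g0(2)] b
      by (auto simp: has_weak_gradient_def)
    then have "weak_partial \<Omega> b (\<lambda>x. f (u0 x)) (\<lambda>x. f' (u0 x) * g0 x)"
      by (rule weak_partial_chain_rule[OF _ b \<Omega> u0(1) g0(1) f f'])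
    moreover have "AE x in lebesgue. f (u0 x) = indicator \<Omega> x * f (u x)"
      using u0(2) by eventually_elim (auto simp: f(3) split: split_indicator)
    moreover have "AE x in lebesgue. f' (u0 x) * g0 x = indicator \<Omega> x * (f' (u x) * (G x \<bullet> b))"
      using u0(2) g0(2) by eventually_elim (auto split: split_indicator)
    ultimately have "\<forall>\<phi>\<in>test_functions \<Omega>. (\<integral>x. f (u x) * frechet_derivative \<phi> (at x) b \<partial>lebesgue_on \<Omega>) =
        - (\<integral>x. f' (u x) * (G x \<bullet> b) * \<phi> x \<partial>lebesgue_on \<Omega>)"
      by (subst (asm) weak_partial_representative_iff[OF S b]) auto
    with \<phi> show "(\<integral>x. f (u x) * frechet_derivative \<phi> (at x) b \<partial>lebesgue_on \<Omega>) =
        - (\<integral>x. (f' (u x) *\<^sub>R G x \<bullet> b) * \<phi> x \<partial>lebesgue_on \<Omega>)"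
      by simp
  qed
qed

section \<open>Limits and linear combinations of weak gradients\<close>

lemma integral_bounded_mult_tendsto:
  fixes f :: "nat \<Rightarrow> 'a \<Rightarrow> real"
  assumes f: "\<And>n. integrable M (f n)" and g: "integrable M g"
    and lim: "(\<lambda>n. \<integral>x. \<bar>f n x - g x\<bar> \<partial>M) \<longlonglongrightarrow> 0"
    and [measurable]: "h \<in> borel_measurable M" and B: "\<And>x. \<bar>h x\<bar> \<le> B"
  shows "(\<lambda>n. \<integral>x. f n x * h x \<partial>M) \<longlonglongrightarrow> (\<integral>x. g x * h x \<partial>M)"
proof -
  have B': "\<bar>h x\<bar> \<le> \<bar>B\<bar>" for x
    using B[of x] by linarith
  have i: "integrable M (\<lambda>x. k x * h x)" if k: "integrable M k" for k
    by (rule integrable_bounded_mult_right[OF _ _ k, where c=B]) (use B in auto)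
  have "(\<lambda>n. (\<integral>x. f n x * h x \<partial>M) - (\<integral>x. g x * h x \<partial>M)) \<longlonglongrightarrow> 0"
  proof (rule Lim_null_comparison)
    have "(\<lambda>n. \<bar>B\<bar> * (\<integral>x. \<bar>f n x - g x\<bar> \<partial>M)) \<longlonglongrightarrow> \<bar>B\<bar> * 0"
      by (intro tendsto_intros lim)
    then show "(\<lambda>n. \<bar>B\<bar> * (\<integral>x. \<bar>f n x - g x\<bar> \<partial>M)) \<longlonglongrightarrow> 0"
      by simp
    have "norm ((\<integral>x. f n x * h x \<partial>M) - (\<integral>x. g x * h x \<partial>M)) \<le> \<bar>B\<bar> * (\<integral>x. \<bar>f n x - g x\<bar> \<partial>M)" for n
    proof -
      have "norm ((\<integral>x. f n x * h x \<partial>M) - (\<integral>x. g x * h x \<partial>M)) = norm (\<integral>x. (f n x - g x) * h x \<partial>M)"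
        using i f g by (simp add: left_diff_distrib)
      also have "\<dots> \<le> (\<integral>x. norm ((f n x - g x) * h x) \<partial>M)"
        by (rule integral_norm_bound)
      also have "\<dots> \<le> (\<integral>x. \<bar>B\<bar> * \<bar>f n x - g x\<bar> \<partial>M)"
        using B' by (intro integral_mono integrable_norm i integrable_mult_right integrable_abs
            Bochner_Integration.integrable_diff f g)
          (auto simp: abs_mult mult.commute[of "\<bar>B\<bar>"] intro!: mult_left_mono)
      finally show ?thesis by simp
    qed
    then show "\<forall>\<^sub>F n in sequentially. norm ((\<integral>x. f n x * h x \<partial>M) - (\<integral>x. g x * h x \<partial>M))
        \<le> \<bar>B\<bar> * (\<integral>x. \<bar>f n x - g x\<bar> \<partial>M)"
      by simp
  qed
  then show ?thesis
    by (rule LIM_zero_cancel)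
qed

text \<open>Test functions and their derivatives are bounded, so both sides of the defining identity
  are continuous under L1 convergence.\<close>

lemma has_weak_gradient_closed:
  fixes u :: "nat \<Rightarrow> 'a::euclidean_space \<Rightarrow> real"
  assumes \<Omega>: "\<Omega> \<in> sets lebesgue" and grad: "\<And>n. has_weak_gradient \<Omega> (u n) (G n)"
    and u: "\<And>n. integrable (lebesgue_on \<Omega>) (u n)" and G: "\<And>n. integrable (lebesgue_on \<Omega>) (G n)"
    and v: "integrable (lebesgue_on \<Omega>) v" and H: "integrable (lebesgue_on \<Omega>) H"
    and lim: "(\<lambda>n. \<integral>x. \<bar>u n x - v x\<bar> \<partial>lebesgue_on \<Omega>) \<longlonglongrightarrow> 0"
      "(\<lambda>n. \<integral>x. norm (G n x - H x) \<partial>lebesgue_on \<Omega>) \<longlonglongrightarrow> 0"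
  shows "has_weak_gradient \<Omega> v H"
  unfolding has_weak_gradient_iff_if_integrable[OF \<Omega> v H]
proof (intro ballI)
  fix \<phi> b assume \<phi>: "\<phi> \<in> test_functions \<Omega>" and b: "b \<in> (Basis :: 'a set)"
  obtain B where B: "\<And>x. \<bar>\<phi> x\<bar> \<le> B"
    using test_function_bounded[OF \<phi>] by metis
  obtain C where C: "\<And>x. \<bar>frechet_derivative \<phi> (at x) b\<bar> \<le> C"
    using test_function_derivative_bounded[OF \<phi> b] by metis
  have m: "\<phi> \<in> borel_measurable (lebesgue_on \<Omega>)"
    "(\<lambda>x. frechet_derivative \<phi> (at x) b) \<in> borel_measurable (lebesgue_on \<Omega>)"
    using test_function_continuous[OF \<phi>] test_function_derivative_continuous[OF \<phi> b]
    by (auto intro: borel_measurable_continuous_onI borel_imp_measurable_lebesgue_on)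
  have "(\<lambda>n. \<integral>x. \<bar>G n x \<bullet> b - H x \<bullet> b\<bar> \<partial>lebesgue_on \<Omega>) \<longlonglongrightarrow> 0"
  proof (rule Lim_null_comparison[OF _ lim(2)])
    have "(\<integral>x. \<bar>G n x \<bullet> b - H x \<bullet> b\<bar> \<partial>lebesgue_on \<Omega>) \<le> (\<integral>x. norm (G n x - H x) \<partial>lebesgue_on \<Omega>)" for n
      using b by (intro integral_mono integrable_norm integrable_abs
          Bochner_Integration.integrable_diff G H integrable_inner_left)
        (simp add: Basis_le_norm flip: inner_diff_left)
    then show "\<forall>\<^sub>F n in sequentially. norm (\<integral>x. \<bar>G n x \<bullet> b - H x \<bullet> b\<bar> \<partial>lebesgue_on \<Omega>)
        \<le> (\<integral>x. norm (G n x - H x) \<partial>lebesgue_on \<Omega>)"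
      by (simp add: integral_nonneg_AE)
  qed
  then have "(\<lambda>n. - (\<integral>x. (G n x \<bullet> b) * \<phi> x \<partial>lebesgue_on \<Omega>)) \<longlonglongrightarrow>
      - (\<integral>x. (H x \<bullet> b) * \<phi> x \<partial>lebesgue_on \<Omega>)"
    using G H m(1) B by (intro tendsto_minus integral_bounded_mult_tendsto) auto
  moreover have "(\<integral>x. u n x * frechet_derivative \<phi> (at x) b \<partial>lebesgue_on \<Omega>) =
      - (\<integral>x. (G n x \<bullet> b) * \<phi> x \<partial>lebesgue_on \<Omega>)" for n
    using grad[of n] \<phi> b by (auto simp: has_weak_gradient_def)
  moreover have "(\<lambda>n. \<integral>x. u n x * frechet_derivative \<phi> (at x) b \<partial>lebesgue_on \<Omega>) \<longlonglongrightarrow>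
      (\<integral>x. v x * frechet_derivative \<phi> (at x) b \<partial>lebesgue_on \<Omega>)"
    by (rule integral_bounded_mult_tendsto[OF u v lim(1) m(2) C])
  ultimately show "(\<integral>x. v x * frechet_derivative \<phi> (at x) b \<partial>lebesgue_on \<Omega>) =
      - (\<integral>x. (H x \<bullet> b) * \<phi> x \<partial>lebesgue_on \<Omega>)"
    using LIMSEQ_unique by fastforce
qed

lemma has_weak_gradient_add_cmult:
  fixes u v :: "'a::euclidean_space \<Rightarrow> real"
  assumes \<Omega>: "\<Omega> \<in> sets lebesgue"
    and grad: "has_weak_gradient \<Omega> u G" "has_weak_gradient \<Omega> v H"
    and u: "integrable (lebesgue_on \<Omega>) u" and G: "integrable (lebesgue_on \<Omega>) G"
    and v: "integrable (lebesgue_on \<Omega>) v" and H: "integrable (lebesgue_on \<Omega>) H"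
  shows "has_weak_gradient \<Omega> (\<lambda>x. u x + c * v x) (\<lambda>x. G x + c *\<^sub>R H x)"
proof -
  have i: "integrable (lebesgue_on \<Omega>) (\<lambda>x. u x + c * v x)"
    "integrable (lebesgue_on \<Omega>) (\<lambda>x. G x + c *\<^sub>R H x)"
    using u G v H by auto
  show ?thesis
    unfolding has_weak_gradient_iff_if_integrable[OF \<Omega> i]
  proof (intro ballI)
    fix \<phi> b assume \<phi>: "\<phi> \<in> test_functions \<Omega>" and b: "b \<in> (Basis :: 'a set)"
    obtain B where B: "\<And>x. \<bar>\<phi> x\<bar> \<le> B"
      using test_function_bounded[OF \<phi>] by metis
    obtain C where C: "\<And>x. \<bar>frechet_derivative \<phi> (at x) b\<bar> \<le> C"
      using test_function_derivative_bounded[OF \<phi> b] by metis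
    have m: "\<phi> \<in> borel_measurable (lebesgue_on \<Omega>)"
      "(\<lambda>x. frechet_derivative \<phi> (at x) b) \<in> borel_measurable (lebesgue_on \<Omega>)"
      using test_function_continuous[OF \<phi>] test_function_derivative_continuous[OF \<phi> b]
      by (auto intro: borel_measurable_continuous_onI borel_imp_measurable_lebesgue_on)
    have im: "integrable (lebesgue_on \<Omega>) (\<lambda>x. k x * h x)"
      if "integrable (lebesgue_on \<Omega>) k" "h \<in> borel_measurable (lebesgue_on \<Omega>)"
        "\<And>x. \<bar>h x\<bar> \<le> B" for k h :: "'a \<Rightarrow> real" and B
      by (rule integrable_bounded_mult_right[OF that(2) _ that(1), where c=B]) (use that(3) in auto)
    have eq: "(\<integral>x. u x * frechet_derivative \<phi> (at x) b \<partial>lebesgue_on \<Omega>) =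
        - (\<integral>x. (G x \<bullet> b) * \<phi> x \<partial>lebesgue_on \<Omega>)"
      "(\<integral>x. v x * frechet_derivative \<phi> (at x) b \<partial>lebesgue_on \<Omega>) =
        - (\<integral>x. (H x \<bullet> b) * \<phi> x \<partial>lebesgue_on \<Omega>)"
      using grad \<phi> b by (auto simp: has_weak_gradient_def)
    have "(\<integral>x. (u x + c * v x) * frechet_derivative \<phi> (at x) b \<partial>lebesgue_on \<Omega>) =
        (\<integral>x. u x * frechet_derivative \<phi> (at x) b \<partial>lebesgue_on \<Omega>) +
        c * (\<integral>x. v x * frechet_derivative \<phi> (at x) b \<partial>lebesgue_on \<Omega>)"
      using im[OF u m(2) C] im[OF v m(2) C] by (simp add: distrib_right mult.assoc)
    also have "\<dots> = - (\<integral>x. ((G x + c *\<^sub>R H x) \<bullet> b) * \<phi> x \<partial>lebesgue_on \<Omega>)"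
      using im[OF integrable_inner_left[OF G] m(1) B, of b]
        im[OF integrable_inner_left[OF H] m(1) B, of b]
      unfolding eq by (simp add: inner_add_left distrib_right mult.assoc)
    finally show "(\<integral>x. (u x + c * v x) * frechet_derivative \<phi> (at x) b \<partial>lebesgue_on \<Omega>) =
        - (\<integral>x. ((G x + c *\<^sub>R H x) \<bullet> b) * \<phi> x \<partial>lebesgue_on \<Omega>)" .
  qed
qed

text \<open>A differentiable substitute for \<open>max 0 (s - c)\<close> when \<open>e > 0\<close>:
  it vanishes to second order at \<open>c\<close>, its slope stays in \<open>[0, 1)\<close>, and it
  is within \<open>e\<close> of the positive part. Being rational to the right of \<open>c\<close>,
  it has an explicit derivative.\<close>

definition smooth_pos_part :: "real \<Rightarrow> real \<Rightarrow> real \<Rightarrow> real" where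
  "smooth_pos_part c e s = (if s \<le> c then 0 else (s - c)\<^sup>2 / (s - c + e))"

definition smooth_pos_part' :: "real \<Rightarrow> real \<Rightarrow> real \<Rightarrow> real" where
  "smooth_pos_part' c e s = (if s \<le> c then 0 else 1 - (e / (s - c + e))\<^sup>2)"

lemma smooth_pos_part_has_derivative:
  assumes "e > 0"
  shows "(smooth_pos_part c e has_real_derivative smooth_pos_part' c e s) (at s)"
proof -
  consider "s < c" | "s = c" | "s > c" by linarith
  then show ?thesis
  proof cases
    case 1
    have "((\<lambda>s. 0::real) has_real_derivative 0) (at s)"
      by simp
    then have "(smooth_pos_part c e has_real_derivative 0) (at s)"
      by (rule has_field_derivative_transform_within_open[where S="{..<c}"])
         (use 1 in \<open>auto simp: smooth_pos_part_def\<close>)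
    with 1 show ?thesis by (simp add: smooth_pos_part'_def)
  next
    case 2
    have "((\<lambda>h. (smooth_pos_part c e (c + h) - smooth_pos_part c e c) / h) \<longlongrightarrow> 0) (at 0)"
    proof (rule filterlim_split_at)
      show "((\<lambda>h. (smooth_pos_part c e (c + h) - smooth_pos_part c e c) / h) \<longlongrightarrow> 0) (at_left 0)"
        by (rule tendsto_eventually) (auto simp: eventually_at_filter smooth_pos_part_def)
      have "((\<lambda>h::real. h / (h + e)) \<longlongrightarrow> 0 / (0 + e)) (at_right 0)"
        using assms by (intro tendsto_intros) auto
      then have "((\<lambda>h::real. h / (h + e)) \<longlongrightarrow> 0) (at_right 0)"
        by simp
      then show "((\<lambda>h. (smooth_pos_part c e (c + h) - smooth_pos_part c e c) / h) \<longlongrightarrow> 0) (at_right 0)"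
        by (rule tendsto_cong[THEN iffD1, rotated])
           (auto simp: eventually_at_filter smooth_pos_part_def power2_eq_square)
    qed
    with 2 show ?thesis
      by (simp add: DERIV_def smooth_pos_part'_def)
  next
    case 3
    have "s - c + e \<noteq> 0"
      using 3 assms by simp
    then have "((\<lambda>s. (s - c)\<^sup>2 / (s - c + e)) has_real_derivative
        (2 * (s - c) * (s - c + e) - (s - c)\<^sup>2) / ((s - c + e) * (s - c + e))) (at s)"
      by (auto intro!: derivative_eq_intros)
    moreover have "2 * (s - c) * (s - c + e) - (s - c)\<^sup>2 = (s - c + e) * (s - c + e) - e * e"
      by (simp add: power2_eq_square algebra_simps)
    then have "(2 * (s - c) * (s - c + e) - (s - c)\<^sup>2) / ((s - c + e) * (s - c + e)) =
        1 - (e / (s - c + e))\<^sup>2"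
      using \<open>s - c + e \<noteq> 0\<close> by (simp add: diff_divide_distrib power2_eq_square)
    ultimately have "((\<lambda>s. (s - c)\<^sup>2 / (s - c + e)) has_real_derivative smooth_pos_part' c e s) (at s)"
      using 3 by (simp add: smooth_pos_part'_def)
    then show ?thesis
      by (rule has_field_derivative_transform_within_open[where S="{c<..}"])
         (use 3 in \<open>auto simp: smooth_pos_part_def\<close>)
  qed
qed

lemma smooth_pos_part_props:
  assumes "e > 0"
  shows "\<bar>smooth_pos_part' c e s\<bar> \<le> 1" "\<bar>smooth_pos_part c e s - max 0 (s - c)\<bar> \<le> e"
proof -
  have "s > c \<Longrightarrow> e / (s - c + e) \<le> 1" "s > c \<Longrightarrow> 0 \<le> e / (s - c + e)"
    using assms by auto
  then have "s > c \<Longrightarrow> (e / (s - c + e))\<^sup>2 \<le> 1"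
    by (simp add: power_le_one)
  then show "\<bar>smooth_pos_part' c e s\<bar> \<le> 1"
    by (auto simp: smooth_pos_part'_def)
  show "\<bar>smooth_pos_part c e s - max 0 (s - c)\<bar> \<le> e"
  proof (cases "s \<le> c")
    case False
    \<comment> \<open>\<open>e * r\<close> is exactly the deficit of \<open>smooth_pos_part\<close>
      below \<open>s - c\<close>.\<close>
    define r where "r = (s - c) / (s - c + e)"
    have "0 \<le> r" "r \<le> 1"
      using False assms by (auto simp: r_def)
    then have "0 \<le> e * r" "e * r \<le> e"
      using assms by (auto intro: mult_left_le)
    moreover have "(s - c)\<^sup>2 / (s - c + e) = (s - c) - e * r"
      using False assms by (simp add: r_def field_simps power2_eq_square)
    ultimately show ?thesis
      using False by (simp add: smooth_pos_part_def)
  qed (use assms in \<open>simp add: smooth_pos_part_def\<close>)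
qed

text \<open>As \<open>e\<close> tends to 0 the regularisations converge uniformly, hence in L1 on
  the bounded domain. Their slopes tend to 1 where \<open>u x > c\<close> and are 0 elsewhere, so
  the limit gradient vanishes on the level set \<open>u x = c\<close>. The sign of \<open>c\<close>
  gives the value 0 at 0 that the chain rule asks for.\<close>

lemma has_weak_gradient_pos_part:
  fixes u :: "'a::euclidean_space \<Rightarrow> real"
  assumes \<Omega>: "open \<Omega>" "bounded \<Omega>" and grad: "has_weak_gradient \<Omega> u G"
    and u: "integrable (lebesgue_on \<Omega>) u" and G: "integrable (lebesgue_on \<Omega>) G" and c: "c \<ge> 0"
  shows "has_weak_gradient \<Omega> (\<lambda>x. max 0 (u x - c)) (\<lambda>x. if u x > c then G x else 0)"
    "integrable (lebesgue_on \<Omega>) (\<lambda>x. max 0 (u x - c))"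
    "integrable (lebesgue_on \<Omega>) (\<lambda>x. if u x > c then G x else 0)"
proof -
  have S: "\<Omega> \<in> sets lebesgue"
    using \<Omega> by (simp add: borel_open)
  have fin: "finite_measure (lebesgue_on \<Omega>)"
    using \<Omega> by (intro finite_measure_lebesgue_on bounded_set_imp_lmeasurable S)
  have [measurable]: "u \<in> borel_measurable (lebesgue_on \<Omega>)" "G \<in> borel_measurable (lebesgue_on \<Omega>)"
    using u G by (auto dest: borel_measurable_integrable)
  show iu: "integrable (lebesgue_on \<Omega>) (\<lambda>x. max 0 (u x - c))"
    by (rule Bochner_Integration.integrable_bound[OF u]) (use c in auto)
  show iG: "integrable (lebesgue_on \<Omega>) (\<lambda>x. if u x > c then G x else 0)"
    by (rule Bochner_Integration.integrable_bound[OF G]) auto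
  define e where "e n = inverse (real (Suc n))" for n
  have e: "e \<longlonglongrightarrow> 0" "\<And>n. e n > 0" "\<And>n. e n \<le> 1"
    unfolding e_def[abs_def] by (rule LIMSEQ_inverse_real_of_nat) (auto simp: field_simps)
  have m [measurable]: "smooth_pos_part' c (e n) \<in> borel_measurable borel"
    "smooth_pos_part c (e n) \<in> borel_measurable borel" for n
    by (auto simp: smooth_pos_part_def[abs_def] smooth_pos_part'_def[abs_def])
  have z: "smooth_pos_part c (e n) 0 = 0" for n
    using c by (simp add: smooth_pos_part_def)
  note chain = has_weak_gradient_chain_rule[OF \<Omega>(1) grad u G
      smooth_pos_part_has_derivative[OF e(2)] smooth_pos_part_props(1)[OF e(2)] z m(1)]
  show "has_weak_gradient \<Omega> (\<lambda>x. max 0 (u x - c)) (\<lambda>x. if u x > c then G x else 0)"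
  proof (rule has_weak_gradient_closed[OF S chain iu iG])
    have "(\<lambda>n. \<integral>x. \<bar>smooth_pos_part c (e n) (u x) - max 0 (u x - c)\<bar> \<partial>lebesgue_on \<Omega>)
        \<longlonglongrightarrow> (\<integral>x. 0 \<partial>lebesgue_on \<Omega>)"
    proof (rule integral_dominated_convergence)
      show "integrable (lebesgue_on \<Omega>) (\<lambda>x. 1::real)"
        by (rule finite_measure.integrable_const[OF fin])
      show "AE x in lebesgue_on \<Omega>. norm \<bar>smooth_pos_part c (e n) (u x) - max 0 (u x - c)\<bar> \<le> 1" for n
        using order.trans[OF smooth_pos_part_props(2)[OF e(2)] e(3)] by simp
      show "AE x in lebesgue_on \<Omega>. (\<lambda>n. \<bar>smooth_pos_part c (e n) (u x) - max 0 (u x - c)\<bar>) \<longlonglongrightarrow> 0"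
        using smooth_pos_part_props(2)[OF e(2)]
        by (intro AE_I2 Lim_null_comparison[OF _ e(1)] always_eventually allI) simp
    qed measurable
    then show "(\<lambda>n. \<integral>x. \<bar>smooth_pos_part c (e n) (u x) - max 0 (u x - c)\<bar> \<partial>lebesgue_on \<Omega>) \<longlonglongrightarrow> 0"
      by simp
    have "(\<lambda>n. \<integral>x. norm (smooth_pos_part' c (e n) (u x) *\<^sub>R G x - (if u x > c then G x else 0))
        \<partial>lebesgue_on \<Omega>) \<longlonglongrightarrow> (\<integral>x. 0 \<partial>lebesgue_on \<Omega>)"
    proof (rule integral_dominated_convergence)
      show "integrable (lebesgue_on \<Omega>) (\<lambda>x. 2 * norm (G x))"
        using G by auto
      show "AE x in lebesgue_on \<Omega>. norm (norm (smooth_pos_part' c (e n) (u x) *\<^sub>R G x -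
          (if u x > c then G x else 0))) \<le> 2 * norm (G x)" for n
      proof (rule AE_I2)
        fix x
        have "norm (smooth_pos_part' c (e n) (u x) *\<^sub>R G x) \<le> norm (G x)"
          using smooth_pos_part_props(1)[OF e(2), of c n "u x"] by (simp add: mult_left_le_one_le)
        then show "norm (norm (smooth_pos_part' c (e n) (u x) *\<^sub>R G x -
            (if u x > c then G x else 0))) \<le> 2 * norm (G x)"
          using norm_triangle_ineq4[of "smooth_pos_part' c (e n) (u x) *\<^sub>R G x" "G x"]
            norm_ge_zero[of "G x"]
          by (cases "c < u x"; simp only: if_True if_False diff_zero real_norm_def abs_norm_cancel; linarith)
      qed
      show "AE x in lebesgue_on \<Omega>. (\<lambda>n. norm (smooth_pos_part' c (e n) (u x) *\<^sub>R G x -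
          (if u x > c then G x else 0))) \<longlonglongrightarrow> 0"
      proof (rule AE_I2)
        fix x
        show "(\<lambda>n. norm (smooth_pos_part' c (e n) (u x) *\<^sub>R G x - (if u x > c then G x else 0))) \<longlonglongrightarrow> 0"
        proof (cases "u x > c")
          case True
          then have "(\<lambda>n. norm ((1 - (e n / (u x - c + e n))\<^sup>2) *\<^sub>R G x - G x)) \<longlonglongrightarrow>
              norm ((1 - (0 / (u x - c + 0))\<^sup>2) *\<^sub>R G x - G x)"
            by (intro tendsto_intros e) auto
          with True show ?thesis
            by (simp add: smooth_pos_part'_def)
        qed (simp add: smooth_pos_part'_def)
      qed
    qed measurable
    then show "(\<lambda>n. \<integral>x. norm (smooth_pos_part' c (e n) (u x) *\<^sub>R G x - (if u x > c then G x else 0))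
        \<partial>lebesgue_on \<Omega>) \<longlonglongrightarrow> 0"
      by simp
  qed
qed

text \<open>The truncation is \<open>u - (u - b)^+ + (a - u)^+\<close>, the last term being the
  positive part of \<open>- u\<close> at level \<open>- a\<close>. The signs of \<open>a\<close> and
  \<open>b\<close> make both levels nonnegative.\<close>

lemma has_weak_gradient_truncate:
  fixes u :: "'a::euclidean_space \<Rightarrow> real"
  assumes \<Omega>: "open \<Omega>" "bounded \<Omega>" and grad: "has_weak_gradient \<Omega> u G"
    and u: "integrable (lebesgue_on \<Omega>) u" and G: "integrable (lebesgue_on \<Omega>) G"
    and ab: "a \<le> 0" "0 \<le> b"
  shows "has_weak_gradient \<Omega> (\<lambda>x. max a (min b (u x))) (\<lambda>x. if a \<le> u x \<and> u x \<le> b then G x else 0)"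
proof -
  have S: "\<Omega> \<in> sets lebesgue"
    using \<Omega> by (simp add: borel_open)
  have "has_weak_gradient \<Omega> (\<lambda>x. 0) (\<lambda>x. 0 :: 'a)"
    by (subst has_weak_gradient_iff_if_integrable[OF S]) auto
  from has_weak_gradient_add_cmult[OF S this grad _ _ u G, of "-1"]
  have grad': "has_weak_gradient \<Omega> (\<lambda>x. - u x) (\<lambda>x. - G x)"
    by simp
  have u': "integrable (lebesgue_on \<Omega>) (\<lambda>x. - u x)" and G': "integrable (lebesgue_on \<Omega>) (\<lambda>x. - G x)"
    using u G by auto
  have a': "- a \<ge> 0"
    using ab by simp
  note p = has_weak_gradient_pos_part[OF \<Omega> grad u G ab(2)]
  note q = has_weak_gradient_pos_part[OF \<Omega> grad' u' G' a']
  note s = has_weak_gradient_add_cmult[OF S grad p(1) u G p(2,3), of "-1"]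
  have "has_weak_gradient \<Omega> (\<lambda>x. (u x + - 1 * max 0 (u x - b)) + 1 * max 0 (- u x - - a))
     (\<lambda>x. (G x + - 1 *\<^sub>R (if b < u x then G x else 0)) + 1 *\<^sub>R (if - a < - u x then - G x else 0))"
    using p(2,3) u G by (intro has_weak_gradient_add_cmult[OF S s q(1) _ _ q(2,3)]) auto
  moreover have "(\<lambda>x. (u x + - 1 * max 0 (u x - b)) + 1 * max 0 (- u x - - a)) =
      (\<lambda>x. max a (min b (u x)))"
    using ab by (auto simp: fun_eq_iff max_def min_def)
  moreover have "(\<lambda>x. (G x + - 1 *\<^sub>R (if b < u x then G x else 0)) +
      1 *\<^sub>R (if - a < - u x then - G x else 0)) = (\<lambda>x. if a \<le> u x \<and> u x \<le> b then G x else 0)"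
    using ab by (auto simp: fun_eq_iff)
  ultimately show ?thesis
    by simp
qed

section \<open>Strong convergence of minimising sequences\<close>

text \<open>Fatou's lemma with integrability of the limit as part of the conclusion; this is how
  finiteness of the modular of the gradient passes to the limit.\<close>

lemma integral_Fatou:
  fixes f :: "nat \<Rightarrow> 'a \<Rightarrow> real"
  assumes f: "\<And>n. integrable M (f n)" "\<And>n. AE x in M. 0 \<le> f n x"
    and g[measurable]: "g \<in> borel_measurable M" and lim: "AE x in M. (\<lambda>n. f n x) \<longlonglongrightarrow> g x"
    and le: "\<And>n. (\<integral>x. f n x \<partial>M) \<le> C"
  shows "integrable M g" "(\<integral>x. g x \<partial>M) \<le> C"
proof -
  have [measurable]: "f n \<in> borel_measurable M" for n
    using f by auto
  have all: "AE x in M. \<forall>n. 0 \<le> f n x"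
    using f(2) by (simp add: AE_all_countable)
  then have pos: "AE x in M. 0 \<le> g x"
    using lim by eventually_elim (auto intro: LIMSEQ_le_const)
  have "0 \<le> (\<integral>x. f 0 x \<partial>M)"
    using f(2) by (intro integral_nonneg_AE)
  then have C: "0 \<le> C"
    using le[of 0] by linarith
  have "AE x in M. ennreal (g x) = liminf (\<lambda>n. ennreal (f n x))"
    using lim by eventually_elim (auto intro!: lim_imp_Liminf[symmetric] tendsto_ennrealI)
  then have "(\<integral>\<^sup>+x. ennreal (g x) \<partial>M) = (\<integral>\<^sup>+x. liminf (\<lambda>n. ennreal (f n x)) \<partial>M)"
    by (rule nn_integral_cong_AE)
  also have "\<dots> \<le> liminf (\<lambda>n. \<integral>\<^sup>+x. ennreal (f n x) \<partial>M)"
    by (rule nn_integral_liminf) measurable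
  also have "\<dots> = liminf (\<lambda>n. ennreal (\<integral>x. f n x \<partial>M))"
    using f by (simp add: nn_integral_eq_integral)
  also have "\<dots> \<le> liminf (\<lambda>n::nat. ennreal C)"
    by (intro Liminf_mono always_eventually allI ennreal_leI le)
  also have "\<dots> = ennreal C"
    by (simp add: Liminf_const)
  finally have *: "(\<integral>\<^sup>+x. ennreal (g x) \<partial>M) \<le> ennreal C" .
  have "(\<integral>\<^sup>+x. ennreal (g x) \<partial>M) < \<infinity>"
    using * by (rule le_less_trans) simp
  then show "integrable M g"
    using pos by (intro integrableI_nonneg) auto
  then have "ennreal (\<integral>x. g x \<partial>M) \<le> ennreal C"
    using * pos by (simp add: nn_integral_eq_integral)
  then show "(\<integral>x. g x \<partial>M) \<le> C"
    using C by simp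
qed

text \<open>Riesz-Fischer for Banach-valued functions: a subsequence with summable L1 increments
  converges almost everywhere as a telescoping series, and Fatou's lemma gives the rate in L1. The
  values will be pairs of a number and a gradient.\<close>

lemma L1_Cauchy_obtains_limit:
  fixes w :: "nat \<Rightarrow> 'a \<Rightarrow> 'b::{banach, second_countable_topology}"
  assumes w: "\<And>n. integrable M (w n)"
    and Cauchy: "\<And>e. e > 0 \<Longrightarrow> \<exists>N. \<forall>m\<ge>N. \<forall>n\<ge>N. (\<integral>x. norm (w m x - w n x) \<partial>M) < e"
  obtains v r where "strict_mono (r :: nat \<Rightarrow> nat)" "integrable M v"
    "AE x in M. (\<lambda>n. w (r n) x) \<longlonglongrightarrow> v x" "(\<lambda>n. \<integral>x. norm (w (r n) x - v x) \<partial>M) \<longlonglongrightarrow> 0"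
proof -
  have [measurable]: "w n \<in> borel_measurable M" for n
    using w by auto
  have "\<exists>N. \<forall>k. \<forall>m\<ge>N k. \<forall>n\<ge>N k. (\<integral>x. norm (w m x - w n x) \<partial>M) < (1 / 2) ^ k"
    using Cauchy by (intro choice allI) simp
  then obtain N where N: "\<And>k m n. m \<ge> N k \<Longrightarrow> n \<ge> N k \<Longrightarrow> (\<integral>x. norm (w m x - w n x) \<partial>M) < (1 / 2) ^ k"
    by metis
  \<comment> \<open>The summand \<open>k\<close> makes \<open>r\<close> strictly increasing; the sum
    makes \<open>r m\<close> dominate \<open>N k\<close> for all \<open>k \<le> m\<close>.\<close>
  define r where "r k = k + (\<Sum>i\<le>k. N i)" for k
  have r: "strict_mono r"
    by (auto simp: strict_mono_Suc_iff r_def)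
  have rN: "r m \<ge> N k" if "m \<ge> k" for m k
  proof -
    have "N k \<le> (\<Sum>i\<le>m. N i)"
      using that by (intro member_le_sum) auto
    then show ?thesis
      by (simp add: r_def)
  qed
  define d where "d n x = w (r (Suc n)) x - w (r n) x" for n x
  have di: "integrable M (d n)" for n
    unfolding d_def[abs_def] by (intro Bochner_Integration.integrable_diff w)
  have [measurable]: "d n \<in> borel_measurable M" for n
    using di by auto
  have d_le: "(\<integral>x. norm (d n x) \<partial>M) \<le> (1 / 2) ^ n" for n
    unfolding d_def using N[of n "r (Suc n)" "r n"] rN by (simp add: less_imp_le)
  have "(\<integral>\<^sup>+x. (\<Sum>n. ennreal (norm (d n x))) \<partial>M) = (\<Sum>n. \<integral>\<^sup>+x. ennreal (norm (d n x)) \<partial>M)"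
    by (rule nn_integral_suminf) measurable
  also have "\<dots> = (\<Sum>n. ennreal (\<integral>x. norm (d n x) \<partial>M))"
    by (simp add: nn_integral_eq_integral di)
  also have "\<dots> \<le> (\<Sum>n. ennreal ((1 / 2) ^ n))"
    by (intro suminf_le ennreal_leI d_le summableI)
  also have "\<dots> < \<infinity>"
    by (subst suminf_ennreal2) (auto simp: summable_geometric)
  finally have "(\<integral>\<^sup>+x. (\<Sum>n. ennreal (norm (d n x))) \<partial>M) \<noteq> \<infinity>"
    by simp
  then have "AE x in M. (\<Sum>n. ennreal (norm (d n x))) \<noteq> \<infinity>"
    by (intro nn_integral_PInf_AE) auto
  then have summ: "AE x in M. summable (\<lambda>n. norm (d n x))"
    by eventually_elim (auto intro: summable_suminf_not_top)
  have "summable (\<lambda>n. \<integral>x. norm (d n x) \<partial>M)"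
    by (rule summable_comparison_test'[where N=0 and g="\<lambda>n. (1 / 2) ^ n"])
       (use d_le in \<open>auto simp: summable_geometric integral_nonneg_AE\<close>)
  then have i: "integrable M (\<lambda>x. \<Sum>n. d n x)"
    by (intro integrable_suminf di summ)
  define v where "v x = w (r 0) x + (\<Sum>n. d n x)" for x
  have vi: "integrable M v"
    unfolding v_def[abs_def] by (intro Bochner_Integration.integrable_add w i)
  have [measurable]: "v \<in> borel_measurable M"
    using vi by auto
  have lim: "AE x in M. (\<lambda>n. w (r n) x) \<longlonglongrightarrow> v x"
    using summ
  proof eventually_elim
    case (elim x)
    have "w (r n) x = w (r 0) x + (\<Sum>i<n. d i x)" for n
      by (induction n) (auto simp: d_def)
    then have eq: "(\<lambda>n. w (r n) x) = (\<lambda>n. w (r 0) x + (\<Sum>i<n. d i x))"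
      by (rule ext)
    have "(\<lambda>n. w (r 0) x + (\<Sum>i<n. d i x)) \<longlonglongrightarrow> v x"
      unfolding v_def using elim by (intro tendsto_add tendsto_const summable_LIMSEQ) (rule summable_norm_cancel)
    then show ?case
      by (subst eq)
  qed
  have "(\<lambda>n. \<integral>x. norm (w (r n) x - v x) \<partial>M) \<longlonglongrightarrow> 0"
  proof (rule Lim_null_comparison)
    show "(\<lambda>n. (1 / 2 :: real) ^ n) \<longlonglongrightarrow> 0"
      by (intro LIMSEQ_realpow_zero) auto
    have "(\<integral>x. norm (w (r n) x - v x) \<partial>M) \<le> (1 / 2) ^ n" for n
    proof (rule integral_Fatou(2))
      show "integrable M (\<lambda>x. norm (w (r n) x - w (r (m + n)) x))" for m
        by (intro integrable_norm Bochner_Integration.integrable_diff w)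
      show "(\<integral>x. norm (w (r n) x - w (r (m + n)) x) \<partial>M) \<le> (1 / 2) ^ n" for m
        using N[of n "r n" "r (m + n)"] rN by (simp add: less_imp_le)
      show "AE x in M. (\<lambda>m. norm (w (r n) x - w (r (m + n)) x)) \<longlonglongrightarrow> norm (w (r n) x - v x)"
        using lim
      proof eventually_elim
        case (elim x)
        show ?case
          using LIMSEQ_ignore_initial_segment[OF elim, of n]
          by (intro tendsto_norm tendsto_diff tendsto_const)
      qed
    qed auto
    then show "\<forall>\<^sub>F n in sequentially. norm (\<integral>x. norm (w (r n) x - v x) \<partial>M) \<le> (1 / 2) ^ n"
      by (simp add: integral_nonneg_AE)
  qed
  with r vi lim show thesis
    by (rule that)
qed

section \<open>The Japanese bracket and its quantitative convexity\<close>

definition jbracket :: "'b::real_inner \<Rightarrow> real" where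
  "jbracket z = sqrt (1 + z \<bullet> z)"

lemma jbracket_ge_1: "jbracket z \<ge> 1"
  by (simp add: jbracket_def)

lemma norm_le_jbracket: "norm z \<le> jbracket z"
  by (simp add: jbracket_def norm_eq_sqrt_inner)

lemma jbracket_le: "jbracket z \<le> 1 + norm z"
proof -
  have "sqrt (1 + z \<bullet> z) \<le> sqrt ((1 + norm z)\<^sup>2)"
    by (intro real_sqrt_le_mono) (simp add: power2_eq_square algebra_simps norm_eq_sqrt_inner)
  then show ?thesis
    by (simp add: jbracket_def)
qed

lemma borel_measurable_jbracket [measurable]:
  "jbracket \<in> borel_measurable (borel :: 'b::{real_inner, second_countable_topology} measure)"
  unfolding jbracket_def[abs_def] by measurable

text \<open>\<open>A\<close> and \<open>B\<close> are the lengths of the vectors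
  \<open>(1, a)\<close> and \<open>(1, b)\<close>, and \<open>p\<close> is the defect in their
  Cauchy-Schwarz inequality. Factoring the difference of squares in Lagrange's identity bounds the
  squared distance by \<open>2 * A * B * p\<close>, and expanding squares gives
  \<open>p = 2 * (H - C) * (H + C)\<close> for the mean \<open>H\<close> and the bracket
  \<open>C\<close> of the midpoint.\<close>

lemma jbracket_midpoint_gap:
  fixes a b :: "'b::real_inner"
  shows "(norm (a - b))\<^sup>2 \<le> 4 * jbracket a * jbracket b * (jbracket a + jbracket b) *
      ((jbracket a + jbracket b) / 2 - jbracket ((1 / 2) *\<^sub>R (a + b)))"
    and "jbracket ((1 / 2) *\<^sub>R (a + b)) \<le> (jbracket a + jbracket b) / 2"
proof -
  define A B C H p where "A = jbracket a" and "B = jbracket b"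
    and "C = jbracket ((1 / 2) *\<^sub>R (a + b))" and "H = (A + B) / 2" and "p = A * B - (1 + a \<bullet> b)"
  have H: "A + B = 2 * H"
    by (simp add: H_def)
  have ge: "A \<ge> 1" "B \<ge> 1" "C \<ge> 1"
    by (simp_all add: A_def B_def C_def jbracket_ge_1)
  have sq: "(jbracket z)\<^sup>2 = 1 + z \<bullet> z" for z :: 'b
    by (simp add: jbracket_def)
  have A2: "A\<^sup>2 = 1 + a \<bullet> a" and B2: "B\<^sup>2 = 1 + b \<bullet> b"
    by (simp_all add: A_def B_def sq)
  have C2: "4 * C\<^sup>2 = 4 + (a \<bullet> a + b \<bullet> b + 2 * (a \<bullet> b))"
    unfolding C_def sq by (simp add: inner_add_left inner_add_right inner_commute)
  have D: "(norm (a - b))\<^sup>2 = a \<bullet> a + b \<bullet> b - 2 * (a \<bullet> b)"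
    by (simp add: power2_norm_eq_inner inner_diff_left inner_diff_right inner_commute)
  have "(A * B)\<^sup>2 - (1 + a \<bullet> b)\<^sup>2 = (norm (a - b))\<^sup>2 + ((a \<bullet> a) * (b \<bullet> b) - (a \<bullet> b)\<^sup>2)"
    unfolding power_mult_distrib A2 B2 D by (simp add: power2_eq_square algebra_simps)
  then have 1: "(norm (a - b))\<^sup>2 \<le> (A * B)\<^sup>2 - (1 + a \<bullet> b)\<^sup>2"
    using Cauchy_Schwarz_ineq[of a b] by linarith
  then have "(1 + a \<bullet> b)\<^sup>2 \<le> (A * B)\<^sup>2"
    using zero_le_power2[of "norm (a - b)"] by linarith
  then have "\<bar>1 + a \<bullet> b\<bar> \<le> A * B"
    using ge by (intro power2_le_imp_le[of "\<bar>1 + a \<bullet> b\<bar>"]) auto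
  then have p: "p \<ge> 0" "A * B + (1 + a \<bullet> b) \<le> 2 * (A * B)"
    by (auto simp: p_def)
  have "(norm (a - b))\<^sup>2 \<le> p * (A * B + (1 + a \<bullet> b))"
    using 1 by (simp add: p_def power2_eq_square algebra_simps)
  also have "\<dots> \<le> p * (2 * (A * B))"
    using p by (intro mult_left_mono) auto
  finally have 2: "(norm (a - b))\<^sup>2 \<le> 2 * (A * B) * p"
    by (simp only: mult_ac)
  have 3: "2 * ((H - C) * (H + C)) = p"
  proof -
    have "(2 * H)\<^sup>2 = A\<^sup>2 + B\<^sup>2 + 2 * (A * B)"
      unfolding H[symmetric] by (simp add: power2_eq_square algebra_simps)
    moreover have "4 * ((H - C) * (H + C)) = (2 * H)\<^sup>2 - 4 * C\<^sup>2"
      by (simp add: power2_eq_square algebra_simps)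
    ultimately show ?thesis
      unfolding A2 B2 C2 p_def by linarith
  qed
  then have "0 \<le> (H - C) * (H + C)"
    using p by linarith
  moreover have "H + C > 0"
    using ge H by linarith
  ultimately have gap: "C \<le> H"
    by (simp add: zero_le_mult_iff)
  then show "jbracket ((1 / 2) *\<^sub>R (a + b)) \<le> (jbracket a + jbracket b) / 2"
    by (simp add: A_def B_def C_def H_def)
  \<comment> \<open>\<open>C \<le> H\<close> gives \<open>H + C \<le> A + B\<close>.\<close>
  have "(H - C) * (H + C) \<le> (H - C) * (A + B)"
    using gap H by (intro mult_left_mono) linarith+
  with 3 have "p \<le> 2 * ((H - C) * (A + B))"
    by linarith
  then have "2 * (A * B) * p \<le> 2 * (A * B) * (2 * ((H - C) * (A + B)))"
    using ge by (intro mult_left_mono) auto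
  with 2 have "(norm (a - b))\<^sup>2 \<le> 2 * (A * B) * (2 * ((H - C) * (A + B)))"
    by linarith
  also have "\<dots> = 4 * A * B * (A + B) * (H - C)"
    by simp
  finally show "(norm (a - b))\<^sup>2 \<le> 4 * jbracket a * jbracket b * (jbracket a + jbracket b) *
      ((jbracket a + jbracket b) / 2 - jbracket ((1 / 2) *\<^sub>R (a + b)))"
    by (simp only: A_def B_def C_def H_def)
qed

text \<open>If both brackets are at most \<open>R\<close>, the squared distance is at most
  \<open>8 * R ^ 3\<close> times the gap, and \<open>d \<le> e + d^2 / (4 * e)\<close> linearises
  it. Otherwise the distance is at most twice the larger bracket, which exceeds \<open>R\<close> and
  so is absorbed by its \<open>q\<close>-th power with the factor
  \<open>R powr (1 - q)\<close>.\<close>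

lemma norm_diff_le_gap:
  fixes a b :: "'b::real_inner"
  assumes q: "q > 1" and R: "R \<ge> 1" and e: "e > 0"
  shows "norm (a - b) \<le> e +
    2 * R ^ 3 / e * ((jbracket a + jbracket b) / 2 - jbracket ((1 / 2) *\<^sub>R (a + b))) +
    2 * R powr (1 - q) * (jbracket a powr q + jbracket b powr q)"
proof -
  define A B \<gamma> d where "A = jbracket a" and "B = jbracket b"
    and "\<gamma> = (A + B) / 2 - jbracket ((1 / 2) *\<^sub>R (a + b))" and "d = norm (a - b)"
  have ge: "A \<ge> 1" "B \<ge> 1" "\<gamma> \<ge> 0"
    using jbracket_midpoint_gap(2)[of a b] by (simp_all add: A_def B_def \<gamma>_def jbracket_ge_1)
  have d2: "d\<^sup>2 \<le> 4 * A * B * (A + B) * \<gamma>"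
    using jbracket_midpoint_gap(1)[of a b] by (simp add: A_def B_def \<gamma>_def d_def)
  have tail: "c \<le> R powr (1 - q) * c powr q" if "c > R" for c
  proof -
    have "c = c powr (1 - q) * c powr q"
      using that R by (simp flip: powr_add)
    also have "\<dots> \<le> R powr (1 - q) * c powr q"
      using that R q by (intro mult_right_mono powr_mono2') auto
    finally show ?thesis .
  qed
  have rest: "0 \<le> 2 * R ^ 3 / e * \<gamma>" "0 \<le> R powr (1 - q) * A powr q" "0 \<le> R powr (1 - q) * B powr q"
    using R e ge by auto
  have "d \<le> e + 2 * R ^ 3 / e * \<gamma> + 2 * R powr (1 - q) * (A powr q + B powr q)"
  proof (cases "A \<le> R \<and> B \<le> R")
    case True
    have "4 * A * B * (A + B) * \<gamma> \<le> 4 * R * R * (R + R) * \<gamma>"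
      using True ge R by (intro mult_mono mult_right_mono add_mono) auto
    moreover have "4 * R * R * (R + R) * \<gamma> = 8 * R ^ 3 * \<gamma>"
      by (simp add: power3_eq_cube)
    ultimately have "d\<^sup>2 \<le> 8 * R ^ 3 * \<gamma>"
      using d2 by linarith
    then have "d\<^sup>2 / (4 * e) \<le> 8 * R ^ 3 * \<gamma> / (4 * e)"
      using e by (intro divide_right_mono) auto
    moreover have "d \<le> e + d\<^sup>2 / (4 * e)"
    proof -
      have "0 \<le> (2 * e - d)\<^sup>2"
        by simp
      then show ?thesis
        using e by (simp add: field_simps power2_eq_square)
    qed
    moreover have "8 * R ^ 3 * \<gamma> / (4 * e) = 2 * R ^ 3 / e * \<gamma>"
      using e by (simp add: field_simps)
    ultimately show ?thesis
      using rest unfolding distrib_left mult.assoc[of 2 "R powr (1 - q)"] by linarith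
  next
    case False
    have "d \<le> norm a + norm b"
      by (simp add: d_def norm_triangle_ineq4)
    also have "\<dots> \<le> A + B"
      by (intro add_mono) (simp_all add: A_def B_def norm_le_jbracket)
    also have "\<dots> \<le> 2 * (R powr (1 - q) * A powr q + R powr (1 - q) * B powr q)"
    proof (cases "A \<le> B")
      case True
      with False have "B \<le> R powr (1 - q) * B powr q"
        by (intro tail) auto
      with True rest(2) show ?thesis
        unfolding distrib_left by linarith
    next
      case False': False
      with False have "A \<le> R powr (1 - q) * A powr q"
        by (intro tail) auto
      with False' rest(3) show ?thesis
        unfolding distrib_left by linarith
    qed
    finally show ?thesis
      using rest e unfolding distrib_left mult.assoc[of 2 "R powr (1 - q)"] by linarith
  qed
  then show ?thesis
    by (simp add: A_def B_def \<gamma>_def d_def)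
qed

text \<open>The gap controls the part where the brackets are bounded, and the moment of order
  \<open>q > 1\<close> the rest, as in the criterion of de la Vallee Poussin. The parameters are
  fixed in the order \<open>s\<close>, \<open>R\<close>, \<open>N\<close>, because the coefficient
  of the gap depends on the first two.\<close>

lemma L1_Cauchy_if_gap:
  fixes w :: "nat \<Rightarrow> 'a \<Rightarrow> 'b::euclidean_space"
  assumes fin: "finite_measure M" and w[measurable]: "\<And>n. w n \<in> borel_measurable M"
    and q: "q > 1" and i: "\<And>n. integrable M (\<lambda>x. jbracket (w n x) powr q)"
    and le: "\<And>n. (\<integral>x. jbracket (w n x) powr q \<partial>M) \<le> B"
    and gap: "\<And>e. e > 0 \<Longrightarrow> \<exists>N. \<forall>m\<ge>N. \<forall>n\<ge>N. (\<integral>x. (jbracket (w m x) + jbracket (w n x)) / 2 -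
      jbracket ((1 / 2) *\<^sub>R (w m x + w n x)) \<partial>M) < e"
    and e: "e > 0"
  shows "\<exists>N. \<forall>m\<ge>N. \<forall>n\<ge>N. (\<integral>x. norm (w m x - w n x) \<partial>M) < e"
proof -
  interpret finite_measure M by fact
  define \<mu> where "\<mu> = measure M (space M)"
  have \<mu>: "\<mu> \<ge> 0"
    by (simp add: \<mu>_def)
  have B: "B \<ge> 0"
    using le[of 0] by (rule order.trans[rotated]) (simp add: integral_nonneg_AE)
  have j_le: "jbracket z \<le> jbracket z powr q" for z :: 'b
    using powr_mono[of 1 q "jbracket z"] q jbracket_ge_1[of z] by simp
  have ji: "integrable M (\<lambda>x. jbracket (w n x))" for n
    by (rule Bochner_Integration.integrable_bound[OF i[of n]])
       (use j_le jbracket_ge_1 in \<open>auto intro!: AE_I2 simp: abs_of_nonneg order.trans[OF zero_le_one jbracket_ge_1]\<close>)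
  have wi: "integrable M (w n)" for n
    by (rule Bochner_Integration.integrable_bound[OF ji[of n]])
       (auto intro!: AE_I2 order.trans[OF norm_le_jbracket])
  have mi: "integrable M (\<lambda>x. jbracket ((1 / 2) *\<^sub>R (w m x + w n x)))" for m n
  proof (rule Bochner_Integration.integrable_bound)
    show "integrable M (\<lambda>x. (jbracket (w m x) + jbracket (w n x)) / 2)"
      using ji by auto
    show "AE x in M. norm (jbracket ((1 / 2) *\<^sub>R (w m x + w n x))) \<le>
        norm ((jbracket (w m x) + jbracket (w n x)) / 2)"
      using jbracket_midpoint_gap(2) jbracket_ge_1
      by (intro AE_I2) (simp add: abs_of_nonneg order.trans[OF zero_le_one jbracket_ge_1])
  qed measurable
  \<comment> \<open>The \<open>+ 1\<close> covers a measure of total mass 0.\<close>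
  define s where "s = e / (4 * (\<mu> + 1))"
  have "s * (\<mu> + 1) = e / 4"
    using \<mu> by (simp add: s_def field_simps)
  moreover have "s > 0"
    using e \<mu> by (simp add: s_def)
  moreover have "s * (\<mu> + 1) = s * \<mu> + s"
    by (simp add: distrib_left)
  ultimately have s: "s > 0" "s * \<mu> < e / 3"
    using e by simp_all
  \<comment> \<open>\<open>q > 1\<close> makes the coefficient of the moments vanish as
    \<open>R\<close> grows.\<close>
  have "((\<lambda>R. 2 * R powr (1 - q) * (B + B)) \<longlongrightarrow> 2 * 0 * (B + B)) at_top"
    using q by (intro tendsto_intros tendsto_neg_powr filterlim_ident) auto
  then have "eventually (\<lambda>R. 2 * R powr (1 - q) * (B + B) < e / 3) at_top"
    using e by (intro order_tendstoD) auto
  then obtain R where R: "R \<ge> 1" "2 * R powr (1 - q) * (B + B) < e / 3"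
    using eventually_conj[OF _ eventually_ge_at_top[of 1]] eventually_happens'[of at_top]
    by (metis (mono_tags, lifting) trivial_limit_at_top_linorder)
  define c where "c = 2 * R ^ 3 / s"
  have c: "c > 0"
    using R s by (simp add: c_def)
  then obtain N where N: "\<And>m n. m \<ge> N \<Longrightarrow> n \<ge> N \<Longrightarrow>
      (\<integral>x. (jbracket (w m x) + jbracket (w n x)) / 2 - jbracket ((1 / 2) *\<^sub>R (w m x + w n x)) \<partial>M)
      < e / (3 * c)"
    using gap[of "e / (3 * c)"] e by auto
  have "(\<integral>x. norm (w m x - w n x) \<partial>M) < e" if mn: "m \<ge> N" "n \<ge> N" for m n
  proof -
    let ?g = "\<lambda>x. (jbracket (w m x) + jbracket (w n x)) / 2 - jbracket ((1 / 2) *\<^sub>R (w m x + w n x))"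
    have gi: "integrable M ?g"
      using ji mi by auto
    have "(\<integral>x. norm (w m x - w n x) \<partial>M) \<le> (\<integral>x. s + c * ?g x +
        2 * R powr (1 - q) * (jbracket (w m x) powr q + jbracket (w n x) powr q) \<partial>M)"
      using wi gi i norm_diff_le_gap[OF q R(1) s(1)] unfolding c_def
      by (intro integral_mono) auto
    also have "\<dots> = s * \<mu> + c * (\<integral>x. ?g x \<partial>M) + 2 * R powr (1 - q) *
        ((\<integral>x. jbracket (w m x) powr q \<partial>M) + (\<integral>x. jbracket (w n x) powr q \<partial>M))"
      using gi i by (simp add: \<mu>_def del: divide_const_simps)
    also have "\<dots> \<le> s * \<mu> + c * (\<integral>x. ?g x \<partial>M) + 2 * R powr (1 - q) * (B + B)"
      by (intro add_mono mult_left_mono order.refl le) auto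
    also have "c * (\<integral>x. ?g x \<partial>M) < e / 3"
      using N[OF mn] c by (simp add: field_simps)
    finally show ?thesis
      using s(2) R(2) by linarith
  qed
  then show ?thesis by blast
qed

text \<open>
  Instead of weak compactness, the minimising sequence is chosen so that among all
  near-minimisers it also nearly minimises the strictly convex integral of
  \<^const>\<open>jbracket\<close>, which forces strong convergence.
\<close>

lemma minimizing_sequence_converges:
  fixes K :: "('a \<Rightarrow> 'b::euclidean_space) set" and J :: "('a \<Rightarrow> 'b) \<Rightarrow> real"
  assumes fin: "finite_measure M" and ne: "K \<noteq> {}"
    and meas: "\<And>w. w \<in> K \<Longrightarrow> w \<in> borel_measurable M"
    and mid: "\<And>w v. w \<in> K \<Longrightarrow> v \<in> K \<Longrightarrow> (\<lambda>x. (1 / 2) *\<^sub>R (w x + v x)) \<in> K"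
    and conv: "\<And>w v. w \<in> K \<Longrightarrow> v \<in> K \<Longrightarrow> J (\<lambda>x. (1 / 2) *\<^sub>R (w x + v x)) \<le> (J w + J v) / 2"
    and bdd: "bdd_below (J ` K)" and q: "q > 1"
    and i: "\<And>w. w \<in> K \<Longrightarrow> integrable M (\<lambda>x. jbracket (w x) powr q)"
    and le: "\<And>w. w \<in> K \<Longrightarrow> J w \<le> Inf (J ` K) + 1 \<Longrightarrow> (\<integral>x. jbracket (w x) powr q \<partial>M) \<le> B"
  obtains w v where "\<And>n :: nat. w n \<in> K" "(\<lambda>n. J (w n)) \<longlonglongrightarrow> Inf (J ` K)"
    "\<And>n. integrable M (w n)" "integrable M v" "AE x in M. (\<lambda>n. w n x) \<longlonglongrightarrow> v x"
    "(\<lambda>n. \<integral>x. norm (w n x - v x) \<partial>M) \<longlonglongrightarrow> 0"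
proof -
  define m where "m = Inf (J ` K)"
  have m: "m \<le> J w" if "w \<in> K" for w
    unfolding m_def using bdd that by (auto intro: cInf_lower)
  define \<iota> where "\<iota> n = inverse (real (Suc n))" for n
  have \<iota>: "\<iota> \<longlonglongrightarrow> 0" "\<And>n. \<iota> n > 0" "\<iota> 0 = 1"
    unfolding \<iota>_def[abs_def] by (rule LIMSEQ_inverse_real_of_nat) simp_all
  have inv: "\<iota> k \<le> \<iota> n" if "n \<le> k" for n k
    using that by (simp add: \<iota>_def field_simps)
  \<comment> \<open>Sublevel sets at heights decreasing to the infimum: nested, nonempty and closed
    under midpoints.\<close>
  define C where "C n = {w \<in> K. J w \<le> m + \<iota> n}" for n
  have C_mono: "C k \<subseteq> C n" if "n \<le> k" for n k
    using inv[OF that] by (force simp: C_def)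
  have C_ne: "C n \<noteq> {}" for n
  proof -
    have "\<exists>y\<in>J ` K. y < m + \<iota> n"
      using ne by (intro cInf_lessD) (auto simp flip: m_def simp: \<iota>(2))
    then show ?thesis
      by (auto simp: C_def less_imp_le)
  qed
  have C_mid: "(\<lambda>x. (1 / 2) *\<^sub>R (w x + v x)) \<in> C n" if "w \<in> C n" "v \<in> C n" for w v n
  proof -
    have "J (\<lambda>x. (1 / 2) *\<^sub>R (w x + v x)) \<le> (J w + J v) / 2"
      using that conv by (auto simp: C_def)
    then show ?thesis
      using that mid by (auto simp: C_def)
  qed
  have C_K: "w \<in> K" "J w \<le> Inf (J ` K) + 1" if "w \<in> C n" for w n
    using that inv[of 0 n] \<iota>(3) by (auto simp: C_def m_def)
  define \<Theta> where "\<Theta> w = (\<integral>x. jbracket (w x) \<partial>M)" for w :: "'a \<Rightarrow> 'b"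
  have j_le: "jbracket z \<le> jbracket z powr q" for z :: 'b
    using powr_mono[of 1 q "jbracket z"] q jbracket_ge_1[of z] by simp
  have j0: "0 \<le> jbracket z" for z :: 'b
    using jbracket_ge_1[of z] by linarith
  have ji: "integrable M (\<lambda>x. jbracket (w x))" if "w \<in> K" for w
    by (rule Bochner_Integration.integrable_bound[OF i[OF that]])
       (use j_le j0 meas[OF that] in auto)
  have \<Theta>_bounds: "0 \<le> \<Theta> w" "\<Theta> w \<le> B" if "w \<in> C n" for w n
  proof -
    show "0 \<le> \<Theta> w"
      unfolding \<Theta>_def using j0 by (intro integral_nonneg_AE) auto
    have "\<Theta> w \<le> (\<integral>x. jbracket (w x) powr q \<partial>M)"
      unfolding \<Theta>_def using C_K[OF that] j_le by (intro integral_mono ji i) auto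
    then show "\<Theta> w \<le> B"
      using le[OF C_K[OF that]] by linarith
  qed
  \<comment> \<open>\<open>\<mu> n\<close> grows with \<open>n\<close> since the sets
    \<open>C n\<close> shrink, and it is bounded by \<open>B\<close>; its convergence is what makes
    the gaps small.\<close>
  define \<mu> where "\<mu> n = Inf (\<Theta> ` C n)" for n
  have bdd\<Theta>: "bdd_below (\<Theta> ` C n)" for n
    using \<Theta>_bounds(1) by (intro bdd_belowI[of _ 0]) auto
  have \<mu>_le: "\<mu> n \<le> \<Theta> w" if "w \<in> C n" for w n
    unfolding \<mu>_def using bdd\<Theta> that by (auto intro: cInf_lower)
  have "\<exists>w\<in>C n. \<Theta> w < \<mu> n + \<iota> n" for n
  proof -
    have "\<exists>y\<in>\<Theta> ` C n. y < \<mu> n + \<iota> n"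
      using C_ne by (intro cInf_lessD) (auto simp flip: \<mu>_def simp: \<iota>(2))
    then show ?thesis by auto
  qed
  then obtain w where w: "\<And>n. w n \<in> C n" "\<And>n. \<Theta> (w n) < \<mu> n + \<iota> n"
    by metis
  have "incseq \<mu>"
    unfolding \<mu>_def by (intro incseq_SucI cInf_superset_mono bdd\<Theta> image_mono C_mono)
      (use C_ne in auto)
  moreover have "\<mu> n \<le> B" for n
    using \<mu>_le[OF w(1)] \<Theta>_bounds(2)[OF w(1)] order.trans by blast
  ultimately obtain L where L: "\<mu> \<longlonglongrightarrow> L" "\<And>n. \<mu> n \<le> L"
    using incseq_convergent[of \<mu> B] by blast
  have wK: "w n \<in> K" for n
    using C_K w(1) by blast
  have gap: "\<exists>N. \<forall>k\<ge>N. \<forall>l\<ge>N. (\<integral>x. (jbracket (w k x) + jbracket (w l x)) / 2 -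
      jbracket ((1 / 2) *\<^sub>R (w k x + w l x)) \<partial>M) < e" if e: "e > 0" for e
  proof -
    have "(\<lambda>n. L + \<iota> n - \<mu> n) \<longlonglongrightarrow> L + 0 - L"
      by (intro tendsto_intros L \<iota>(1))
    then have "eventually (\<lambda>n. L + \<iota> n - \<mu> n < e) sequentially"
      using e by (intro order_tendstoD) auto
    then obtain N where N: "L + \<iota> N - \<mu> N < e"
      by (auto simp: eventually_sequentially)
    have "(\<integral>x. (jbracket (w k x) + jbracket (w l x)) / 2 -
      jbracket ((1 / 2) *\<^sub>R (w k x + w l x)) \<partial>M) < e" if kl: "k \<ge> N" "l \<ge> N" for k l
    proof -
      \<comment> \<open>The midpoint competes in \<open>C N\<close>, so its bracket integral is at
        least \<open>\<mu> N\<close>, whereas those of \<open>w k\<close> and \<open>w l\<close> are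
        below \<open>L + \<iota> N\<close>.\<close>
      have midC: "(\<lambda>x. (1 / 2) *\<^sub>R (w k x + w l x)) \<in> C N"
        using w(1) C_mono kl by (intro C_mid) blast+
      have "(\<integral>x. (jbracket (w k x) + jbracket (w l x)) / 2 -
          jbracket ((1 / 2) *\<^sub>R (w k x + w l x)) \<partial>M) =
          (\<Theta> (w k) + \<Theta> (w l)) / 2 - \<Theta> (\<lambda>x. (1 / 2) *\<^sub>R (w k x + w l x))"
        unfolding \<Theta>_def using ji[OF wK] ji[OF C_K(1)[OF midC]] by (simp del: divide_const_simps)
      also have "\<dots> \<le> (\<mu> k + \<iota> k + (\<mu> l + \<iota> l)) / 2 - \<mu> N"
        using w(2)[of k] w(2)[of l] \<mu>_le[OF midC] by (simp add: field_simps)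
      also have "\<dots> \<le> L + \<iota> N - \<mu> N"
        using L(2)[of k] L(2)[of l] inv[OF kl(1)] inv[OF kl(2)] by (simp add: field_simps)
      finally show ?thesis
        using N by linarith
    qed
    then show ?thesis by blast
  qed
  have wi: "integrable M (w n)" for n
    by (rule Bochner_Integration.integrable_bound[OF ji[OF wK[of n]]])
       (use meas[OF wK] in \<open>auto intro!: AE_I2 order.trans[OF norm_le_jbracket]\<close>)
  have cauchy: "\<exists>N. \<forall>k\<ge>N. \<forall>l\<ge>N. (\<integral>x. norm (w k x - w l x) \<partial>M) < e" if "e > 0" for e
    using L1_Cauchy_if_gap[OF fin meas[OF wK] q i[OF wK] le[OF C_K[OF w(1)]] gap that] by blast
  obtain r v where r: "strict_mono (r :: nat \<Rightarrow> nat)" and v: "integrable M v"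
    "AE x in M. (\<lambda>n. w (r n) x) \<longlonglongrightarrow> v x" "(\<lambda>n. \<integral>x. norm (w (r n) x - v x) \<partial>M) \<longlonglongrightarrow> 0"
    by (rule L1_Cauchy_obtains_limit[OF wi cauchy])
  have Jlim: "(\<lambda>n. J (w n)) \<longlonglongrightarrow> m"
  proof (rule tendsto_sandwich[where f="\<lambda>_. m"])
    have "(\<lambda>n. m + \<iota> n) \<longlonglongrightarrow> m + 0"
      by (intro tendsto_intros \<iota>(1))
    then show "(\<lambda>n. m + \<iota> n) \<longlonglongrightarrow> m"
      by simp
  qed (use m wK w(1) in \<open>auto simp: C_def\<close>)
  show thesis
    by (rule that[of "\<lambda>n. w (r n)", OF wK _ wi v])
       (use LIMSEQ_subseq_LIMSEQ[OF Jlim r] in \<open>simp add: o_def m_def\<close>)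
qed

section \<open>The flux and its potential\<close>

text \<open>Completeness of Lebesgue measure. It serves for limits that are known only at almost
  every \<open>x\<close>.\<close>

lemma measurable_lebesgue_on_AE:
  fixes f g :: "'a::euclidean_space \<Rightarrow> real"
  assumes S: "S \<in> sets lebesgue" and f: "f \<in> borel_measurable (lebesgue_on S)"
    and ae: "AE x in lebesgue_on S. f x = g x"
  shows "g \<in> borel_measurable (lebesgue_on S)"
proof -
  have "(\<lambda>x. if x \<in> S then f x else 0) \<in> borel_measurable lebesgue"
    using f S by (simp add: borel_measurable_if)
  moreover have "AE x in lebesgue. (if x \<in> S then f x else 0) = (if x \<in> S then g x else 0)"
    using ae S by (auto simp: AE_restrict_space_iff elim: eventually_mono)
  ultimately have "(\<lambda>x. if x \<in> S then g x else 0) \<in> borel_measurable lebesgue"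
    by (rule borel_measurable_AE)
  then show ?thesis
    using S by (simp add: borel_measurable_if)
qed

text \<open>To be applied to \<open>\<Phi>(x, \<cdot>)\<close> for almost every \<open>x\<close>.\<close>

definition growth_profile :: "(real \<Rightarrow> real) \<Rightarrow> bool" where
  "growth_profile \<phi> \<longleftrightarrow> continuous_on {0..} \<phi> \<and> mono_on {0..} \<phi> \<and> \<phi> 0 = 0"

lemma growth_profile_nonneg: "growth_profile \<phi> \<Longrightarrow> s \<ge> 0 \<Longrightarrow> \<phi> s \<ge> 0"
  unfolding growth_profile_def mono_on_def by (metis atLeast_iff order.refl)

lemma growth_profile_mono: "growth_profile \<phi> \<Longrightarrow> 0 \<le> s \<Longrightarrow> s \<le> t \<Longrightarrow> \<phi> s \<le> \<phi> t"
  unfolding growth_profile_def mono_on_def by auto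

lemma growth_profile_integrable:
  "growth_profile \<phi> \<Longrightarrow> 0 \<le> s \<Longrightarrow> \<phi> integrable_on {s..t}"
  by (rule integrable_continuous_interval)
     (auto simp: growth_profile_def intro: continuous_on_subset)

lemma growth_profile_integral_diff:
  assumes \<phi>: "growth_profile \<phi>" and st: "0 \<le> s" "s \<le> t"
  shows "\<phi> s * (t - s) \<le> integral {0..t} \<phi> - integral {0..s} \<phi>"
    "integral {0..t} \<phi> - integral {0..s} \<phi> \<le> \<phi> t * (t - s)"
proof -
  have "integral {0..s} \<phi> + integral {s..t} \<phi> = integral {0..t} \<phi>"
    using st \<phi> by (intro Henstock_Kurzweil_Integration.integral_combine growth_profile_integrable) auto
  then have eq: "integral {0..t} \<phi> - integral {0..s} \<phi> = integral {s..t} \<phi>"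
    by linarith
  have i: "\<phi> integrable_on {s..t}"
    using \<phi> st(1) by (rule growth_profile_integrable)
  have "integral {s..t} (\<lambda>_. \<phi> s) \<le> integral {s..t} \<phi>"
    using \<phi> st i by (intro integral_le) (auto intro: growth_profile_mono)
  then show "\<phi> s * (t - s) \<le> integral {0..t} \<phi> - integral {0..s} \<phi>"
    using st by (simp add: eq mult.commute)
  have "integral {s..t} \<phi> \<le> integral {s..t} (\<lambda>_. \<phi> t)"
    using \<phi> st i by (intro integral_le) (auto intro: growth_profile_mono)
  then show "integral {0..t} \<phi> - integral {0..s} \<phi> \<le> \<phi> t * (t - s)"
    using st by (simp add: eq mult.commute)
qed

text \<open>The primitive of a monotone function is convex, and \<open>\<phi> t\<close> is its slope
  at \<open>t\<close>. For \<open>t < s\<close> both differences change sign, which turns the lower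
  bound of the preceding estimate into the upper bound here.\<close>

lemma growth_profile_integral_le:
  assumes \<phi>: "growth_profile \<phi>" and st: "0 \<le> s" "0 \<le> t"
  shows "integral {0..t} \<phi> - integral {0..s} \<phi> \<le> \<phi> t * (t - s)"
proof (cases "s \<le> t")
  case False
  then show ?thesis
    using growth_profile_integral_diff(1)[OF \<phi> st(2), of s] by (simp add: algebra_simps)
qed (use growth_profile_integral_diff(2)[OF \<phi> st(1)] in auto)

lemma growth_profile_integral_nonneg:
  "growth_profile \<phi> \<Longrightarrow> 0 \<le> s \<Longrightarrow> 0 \<le> integral {0..s} \<phi>"
  by (rule integral_nonneg[OF growth_profile_integrable]) (auto intro: growth_profile_nonneg)

text \<open>Meant for \<open>s = v x\<close>: the potential becomes a limit of finite sums with
  values \<open>Phi_of \<Psi> x (c * v x)\<close>, so that measurability in \<open>x\<close> can be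
  read off from fixed multiples of \<open>v\<close>. The error of the left endpoint rule telescopes,
  since monotonicity bounds each term by the increment of \<open>\<phi>\<close> times the
  step.\<close>

lemma growth_profile_riemann_sum:
  assumes \<phi>: "growth_profile \<phi>" and s: "0 \<le> s"
  shows "(\<lambda>n. \<Sum>i<Suc n. \<phi> (real i / real (Suc n) * s) * (1 / real (Suc n) * s))
    \<longlonglongrightarrow> integral {0..s} \<phi>"
proof -
  define F where "F t = integral {0..t} \<phi>" for t
  define R where "R n = (\<Sum>i<Suc n. \<phi> (real i / real (Suc n) * s) * (1 / real (Suc n) * s))" for n
  have bound: "0 \<le> F s - R n \<and> F s - R n \<le> \<phi> s * s * inverse (real (Suc n))" for n
  proof -
    define h where "h = 1 / real (Suc n) * s"
    have h: "h \<ge> 0" "real (Suc n) * h = s"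
      using s by (simp_all add: h_def)
    have a: "real i / real (Suc n) * s = real i * h" for i
      by (simp add: h_def)
    have step: "0 \<le> F (real (Suc i) * h) - F (real i * h) - \<phi> (real i * h) * h \<and>
        F (real (Suc i) * h) - F (real i * h) - \<phi> (real i * h) * h \<le>
        (\<phi> (real (Suc i) * h) - \<phi> (real i * h)) * h" for i
    proof -
      have "real i * h \<le> real (Suc i) * h" "real (Suc i) * h - real i * h = h" "0 \<le> real i * h"
        using h(1) by (auto simp: algebra_simps)
      then show ?thesis
        using growth_profile_integral_diff[OF \<phi>, of "real i * h" "real (Suc i) * h"]
        by (simp add: F_def left_diff_distrib)
    qed
    have R: "R n = (\<Sum>i<Suc n. \<phi> (real i * h) * h)"
      unfolding R_def a h_def[symmetric] ..
    have F0: "F 0 = 0"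
      by (simp add: F_def)
    have "(\<Sum>i<Suc n. F (real (Suc i) * h) - F (real i * h)) = F (real (Suc n) * h) - F (real 0 * h)"
      by (rule sum_lessThan_telescope)
    then have "F s = (\<Sum>i<Suc n. F (real (Suc i) * h) - F (real i * h))"
      using h F0 by simp
    then have eq: "F s - R n = (\<Sum>i<Suc n. F (real (Suc i) * h) - F (real i * h) - \<phi> (real i * h) * h)"
      unfolding R by (simp only: sum_subtractf)
    have "0 \<le> F s - R n"
      unfolding eq using step by (intro sum_nonneg) blast
    moreover have "F s - R n \<le> \<phi> s * s * inverse (real (Suc n))"
    proof -
      have "F s - R n \<le> (\<Sum>i<Suc n. (\<phi> (real (Suc i) * h) - \<phi> (real i * h)) * h)"
        unfolding eq using step by (intro sum_mono) blast
      also have "\<dots> = (\<Sum>i<Suc n. \<phi> (real (Suc i) * h) - \<phi> (real i * h)) * h"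
        by (rule sum_distrib_right[symmetric])
      also have "(\<Sum>i<Suc n. \<phi> (real (Suc i) * h) - \<phi> (real i * h)) =
          \<phi> (real (Suc n) * h) - \<phi> (real 0 * h)"
        by (rule sum_lessThan_telescope)
      also have "\<phi> (real (Suc n) * h) - \<phi> (real 0 * h) = \<phi> s"
        using h \<phi> by (simp add: growth_profile_def)
      also have "\<phi> s * h = \<phi> s * s * inverse (real (Suc n))"
        by (simp add: h_def field_simps)
      finally show ?thesis .
    qed
    ultimately show ?thesis
      by blast
  qed
  have "(\<lambda>n. F s - R n) \<longlonglongrightarrow> 0"
  proof (rule tendsto_sandwich[where f="\<lambda>_. 0"])
    have "(\<lambda>n. \<phi> s * s * inverse (real (Suc n))) \<longlonglongrightarrow> \<phi> s * s * 0"
      by (intro tendsto_mult tendsto_const LIMSEQ_inverse_real_of_nat)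
    then show "(\<lambda>n. \<phi> s * s * inverse (real (Suc n))) \<longlonglongrightarrow> 0"
      by simp
  qed (use bound in auto)
  then have "(\<lambda>n. F s - (F s - R n)) \<longlonglongrightarrow> F s - 0"
    by (intro tendsto_diff tendsto_const)
  then show ?thesis
    by (simp add: R_def F_def)
qed

lemma growth_profile_integral_continuous:
  assumes \<phi>: "growth_profile \<phi>" and s: "s \<longlonglongrightarrow> a" "\<And>n. s n \<ge> 0"
  shows "(\<lambda>n. integral {0..s n} \<phi>) \<longlonglongrightarrow> integral {0..a} \<phi>"
proof -
  have a: "a \<ge> 0"
    by (rule LIMSEQ_le_const[OF s(1)]) (use s(2) in auto)
  obtain r where r: "\<And>n. \<bar>s n\<bar> \<le> r"
    using convergent_imp_Bseq[of s] s(1) by (auto simp: convergent_def Bseq_def)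
  have "continuous_on {0..r + a} (\<lambda>t. integral {0..t} \<phi>)"
    using growth_profile_integrable[OF \<phi>] by (intro indefinite_integral_continuous_1) auto
  then show ?thesis
    using s a r by (rule_tac continuous_on_tendsto_compose[where s="{0..r + a}"])
      (auto intro!: always_eventually simp: abs_le_iff add_increasing2 order.trans[OF _ r])
qed

section \<open>The flux as a subgradient of the potential\<close>

lemma flux_eq_sgn: "flux \<Psi> x \<xi> = Phi_of \<Psi> x (norm \<xi>) *\<^sub>R sgn \<xi>"
  by (auto simp: flux_def Phi_of_def sgn_div_norm)

lemma norm_flux_le: "norm (flux \<Psi> x \<xi>) \<le> \<bar>Phi_of \<Psi> x (norm \<xi>)\<bar>"
  by (auto simp: flux_eq_sgn norm_sgn)

lemma A_of_nonneg: "growth_profile (Phi_of \<Psi> x) \<Longrightarrow> 0 \<le> A_of \<Psi> x \<xi>"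
  by (simp add: A_of_def growth_profile_integral_nonneg)

lemma A_of_0 [simp]: "A_of \<Psi> x 0 = 0"
  by (simp add: A_of_def)

lemma A_of_le: "growth_profile (Phi_of \<Psi> x) \<Longrightarrow> A_of \<Psi> x \<xi> \<le> Phi_of \<Psi> x (norm \<xi>) * norm \<xi>"
  using growth_profile_integral_le[of "Phi_of \<Psi> x" 0 "norm \<xi>"] by (simp add: A_of_def)

text \<open>In the radial variable this is convexity of the primitive of
  \<open>Phi_of \<Psi> x\<close>. As the slope is nonnegative and
  \<open>sgn \<eta> \<bullet> \<xi> \<le> norm \<xi>\<close>, the radial increment may be replaced
  by the increment along \<open>sgn \<eta>\<close>.\<close>

lemma A_of_subgradient:
  assumes "growth_profile (Phi_of \<Psi> x)"
  shows "A_of \<Psi> x \<eta> - A_of \<Psi> x \<xi> \<le> flux \<Psi> x \<eta> \<bullet> (\<eta> - \<xi>)"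
proof -
  let ?\<phi> = "Phi_of \<Psi> x (norm \<eta>)"
  have "sgn \<eta> \<bullet> \<xi> \<le> norm \<xi>"
  proof -
    have "sgn \<eta> \<bullet> \<xi> \<le> norm (sgn \<eta>) * norm \<xi>"
      by (rule norm_cauchy_schwarz)
    also have "\<dots> \<le> norm \<xi>"
      by (simp add: norm_sgn)
    finally show ?thesis .
  qed
  then have *: "norm \<eta> - norm \<xi> \<le> sgn \<eta> \<bullet> (\<eta> - \<xi>)"
  proof -
    have "sgn \<eta> \<bullet> \<eta> = norm \<eta>"
      by (cases "\<eta> = 0") (simp_all add: sgn_div_norm dot_square_norm power2_eq_square)
    with \<open>sgn \<eta> \<bullet> \<xi> \<le> norm \<xi>\<close> show ?thesis
      by (simp add: inner_diff_right)
  qed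
  have "A_of \<Psi> x \<eta> - A_of \<Psi> x \<xi> \<le> ?\<phi> * (norm \<eta> - norm \<xi>)"
    unfolding A_of_def using assms by (intro growth_profile_integral_le) auto
  also have "\<dots> \<le> ?\<phi> * (sgn \<eta> \<bullet> (\<eta> - \<xi>))"
    using * assms by (intro mult_left_mono) (auto intro: growth_profile_nonneg)
  finally show ?thesis
    by (simp add: flux_eq_sgn)
qed

text \<open>Adding the subgradient inequalities at both points cancels the potential.\<close>

lemma flux_monotone:
  assumes "growth_profile (Phi_of \<Psi> x)"
  shows "0 \<le> (flux \<Psi> x \<eta> - flux \<Psi> x \<xi>) \<bullet> (\<eta> - \<xi>)"
  using A_of_subgradient[OF assms, of \<eta> \<xi>] A_of_subgradient[OF assms, of \<xi> \<eta>]
  by (simp add: inner_diff_left inner_diff_right)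

text \<open>The subgradient inequality at the midpoint is used against both end points; the two
  displacements are opposite, so the flux terms cancel.\<close>

lemma A_of_midpoint:
  assumes "growth_profile (Phi_of \<Psi> x)"
  shows "2 * A_of \<Psi> x ((1 / 2) *\<^sub>R (\<eta> + \<xi>)) \<le> A_of \<Psi> x \<eta> + A_of \<Psi> x \<xi>"
proof -
  define \<zeta> where "\<zeta> = (1 / 2) *\<^sub>R (\<eta> + \<xi>)"
  have "\<zeta> + \<zeta> = (1 / 2 + 1 / 2) *\<^sub>R (\<eta> + \<xi>)"
    unfolding \<zeta>_def by (rule scaleR_add_left[symmetric])
  then have "(\<zeta> - \<eta>) + (\<zeta> - \<xi>) = 0"
    by (simp add: algebra_simps)
  then have "flux \<Psi> x \<zeta> \<bullet> (\<zeta> - \<eta>) + flux \<Psi> x \<zeta> \<bullet> (\<zeta> - \<xi>) = 0"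
    by (metis inner_add_right inner_zero_right)
  then show ?thesis
    using A_of_subgradient[OF assms, of \<zeta> \<eta>] A_of_subgradient[OF assms, of \<zeta> \<xi>]
    unfolding \<zeta>_def[symmetric] by linarith
qed

lemma A_of_continuous:
  assumes "growth_profile (Phi_of \<Psi> x)" "\<xi> \<longlonglongrightarrow> \<eta>"
  shows "(\<lambda>n. A_of \<Psi> x (\<xi> n)) \<longlonglongrightarrow> A_of \<Psi> x \<eta>"
  unfolding A_of_def
  by (rule growth_profile_integral_continuous[OF assms(1) tendsto_norm[OF assms(2)]]) simp

lemma flux_continuous:
  assumes \<phi>: "growth_profile (Phi_of \<Psi> x)" and \<xi>: "\<xi> \<longlonglongrightarrow> \<eta>"
  shows "(\<lambda>n. flux \<Psi> x (\<xi> n)) \<longlonglongrightarrow> flux \<Psi> x \<eta>"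
proof -
  have "continuous_on {0..} (Phi_of \<Psi> x)"
    using \<phi> by (simp add: growth_profile_def)
  then have lim: "(\<lambda>n. Phi_of \<Psi> x (norm (\<xi> n))) \<longlonglongrightarrow> Phi_of \<Psi> x (norm \<eta>)"
    by (rule continuous_on_tendsto_compose[OF _ tendsto_norm[OF \<xi>]]) auto
  show ?thesis
  proof (cases "\<eta> = 0")
    \<comment> \<open>The direction need not converge here, but the modulus tends to
      \<open>Phi_of \<Psi> x 0 = 0\<close>.\<close>
    case True
    then have "(\<lambda>n. \<bar>Phi_of \<Psi> x (norm (\<xi> n))\<bar>) \<longlonglongrightarrow> 0"
      using tendsto_rabs[OF lim] by (simp add: Phi_of_def)
    then have "(\<lambda>n. flux \<Psi> x (\<xi> n)) \<longlonglongrightarrow> 0"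
      by (rule Lim_null_comparison[OF always_eventually[OF allI[OF norm_flux_le]]])
    with True show ?thesis
      by (simp add: flux_def)
  next
    case False
    then show ?thesis
      unfolding flux_eq_sgn by (intro tendsto_scaleR lim tendsto_sgn \<xi>)
  qed
qed

section \<open>Variable exponent spaces\<close>

text \<open>The constant depends only on an upper bound \<open>P\<close> of the exponent, so it
  serves all \<open>x\<close> at once when \<open>r = p x\<close>.\<close>

lemma powr_add_le:
  fixes a b r P :: real
  assumes "a \<ge> 0" "b \<ge> 0" "1 \<le> r" "r \<le> P"
  shows "(a + b) powr r \<le> 2 powr P * (a powr r + b powr r)"
proof -
  define c where "c = max a b"
  have c: "c \<ge> 0" "a + b \<le> 2 * c"
    using assms by (auto simp: c_def)
  have "(a + b) powr r \<le> (2 * c) powr r"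
    using assms c by (intro powr_mono2) auto
  also have "\<dots> = 2 powr r * c powr r"
    using c by (simp add: powr_mult)
  also have "\<dots> \<le> 2 powr P * (a powr r + b powr r)"
    using assms by (intro mult_mono powr_mono) (auto simp: c_def max_def)
  finally show ?thesis .
qed

lemma le_one_add_powr:
  fixes a r :: real
  assumes "a \<ge> 0" "r \<ge> 1"
  shows "a \<le> 1 + a powr r"
proof (cases "a \<le> 1")
  case True
  then show ?thesis
    using powr_ge_zero[of a r] by linarith
next
  case False
  then have "a powr 1 \<le> a powr r"
    using assms by (intro powr_mono) auto
  then show ?thesis
    using False by simp
qed

text \<open>\<open>pm\<close> and \<open>pP\<close> bound the exponent uniformly and will be its
  extreme values on the closure of the domain. The constant \<open>pm > 1\<close> is the moment
  order that forces strong convergence of minimising sequences.\<close>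

locale variable_exponent =
  fixes \<Omega> :: "'a::euclidean_space set" and p :: "'a \<Rightarrow> real" and pm pP :: real
  assumes open_dom: "open \<Omega>" and bounded_dom: "bounded \<Omega>"
    and p_meas [measurable]: "p \<in> borel_measurable (lebesgue_on \<Omega>)"
    and pm: "1 < pm"
    and p_ge: "\<And>x. x \<in> \<Omega> \<Longrightarrow> pm \<le> p x" and p_le: "\<And>x. x \<in> \<Omega> \<Longrightarrow> p x \<le> pP"
begin

abbreviation M :: "'a measure" where "M \<equiv> lebesgue_on \<Omega>"

lemma dom_sets: "\<Omega> \<in> sets lebesgue"
  using open_dom by (simp add: borel_open)

sublocale finite_measure M
  using bounded_dom by (intro finite_measure_lebesgue_on bounded_set_imp_lmeasurable dom_sets)

lemma p_gt_1: "x \<in> \<Omega> \<Longrightarrow> 1 < p x"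
  using pm p_ge[of x] by linarith

lemma var_Lp_measurable: "u \<in> var_Lp \<Omega> q \<Longrightarrow> u \<in> borel_measurable M"
  by (simp add: var_Lp_def)

lemma var_Lp_integrable_powr: "u \<in> var_Lp \<Omega> q \<Longrightarrow> integrable M (\<lambda>x. \<bar>u x\<bar> powr q x)"
  by (simp add: var_Lp_def)

lemma var_Lp_dominated:
  assumes [measurable]: "u \<in> borel_measurable M" and v: "v \<in> var_Lp \<Omega> p"
    and le: "AE x in M. \<bar>u x\<bar> \<le> \<bar>v x\<bar>"
  shows "u \<in> var_Lp \<Omega> p"
proof -
  have "integrable M (\<lambda>x. \<bar>u x\<bar> powr p x)"
  proof (rule Bochner_Integration.integrable_bound[OF var_Lp_integrable_powr[OF v]])
    show "AE x in M. norm (\<bar>u x\<bar> powr p x) \<le> norm (\<bar>v x\<bar> powr p x)"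
      using le AE_space
    proof eventually_elim
      case (elim x)
      then show ?case
        using p_gt_1[of x] by (auto intro!: powr_mono2)
    qed
  qed measurable
  then show ?thesis
    by (simp add: var_Lp_def)
qed

lemma var_Lp_add:
  assumes u: "u \<in> var_Lp \<Omega> p" and v: "v \<in> var_Lp \<Omega> p"
  shows "(\<lambda>x. u x + v x) \<in> var_Lp \<Omega> p"
proof -
  have [measurable]: "u \<in> borel_measurable M" "v \<in> borel_measurable M"
    using u v by (auto dest: var_Lp_measurable)
  have "integrable M (\<lambda>x. \<bar>u x + v x\<bar> powr p x)"
  proof (rule Bochner_Integration.integrable_bound)
    show "integrable M (\<lambda>x. 2 powr pP * (\<bar>u x\<bar> powr p x + \<bar>v x\<bar> powr p x))"
      using var_Lp_integrable_powr[OF u] var_Lp_integrable_powr[OF v] by auto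
    show "AE x in M. norm (\<bar>u x + v x\<bar> powr p x) \<le>
        norm (2 powr pP * (\<bar>u x\<bar> powr p x + \<bar>v x\<bar> powr p x))"
      using AE_space
    proof eventually_elim
      case (elim x)
      then have x: "x \<in> \<Omega>" by simp
      have "\<bar>u x + v x\<bar> powr p x \<le> (\<bar>u x\<bar> + \<bar>v x\<bar>) powr p x"
        using p_gt_1[OF x] by (intro powr_mono2) auto
      also have "\<dots> \<le> 2 powr pP * (\<bar>u x\<bar> powr p x + \<bar>v x\<bar> powr p x)"
        using p_gt_1[OF x] p_le[OF x] by (intro powr_add_le) auto
      finally show ?case by simp
    qed
  qed measurable
  then show ?thesis
    by (simp add: var_Lp_def)
qed

lemma var_Lp_cmult:
  assumes u: "u \<in> var_Lp \<Omega> p"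
  shows "(\<lambda>x. c * u x) \<in> var_Lp \<Omega> p"
proof -
  have [measurable]: "u \<in> borel_measurable M"
    using u by (auto dest: var_Lp_measurable)
  have "integrable M (\<lambda>x. \<bar>c * u x\<bar> powr p x)"
  proof (rule Bochner_Integration.integrable_bound)
    show "integrable M (\<lambda>x. (1 + \<bar>c\<bar>) powr pP * \<bar>u x\<bar> powr p x)"
      using var_Lp_integrable_powr[OF u] by auto
    show "AE x in M. norm (\<bar>c * u x\<bar> powr p x) \<le> norm ((1 + \<bar>c\<bar>) powr pP * \<bar>u x\<bar> powr p x)"
      using AE_space
    proof eventually_elim
      case (elim x)
      then have x: "x \<in> \<Omega>" by simp
      have "\<bar>c\<bar> powr p x \<le> (1 + \<bar>c\<bar>) powr p x"
        using p_gt_1[OF x] by (intro powr_mono2) auto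
      also have "\<dots> \<le> (1 + \<bar>c\<bar>) powr pP"
        using p_le[OF x] by (intro powr_mono) auto
      finally have "\<bar>c\<bar> powr p x * \<bar>u x\<bar> powr p x \<le> (1 + \<bar>c\<bar>) powr pP * \<bar>u x\<bar> powr p x"
        by (intro mult_right_mono) auto
      then show ?case
        by (simp add: abs_mult powr_mult)
    qed
  qed measurable
  then show ?thesis
    by (simp add: var_Lp_def)
qed

lemma var_Lp_const: "(\<lambda>x. c) \<in> var_Lp \<Omega> p"
proof -
  have "integrable M (\<lambda>x. \<bar>c\<bar> powr p x)"
  proof (rule integrable_const_bound)
    show "AE x in M. norm (\<bar>c\<bar> powr p x) \<le> (1 + \<bar>c\<bar>) powr pP"
      using AE_space
    proof eventually_elim
      case (elim x)
      then have x: "x \<in> \<Omega>" by simp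
      have "\<bar>c\<bar> powr p x \<le> (1 + \<bar>c\<bar>) powr p x"
        using p_gt_1[OF x] by (intro powr_mono2) auto
      also have "\<dots> \<le> (1 + \<bar>c\<bar>) powr pP"
        using p_le[OF x] by (intro powr_mono) auto
      finally show ?case by simp
    qed
  qed measurable
  then show ?thesis
    by (simp add: var_Lp_def)
qed

lemma var_Lp_bounded:
  assumes "u \<in> borel_measurable M" "AE x in M. \<bar>u x\<bar> \<le> c"
  shows "u \<in> var_Lp \<Omega> p"
  using assms(2) by (intro var_Lp_dominated[OF assms(1) var_Lp_const[of c]]) (auto elim: eventually_mono)

lemma var_Lp_integrable:
  assumes u: "u \<in> var_Lp \<Omega> p"
  shows "integrable M u"
proof (rule Bochner_Integration.integrable_bound)
  show "integrable M (\<lambda>x. 1 + \<bar>u x\<bar> powr p x)"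
    using var_Lp_integrable_powr[OF u] by auto
  show "AE x in M. norm (u x) \<le> norm (1 + \<bar>u x\<bar> powr p x)"
    using AE_space
  proof eventually_elim
    case (elim x)
    then show ?case
      using le_one_add_powr[of "\<bar>u x\<bar>" "p x"] p_gt_1[of x] by simp
  qed
qed (use u in \<open>auto dest: var_Lp_measurable\<close>)

text \<open>Young's inequality at each point, in place of a Holder inequality for Luxemburg norms:
  finiteness of the two modulars is all that enters.\<close>

lemma var_Lp_pairing:
  assumes a: "a \<in> var_Lp \<Omega> (conj_exponent p)" and b: "b \<in> var_Lp \<Omega> p"
  shows "integrable M (\<lambda>x. a x * b x)"
proof (rule Bochner_Integration.integrable_bound)
  show "integrable M (\<lambda>x. \<bar>a x\<bar> powr conj_exponent p x + \<bar>b x\<bar> powr p x)"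
    using var_Lp_integrable_powr[OF a] var_Lp_integrable_powr[OF b] by auto
  show "AE x in M. norm (a x * b x) \<le> norm (\<bar>a x\<bar> powr conj_exponent p x + \<bar>b x\<bar> powr p x)"
    using AE_space
  proof eventually_elim
    case (elim x)
    then have x: "1 < p x"
      using p_gt_1 by simp
    define r where "r = conj_exponent p x"
    have r: "1 < r" "1 / r + 1 / p x = 1"
      using x by (auto simp: r_def conj_exponent_def field_simps)
    have "\<bar>a x\<bar> * \<bar>b x\<bar> \<le> \<bar>a x\<bar> powr r / r + \<bar>b x\<bar> powr p x / p x"
      using x r by (intro Youngs_inequality) auto
    also have "\<dots> \<le> \<bar>a x\<bar> powr r + \<bar>b x\<bar> powr p x"
    proof (intro add_mono)
      have "y / s \<le> y" if "y \<ge> 0" "s > 1" for y s :: real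
        using that by (simp add: divide_le_eq mult_le_cancel_left1)
      then show "\<bar>a x\<bar> powr r / r \<le> \<bar>a x\<bar> powr r" "\<bar>b x\<bar> powr p x / p x \<le> \<bar>b x\<bar> powr p x"
        using x r by auto
    qed
    finally show ?case
      by (simp add: abs_mult r_def)
  qed
qed (use a b in \<open>auto dest!: var_Lp_measurable\<close>)

section \<open>The Sobolev class: linear combinations and truncation\<close>

lemma W1_D:
  assumes "W1 \<Omega> p u G"
  shows "u \<in> var_Lp \<Omega> p" "(\<lambda>x. norm (G x)) \<in> var_Lp \<Omega> p" "has_weak_gradient \<Omega> u G"
    "u \<in> borel_measurable M" "G \<in> borel_measurable M" "integrable M u" "integrable M G"
proof -
  show *: "u \<in> var_Lp \<Omega> p" "(\<lambda>x. norm (G x)) \<in> var_Lp \<Omega> p" "has_weak_gradient \<Omega> u G"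
    using assms by (auto simp: W1_def)
  then show "u \<in> borel_measurable M" and G: "G \<in> borel_measurable M"
    by (auto simp: has_weak_gradient_def)
  show "integrable M u"
    using *(1) by (rule var_Lp_integrable)
  show "integrable M G"
    by (rule integrable_norm_cancel[OF var_Lp_integrable[OF *(2)] G])
qed

lemma W1_add_cmult:
  assumes u: "W1 \<Omega> p u G" and v: "W1 \<Omega> p v H"
  shows "W1 \<Omega> p (\<lambda>x. u x + c * v x) (\<lambda>x. G x + c *\<^sub>R H x)"
  unfolding W1_def
proof (intro conjI)
  note [measurable] = W1_D(5)[OF u] W1_D(5)[OF v]
  show "(\<lambda>x. u x + c * v x) \<in> var_Lp \<Omega> p"
    by (intro var_Lp_add var_Lp_cmult W1_D(1)[OF u] W1_D(1)[OF v])
  show "has_weak_gradient \<Omega> (\<lambda>x. u x + c * v x) (\<lambda>x. G x + c *\<^sub>R H x)"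
    by (rule has_weak_gradient_add_cmult[OF dom_sets W1_D(3)[OF u] W1_D(3)[OF v] W1_D(6,7)[OF u]
        W1_D(6,7)[OF v]])
  show "(\<lambda>x. norm (G x + c *\<^sub>R H x)) \<in> var_Lp \<Omega> p"
  proof (rule var_Lp_dominated)
    show "(\<lambda>x. norm (G x) + \<bar>c\<bar> * norm (H x)) \<in> var_Lp \<Omega> p"
      by (intro var_Lp_add var_Lp_cmult W1_D(2)[OF u] W1_D(2)[OF v])
    show "AE x in M. \<bar>norm (G x + c *\<^sub>R H x)\<bar> \<le> \<bar>norm (G x) + \<bar>c\<bar> * norm (H x)\<bar>"
      by (intro AE_I2) (auto intro!: order.trans[OF norm_triangle_ineq])
  qed measurable
qed

lemma W1_0: "W1 \<Omega> p (\<lambda>x. 0) (\<lambda>x. 0)"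
  unfolding W1_def using var_Lp_const[of 0]
  by (auto simp: has_weak_gradient_iff_if_integrable[OF dom_sets])

lemma W1_truncate:
  assumes u: "W1 \<Omega> p u G" and ab: "a \<le> 0" "0 \<le> b"
  shows "W1 \<Omega> p (\<lambda>x. max a (min b (u x))) (\<lambda>x. if a \<le> u x \<and> u x \<le> b then G x else 0)"
  unfolding W1_def
proof (intro conjI)
  note [measurable] = W1_D(4,5)[OF u]
  show "(\<lambda>x. max a (min b (u x))) \<in> var_Lp \<Omega> p"
    by (rule var_Lp_dominated[OF _ W1_D(1)[OF u]]) (use ab in \<open>auto simp: max_def min_def\<close>)
  show "has_weak_gradient \<Omega> (\<lambda>x. max a (min b (u x))) (\<lambda>x. if a \<le> u x \<and> u x \<le> b then G x else 0)"
    by (rule has_weak_gradient_truncate[OF open_dom bounded_dom W1_D(3,6,7)[OF u] ab])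
  show "(\<lambda>x. norm (if a \<le> u x \<and> u x \<le> b then G x else 0)) \<in> var_Lp \<Omega> p"
    by (rule var_Lp_dominated[OF _ W1_D(2)[OF u]]) auto
qed

end

text \<open>\<open>\<kappa>\<close> is half of the zeroth order coefficient, so that
  \<open>\<kappa> * s^2\<close> has derivative \<open>2 * \<kappa> * s\<close>. The assumption
  \<open>profile\<close> records what the conditions on \<open>\<Psi>\<close> yield for
  \<open>Phi_of \<Psi> x\<close> at almost every \<open>x\<close>.\<close>

locale neumann_problem = variable_exponent \<Omega> p pm pP
  for \<Omega> :: "'a::euclidean_space set" and p and pm pP :: real +
  fixes \<Psi> :: "'a \<Rightarrow> real \<Rightarrow> real" and \<delta> \<delta>' \<kappa> :: real and g :: "'a \<Rightarrow> real"
  assumes profile: "AE x in lebesgue_on \<Omega>. growth_profile (Phi_of \<Psi> x)"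
    and growth: "\<And>v. v \<in> var_Lp \<Omega> p \<Longrightarrow> (\<lambda>x. Phi_of \<Psi> x (v x)) \<in> var_Lp \<Omega> (conj_exponent p)"
    and \<delta>_pos: "\<delta> > 0" and coercive: "\<And>v G. W1 \<Omega> p v G \<Longrightarrow>
       (\<integral>x. A_of \<Psi> x (G x) \<partial>lebesgue_on \<Omega>)
         \<ge> \<delta> * (\<integral>x. norm (G x) powr p x \<partial>lebesgue_on \<Omega>) - \<delta>'"
    and \<kappa>_pos: "\<kappa> > 0"
    and g_meas [measurable]: "g \<in> borel_measurable (lebesgue_on \<Omega>)"
    and g_bounds: "AE x in lebesgue_on \<Omega>. 0 \<le> g x \<and> g x \<le> 2 * \<kappa>"
begin

text \<open>Both the integrand and the upper limit depend on \<open>x\<close>. Riemann sums reduce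
  the claim to fixed multiples of \<open>v\<close>, whose composition with \<open>Phi_of\<close> is
  measurable by the growth assumption.\<close>

lemma A_measurable:
  assumes v: "v \<in> var_Lp \<Omega> p" and pos: "\<And>x. 0 \<le> v x"
  shows "(\<lambda>x. integral {0..v x} (Phi_of \<Psi> x)) \<in> borel_measurable M"
proof -
  have [measurable]: "v \<in> borel_measurable M"
    using v by (rule var_Lp_measurable)
  define R where "R n x = (\<Sum>i<Suc n. Phi_of \<Psi> x (real i / real (Suc n) * v x) * (1 / real (Suc n) * v x))"
    for n x
  have [measurable]: "R n \<in> borel_measurable M" for n
  proof -
    have m: "(\<lambda>x. Phi_of \<Psi> x (c * v x)) \<in> borel_measurable M" for c
      by (rule var_Lp_measurable[OF growth[OF var_Lp_cmult[OF v]]])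
    show ?thesis
      unfolding R_def[abs_def] by (intro borel_measurable_sum borel_measurable_times m) auto
  qed
  have "(\<lambda>x. lim (\<lambda>n. R n x)) \<in> borel_measurable M"
    by measurable
  moreover have "AE x in M. lim (\<lambda>n. R n x) = integral {0..v x} (Phi_of \<Psi> x)"
    using profile
  proof eventually_elim
    case (elim x)
    then show ?case
      unfolding R_def by (intro limI growth_profile_riemann_sum pos)
  qed
  ultimately show ?thesis
    by (rule measurable_lebesgue_on_AE[OF dom_sets])
qed

text \<open>The potential is at most \<open>Phi_of \<Psi> x s * s\<close> at
  \<open>s = norm (G x)\<close>, a product of functions from conjugate classes.\<close>

lemma A_integrable:
  assumes [measurable]: "G \<in> borel_measurable M" and G: "(\<lambda>x. norm (G x)) \<in> var_Lp \<Omega> p"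
  shows "integrable M (\<lambda>x. A_of \<Psi> x (G x))"
proof (rule Bochner_Integration.integrable_bound)
  show "integrable M (\<lambda>x. Phi_of \<Psi> x (norm (G x)) * norm (G x))"
    by (rule var_Lp_pairing[OF growth[OF G] G])
  show "(\<lambda>x. A_of \<Psi> x (G x)) \<in> borel_measurable M"
    unfolding A_of_def by (rule A_measurable[OF G]) simp
  show "AE x in M. norm (A_of \<Psi> x (G x)) \<le> norm (Phi_of \<Psi> x (norm (G x)) * norm (G x))"
    using profile
  proof eventually_elim
    case (elim x)
    then show ?case
      using A_of_nonneg[OF elim, of "G x"] A_of_le[OF elim, of "G x"] by simp
  qed
qed

lemma flux_measurable:
  assumes [measurable]: "G \<in> borel_measurable M" and G: "(\<lambda>x. norm (G x)) \<in> var_Lp \<Omega> p"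
  shows "(\<lambda>x. flux \<Psi> x (G x)) \<in> borel_measurable M"
proof -
  have [measurable]: "(\<lambda>x. Phi_of \<Psi> x (norm (G x))) \<in> borel_measurable M"
    by (rule var_Lp_measurable[OF growth[OF G]])
  show ?thesis
    unfolding flux_eq_sgn sgn_div_norm by measurable
qed

lemma flux_inner_integrable:
  assumes G: "G \<in> borel_measurable M" "(\<lambda>x. norm (G x)) \<in> var_Lp \<Omega> p"
    and H: "H \<in> borel_measurable M" "(\<lambda>x. norm (H x)) \<in> var_Lp \<Omega> p"
  shows "integrable M (\<lambda>x. flux \<Psi> x (G x) \<bullet> H x)"
proof (rule Bochner_Integration.integrable_bound)
  show "integrable M (\<lambda>x. Phi_of \<Psi> x (norm (G x)) * norm (H x))"
    by (rule var_Lp_pairing[OF growth[OF G(2)] H(2)])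
  show "(\<lambda>x. flux \<Psi> x (G x) \<bullet> H x) \<in> borel_measurable M"
    using flux_measurable[OF G] H(1) by measurable
  show "AE x in M. norm (flux \<Psi> x (G x) \<bullet> H x) \<le> norm (Phi_of \<Psi> x (norm (G x)) * norm (H x))"
  proof (rule AE_I2)
    fix x
    have "\<bar>flux \<Psi> x (G x) \<bullet> H x\<bar> \<le> norm (flux \<Psi> x (G x)) * norm (H x)"
      by (rule Cauchy_Schwarz_ineq2)
    also have "\<dots> \<le> \<bar>Phi_of \<Psi> x (norm (G x))\<bar> * norm (H x)"
      by (intro mult_right_mono norm_flux_le) auto
    finally show "norm (flux \<Psi> x (G x) \<bullet> H x) \<le> norm (Phi_of \<Psi> x (norm (G x)) * norm (H x))"
      by (simp add: abs_mult)
  qed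
qed

text \<open>Its derivative in \<open>s\<close> is the residual
  \<open>2 * \<kappa> * s - g x\<close>. It is a parabola with vertex
  \<open>g x / (2 * \<kappa>)\<close>, which lies in \<open>[0, 1]\<close> for almost every
  \<open>x\<close>.\<close>

definition dens :: "'a \<Rightarrow> real \<Rightarrow> real" where
  "dens x s = \<kappa> * s\<^sup>2 - g x * s"

definition energy :: "('a \<Rightarrow> real) \<Rightarrow> ('a \<Rightarrow> 'a) \<Rightarrow> real" where
  "energy u G = (\<integral>x. A_of \<Psi> x (G x) \<partial>M) + (\<integral>x. dens x (u x) \<partial>M)"

lemma dens_measurable [measurable]:
  "u \<in> borel_measurable M \<Longrightarrow> (\<lambda>x. dens x (u x)) \<in> borel_measurable M"
  unfolding dens_def
  by (intro borel_measurable_diff borel_measurable_times borel_measurable_const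
      borel_measurable_power g_meas)

lemma dens_bound: "0 \<le> g x \<Longrightarrow> g x \<le> 2 * \<kappa> \<Longrightarrow> \<bar>s\<bar> \<le> k \<Longrightarrow> \<bar>dens x s\<bar> \<le> \<kappa> * k\<^sup>2 + 2 * \<kappa> * k"
proof -
  assume g: "0 \<le> g x" "g x \<le> 2 * \<kappa>" and s: "\<bar>s\<bar> \<le> k"
  have "\<bar>\<kappa> * s\<^sup>2\<bar> \<le> \<kappa> * k\<^sup>2"
    using s \<kappa>_pos by (auto simp: abs_mult intro!: mult_left_mono power2_le_iff_abs_le[THEN iffD2])
  moreover have "\<bar>g x * s\<bar> \<le> 2 * \<kappa> * k"
    unfolding abs_mult using g s by (intro mult_mono) auto
  ultimately show ?thesis
    unfolding dens_def by linarith
qed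

lemma dens_integrable:
  assumes [measurable]: "u \<in> borel_measurable M" and "AE x in M. \<bar>u x\<bar> \<le> k"
  shows "integrable M (\<lambda>x. dens x (u x))"
proof (rule integrable_const_bound)
  show "AE x in M. norm (dens x (u x)) \<le> \<kappa> * k\<^sup>2 + 2 * \<kappa> * k"
    using assms(2) g_bounds by eventually_elim (auto intro: dens_bound)
qed measurable

lemma dens_midpoint: "2 * dens x ((1 / 2) * (s + t)) \<le> dens x s + dens x t"
proof -
  have "0 \<le> \<kappa> * (s - t)\<^sup>2"
    using \<kappa>_pos by simp
  then show ?thesis
    by (simp add: dens_def power2_eq_square field_simps)
qed

text \<open>An upward parabola does not increase under projection to an interval that contains its
  vertex.\<close>

lemma dens_truncate:
  assumes "0 \<le> g x" "g x \<le> 2 * \<kappa>"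
  shows "dens x (max 0 (min 1 s)) \<le> dens x s"
proof -
  consider "0 \<le> s \<and> s \<le> 1" | "s < 0" | "s > 1" by linarith
  then show ?thesis
  proof cases
    case 1
    then have "max 0 (min 1 s) = s"
      by (auto simp: max_def min_def)
    then show ?thesis
      by simp
  next
    case 2
    then have "0 \<le> \<kappa> * s\<^sup>2" "g x * s \<le> 0"
      using assms \<kappa>_pos by (auto simp: mult_le_0_iff)
    with 2 show ?thesis
      by (simp add: dens_def)
  next
    case 3
    have "g x * (s - 1) \<le> 2 * \<kappa> * (s - 1)"
      using assms 3 by (intro mult_right_mono) auto
    \<comment> \<open>The difference of the two sides is
      \<open>\<kappa> * (s - 1)^2\<close>.\<close>
    moreover have "2 * \<kappa> * (s - 1) \<le> \<kappa> * (s\<^sup>2 - 1)"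
    proof -
      have "0 \<le> \<kappa> * (s - 1)\<^sup>2"
        using \<kappa>_pos by simp
      then show ?thesis
        by (simp add: power2_eq_square algebra_simps)
    qed
    ultimately show ?thesis
      using 3 by (simp add: dens_def algebra_simps)
  qed
qed

section \<open>The minimiser\<close>

lemma dens_integral_bound:
  assumes "AE x in M. 0 \<le> u x \<and> u x \<le> 1"
  shows "\<bar>\<integral>x. dens x (u x) \<partial>M\<bar> \<le> 3 * \<kappa> * measure M (space M)"
proof -
  have "\<bar>\<integral>x. dens x (u x) \<partial>M\<bar> \<le> (\<integral>x. \<bar>dens x (u x)\<bar> \<partial>M)"
    by (rule integral_abs_bound)
  also have "\<dots> \<le> (\<integral>x. 3 * \<kappa> \<partial>M)"
  proof (rule integral_mono_AE')
    \<comment> \<open>The constant is that of \<open>dens_bound\<close> at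
      \<open>k = 1\<close>.\<close>
    show "AE x in M. \<bar>dens x (u x)\<bar> \<le> 3 * \<kappa>"
      using assms g_bounds
    proof eventually_elim
      case (elim x)
      then show ?case
        using dens_bound[of x "u x" 1] by simp
    qed
  qed (use \<kappa>_pos in auto)
  finally show ?thesis
    by (simp add: mult.commute)
qed

lemma A_integral_nonneg: "0 \<le> (\<integral>x. A_of \<Psi> x (G x) \<partial>M)"
  using profile by (intro integral_nonneg_AE) (auto elim!: eventually_mono intro: A_of_nonneg)

text \<open>Values in \<open>[0, 1]\<close> keep the lower order term above a fixed constant, so the
  energy controls the potential and, by coercivity, the modular.\<close>

lemma gradient_bound:
  assumes "W1 \<Omega> p u G" "AE x in M. 0 \<le> u x \<and> u x \<le> 1"
  shows "(\<integral>x. norm (G x) powr p x \<partial>M) \<le> (energy u G + 3 * \<kappa> * measure M (space M) + \<delta>') / \<delta>"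
proof -
  have "\<delta> * (\<integral>x. norm (G x) powr p x \<partial>M) \<le> energy u G + 3 * \<kappa> * measure M (space M) + \<delta>'"
    using coercive[OF assms(1)] dens_integral_bound[OF assms(2)] unfolding energy_def abs_le_iff
    by linarith
  then show ?thesis
    using \<delta>_pos by (simp add: le_divide_eq mult.commute)
qed

text \<open>Passage from the variable exponent to the constant \<open>pm\<close>: where
  \<open>norm \<xi> \<le> 1\<close> the power is at most 1, and elsewhere the larger exponent
  \<open>p x\<close> only increases it.\<close>

lemma jbracket_powr_le:
  fixes v :: real and \<xi> :: "'b::real_inner"
  assumes x: "x \<in> \<Omega>" and v: "0 \<le> v" "v \<le> 1"
  shows "jbracket (v, \<xi>) powr pm \<le> 2 powr pm * (2 powr pm + 1 + norm \<xi> powr p x)"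
proof -
  have "jbracket (v, \<xi>) \<le> 1 + norm (v, \<xi>)"
    by (rule jbracket_le)
  also have "norm (v, \<xi>) \<le> norm v + norm \<xi>"
    by (rule norm_Pair_le)
  also have "norm v \<le> 1"
    using v by simp
  finally have "jbracket (v, \<xi>) \<le> 2 + norm \<xi>"
    by simp
  then have "jbracket (v, \<xi>) powr pm \<le> (2 + norm \<xi>) powr pm"
    using pm jbracket_ge_1[of "(v, \<xi>)"] by (intro powr_mono2) auto
  also have "\<dots> \<le> 2 powr pm * (2 powr pm + norm \<xi> powr pm)"
    using pm by (intro powr_add_le) auto
  also have "norm \<xi> powr pm \<le> 1 + norm \<xi> powr p x"
  proof (cases "norm \<xi> \<le> 1")
    case True
    then have "norm \<xi> powr pm \<le> 1"
      using pm by (intro powr_le1) auto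
    then show ?thesis
      using powr_ge_zero[of "norm \<xi>" "p x"] by linarith
  next
    case False
    then have "norm \<xi> powr pm \<le> norm \<xi> powr p x"
      using p_ge[OF x] by (intro powr_mono) auto
    then show ?thesis by linarith
  qed
  finally show ?thesis
    by (simp add: add.assoc)
qed

lemma energy_midpoint:
  assumes u: "W1 \<Omega> p u G" "AE x in M. 0 \<le> u x \<and> u x \<le> 1"
    and v: "W1 \<Omega> p v H" "AE x in M. 0 \<le> v x \<and> v x \<le> 1"
  shows "W1 \<Omega> p (\<lambda>x. (1 / 2) * (u x + v x)) (\<lambda>x. (1 / 2) *\<^sub>R (G x + H x))"
    "AE x in M. 0 \<le> (1 / 2) * (u x + v x) \<and> (1 / 2) * (u x + v x) \<le> 1"
    "energy (\<lambda>x. (1 / 2) * (u x + v x)) (\<lambda>x. (1 / 2) *\<^sub>R (G x + H x)) \<le> (energy u G + energy v H) / 2"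
proof -
  note [measurable] = W1_D(4,5)[OF u(1)] W1_D(4,5)[OF v(1)]
  from W1_add_cmult[OF W1_0 W1_add_cmult[OF u(1) v(1), of 1], of "1 / 2"]
  show W: "W1 \<Omega> p (\<lambda>x. (1 / 2) * (u x + v x)) (\<lambda>x. (1 / 2) *\<^sub>R (G x + H x))"
    by simp
  show m: "AE x in M. 0 \<le> (1 / 2) * (u x + v x) \<and> (1 / 2) * (u x + v x) \<le> 1"
    using u(2) v(2) by eventually_elim auto
  have iA: "integrable M (\<lambda>x. A_of \<Psi> x (G x))" if "W1 \<Omega> p u G" for u G
    using A_integrable[OF W1_D(5,2)[OF that]] .
  have id: "integrable M (\<lambda>x. dens x (u x))" if "W1 \<Omega> p u G" "AE x in M. 0 \<le> u x \<and> u x \<le> 1" for u G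
    by (rule dens_integrable[OF W1_D(4)[OF that(1)], of 1]) (use that(2) in \<open>auto elim: eventually_mono\<close>)
  have "2 * (\<integral>x. A_of \<Psi> x ((1 / 2) *\<^sub>R (G x + H x)) \<partial>M) =
      (\<integral>x. 2 * A_of \<Psi> x ((1 / 2) *\<^sub>R (G x + H x)) \<partial>M)"
    by simp
  also have "\<dots> \<le> (\<integral>x. A_of \<Psi> x (G x) + A_of \<Psi> x (H x) \<partial>M)"
    using profile
    by (intro integral_mono_AE integrable_mult_right Bochner_Integration.integrable_add iA[OF W] iA[OF u(1)] iA[OF v(1)])
       (auto elim!: eventually_mono intro: A_of_midpoint)
  also have "\<dots> = (\<integral>x. A_of \<Psi> x (G x) \<partial>M) + (\<integral>x. A_of \<Psi> x (H x) \<partial>M)"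
    by (rule Bochner_Integration.integral_add[OF iA[OF u(1)] iA[OF v(1)]])
  finally have 1: "2 * (\<integral>x. A_of \<Psi> x ((1 / 2) *\<^sub>R (G x + H x)) \<partial>M) \<le> \<dots>" .
  have "2 * (\<integral>x. dens x ((1 / 2) * (u x + v x)) \<partial>M) = (\<integral>x. 2 * dens x ((1 / 2) * (u x + v x)) \<partial>M)"
    by simp
  also have "\<dots> \<le> (\<integral>x. dens x (u x) + dens x (v x) \<partial>M)"
    by (intro integral_mono integrable_mult_right Bochner_Integration.integrable_add id[OF W m] id[OF u] id[OF v] dens_midpoint)
  also have "\<dots> = (\<integral>x. dens x (u x) \<partial>M) + (\<integral>x. dens x (v x) \<partial>M)"
    by (rule Bochner_Integration.integral_add[OF id[OF u] id[OF v]])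
  finally have 2: "2 * (\<integral>x. dens x ((1 / 2) * (u x + v x)) \<partial>M) \<le> \<dots>" .
  have "2 * energy (\<lambda>x. (1 / 2) * (u x + v x)) (\<lambda>x. (1 / 2) *\<^sub>R (G x + H x)) \<le> energy u G + energy v H"
    using 1 2 unfolding energy_def distrib_left by linarith
  then show "energy (\<lambda>x. (1 / 2) * (u x + v x)) (\<lambda>x. (1 / 2) *\<^sub>R (G x + H x)) \<le> (energy u G + energy v H) / 2"
    by simp
qed

text \<open>The abstract minimisation is applied to pairs of a function and its gradient, so that
  one bracket makes both converge. Closedness of the class of pairs is not among its hypotheses;
  every membership condition is verified for the limit.\<close>

lemma energy_minimizer:
  obtains V G where "W1 \<Omega> p V G" "AE x in M. 0 \<le> V x \<and> V x \<le> 1"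
    "\<forall>u H. W1 \<Omega> p u H \<longrightarrow> (AE x in M. 0 \<le> u x \<and> u x \<le> 1) \<longrightarrow> energy V G \<le> energy u H"
proof -
  define K :: "('a \<Rightarrow> real \<times> 'a) set" where
    "K = {w. W1 \<Omega> p (\<lambda>x. fst (w x)) (\<lambda>x. snd (w x)) \<and> (AE x in M. 0 \<le> fst (w x) \<and> fst (w x) \<le> 1)}"
  define J where "J w = energy (\<lambda>x. fst (w x)) (\<lambda>x. snd (w x))" for w
  define \<mu> where "\<mu> = measure M (space M)"
  define m where "m = Inf (J ` K)"
  \<comment> \<open>Bound for the \<open>pm\<close>-moment of the bracket on the part of
    \<open>K\<close> with energy at most \<open>r\<close>; it is used with
    \<open>r = m + 1\<close>.\<close>
  define c where "c r = 2 powr pm * ((2 powr pm + 1) * \<mu> + (r + 3 * \<kappa> * \<mu> + \<delta>') / \<delta>)" for r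
  have K: "W1 \<Omega> p (\<lambda>x. fst (w x)) (\<lambda>x. snd (w x))" "AE x in M. 0 \<le> fst (w x) \<and> fst (w x) \<le> 1"
    if "w \<in> K" for w
    using that by (auto simp: K_def)
  have KI: "(\<lambda>x. (u x, H x)) \<in> K" if "W1 \<Omega> p u H" "AE x in M. 0 \<le> u x \<and> u x \<le> 1" for u H
    using that by (simp add: K_def)
  have meas: "w \<in> borel_measurable M" if "w \<in> K" for w
    using borel_measurable_Pair[OF W1_D(4)[OF K(1)[OF that]] W1_D(5)[OF K(1)[OF that]]] by simp
  have ne: "K \<noteq> {}"
    using KI[OF W1_0] by auto
  have lower: "- (3 * \<kappa> * \<mu>) \<le> J w" if "w \<in> K" for w
    using A_integral_nonneg[of "\<lambda>x. snd (w x)"] dens_integral_bound[OF K(2)[OF that]]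
    unfolding J_def energy_def \<mu>_def abs_le_iff by linarith
  have bdd: "bdd_below (J ` K)"
    using lower by (intro bdd_belowI[of _ "- (3 * \<kappa> * \<mu>)"]) auto
  have m_le: "m \<le> J w" if "w \<in> K" for w
    unfolding m_def using bdd that by (auto intro: cInf_lower)
  have jb: "AE x in M. jbracket (w x) powr pm \<le> 2 powr pm * (2 powr pm + 1 + norm (snd (w x)) powr p x)"
    if "w \<in> K" for w
    using K(2)[OF that] AE_space
  proof eventually_elim
    case (elim x)
    then show ?case
      using jbracket_powr_le[of x "fst (w x)" "snd (w x)"] by simp
  qed
  have pint: "integrable M (\<lambda>x. norm (snd (w x)) powr p x)" if "w \<in> K" for w
    using var_Lp_integrable_powr[OF W1_D(2)[OF K(1)[OF that]]] by simp
  have rhs: "integrable M (\<lambda>x. 2 powr pm * (2 powr pm + 1 + norm (snd (w x)) powr p x))" if "w \<in> K" for w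
    using pint[OF that] by auto
  have ji: "integrable M (\<lambda>x. jbracket (w x) powr pm)" if "w \<in> K" for w
    by (rule Bochner_Integration.integrable_bound[OF rhs[OF that]])
       (use meas[OF that] jb[OF that] in \<open>auto elim: eventually_mono\<close>)
  have jle: "(\<integral>x. jbracket (w x) powr pm \<partial>M) \<le> c r" if w: "w \<in> K" and r: "J w \<le> r" for w r
  proof -
    have "(\<integral>x. jbracket (w x) powr pm \<partial>M) \<le>
        (\<integral>x. 2 powr pm * (2 powr pm + 1 + norm (snd (w x)) powr p x) \<partial>M)"
      by (rule integral_mono_AE[OF ji[OF w] rhs[OF w] jb[OF w]])
    also have "\<dots> = 2 powr pm * ((2 powr pm + 1) * \<mu> + (\<integral>x. norm (snd (w x)) powr p x \<partial>M))"
      using pint[OF w] by (simp add: \<mu>_def algebra_simps)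
    also have "\<dots> \<le> c r"
      unfolding c_def
    proof (intro mult_left_mono add_left_mono)
      have "(\<integral>x. norm (snd (w x)) powr p x \<partial>M) \<le> (J w + 3 * \<kappa> * \<mu> + \<delta>') / \<delta>"
        using gradient_bound[OF K[OF w]] by (simp add: J_def \<mu>_def)
      also have "\<dots> \<le> (r + 3 * \<kappa> * \<mu> + \<delta>') / \<delta>"
        using r \<delta>_pos by (intro divide_right_mono) auto
      finally show "(\<integral>x. norm (snd (w x)) powr p x \<partial>M) \<le> (r + 3 * \<kappa> * \<mu> + \<delta>') / \<delta>" .
    qed auto
    finally show ?thesis .
  qed
  have mid: "(\<lambda>x. (1 / 2) *\<^sub>R (w x + v x)) \<in> K" "J (\<lambda>x. (1 / 2) *\<^sub>R (w x + v x)) \<le> (J w + J v) / 2"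
    if "w \<in> K" "v \<in> K" for w v
    using energy_midpoint[OF K[OF that(1)] K[OF that(2)]] by (simp_all add: K_def J_def)
  obtain w v where w: "\<And>n :: nat. w n \<in> K" "(\<lambda>n. J (w n)) \<longlonglongrightarrow> m"
    and wi: "\<And>n. integrable M (w n)" and vi: "integrable M v"
    and ae: "AE x in M. (\<lambda>n. w n x) \<longlonglongrightarrow> v x"
    and L1: "(\<lambda>n. \<integral>x. norm (w n x - v x) \<partial>M) \<longlonglongrightarrow> 0"
    by (rule minimizing_sequence_converges[of M K J pm "c (m + 1)"])
       (use finite_measure_axioms ne meas mid bdd pm ji jle in \<open>auto simp flip: m_def\<close>)
  define V G where "V x = fst (v x)" and "G x = snd (v x)" for x
  have Vi: "integrable M V"
    unfolding V_def[abs_def] by (rule integrable_bounded_linear[OF bounded_linear_fst vi])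
  have Gi: "integrable M G"
    unfolding G_def[abs_def] by (rule integrable_bounded_linear[OF bounded_linear_snd vi])
  have [measurable]: "V \<in> borel_measurable M" "G \<in> borel_measurable M"
    using Vi Gi by auto
  have aeV: "AE x in M. (\<lambda>n. fst (w n x)) \<longlonglongrightarrow> V x"
    using ae unfolding V_def by eventually_elim (rule tendsto_fst)
  have aeG: "AE x in M. (\<lambda>n. snd (w n x)) \<longlonglongrightarrow> G x"
    using ae unfolding G_def by eventually_elim (rule tendsto_snd)
  have w01: "AE x in M. \<forall>n. 0 \<le> fst (w n x) \<and> fst (w n x) \<le> 1"
    using K(2)[OF w(1)] by (simp add: AE_all_countable)
  have V01: "AE x in M. 0 \<le> V x \<and> V x \<le> 1"
    using aeV w01
  proof eventually_elim
    case (elim x)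
    then show ?case
      using LIMSEQ_le_const[of "\<lambda>n. fst (w n x)" "V x" 0] LIMSEQ_le_const2[of "\<lambda>n. fst (w n x)" "V x" 1]
      by auto
  qed
  \<comment> \<open>The norm of a pair dominates that of each component, so both converge in
    L1.\<close>
  have grad: "has_weak_gradient \<Omega> V G"
  proof (rule has_weak_gradient_closed[OF dom_sets, where u="\<lambda>n x. fst (w n x)" and G="\<lambda>n x. snd (w n x)"])
    show "has_weak_gradient \<Omega> (\<lambda>x. fst (w n x)) (\<lambda>x. snd (w n x))"
      "integrable M (\<lambda>x. fst (w n x))" "integrable M (\<lambda>x. snd (w n x))" for n
      using W1_D(3,6,7)[OF K(1)[OF w(1)]] by auto
    show "(\<lambda>n. \<integral>x. \<bar>fst (w n x) - V x\<bar> \<partial>M) \<longlonglongrightarrow> 0"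
    proof (rule Lim_null_comparison[OF _ L1])
      have "(\<integral>x. \<bar>fst (w n x) - V x\<bar> \<partial>M) \<le> (\<integral>x. norm (w n x - v x) \<partial>M)" for n
      proof (rule integral_mono)
        show "integrable M (\<lambda>x. \<bar>fst (w n x) - V x\<bar>)"
          using W1_D(6)[OF K(1)[OF w(1)]] Vi by auto
        show "integrable M (\<lambda>x. norm (w n x - v x))"
          using wi vi by auto
        show "\<bar>fst (w n x) - V x\<bar> \<le> norm (w n x - v x)" for x
          using norm_fst_le[of "fst (w n x - v x)" "snd (w n x - v x)"]
          unfolding prod.collapse by (simp add: V_def)
      qed
      then show "\<forall>\<^sub>F n in sequentially. norm (\<integral>x. \<bar>fst (w n x) - V x\<bar> \<partial>M) \<le> (\<integral>x. norm (w n x - v x) \<partial>M)"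
        by (simp add: integral_nonneg_AE)
    qed
    show "(\<lambda>n. \<integral>x. norm (snd (w n x) - G x) \<partial>M) \<longlonglongrightarrow> 0"
    proof (rule Lim_null_comparison[OF _ L1])
      have "(\<integral>x. norm (snd (w n x) - G x) \<partial>M) \<le> (\<integral>x. norm (w n x - v x) \<partial>M)" for n
      proof (rule integral_mono)
        show "integrable M (\<lambda>x. norm (snd (w n x) - G x))"
          using W1_D(7)[OF K(1)[OF w(1)]] Gi by auto
        show "integrable M (\<lambda>x. norm (w n x - v x))"
          using wi vi by auto
        show "norm (snd (w n x) - G x) \<le> norm (w n x - v x)" for x
          using norm_snd_le[of "snd (w n x - v x)" "fst (w n x - v x)"]
          unfolding prod.collapse by (simp add: G_def)
      qed
      then show "\<forall>\<^sub>F n in sequentially. norm (\<integral>x. norm (snd (w n x) - G x) \<partial>M) \<le> (\<integral>x. norm (w n x - v x) \<partial>M)"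
        by (simp add: integral_nonneg_AE)
    qed
  qed (fact Vi Gi)+
  obtain r where r: "\<And>n. J (w n) \<le> r"
    using convergent_imp_Bseq[of "\<lambda>n. J (w n)"] w(2)
    by (auto simp: convergent_def Bseq_def abs_le_iff)
  \<comment> \<open>Fatou's lemma for the modulars, which coercivity keeps bounded along the
    sequence.\<close>
  have "integrable M (\<lambda>x. norm (G x) powr p x)"
  proof (rule integral_Fatou(1)[where f="\<lambda>n x. norm (snd (w n x)) powr p x"])
    show "AE x in M. (\<lambda>n. norm (snd (w n x)) powr p x) \<longlonglongrightarrow> norm (G x) powr p x"
      using aeG AE_space
    proof eventually_elim
      case (elim x)
      then have "p x > 0"
        using p_gt_1[of x] by simp
      with elim show ?case
        by (intro tendsto_powr' tendsto_norm tendsto_const) auto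
    qed
    show "(\<integral>x. norm (snd (w n x)) powr p x \<partial>M) \<le> (r + 3 * \<kappa> * \<mu> + \<delta>') / \<delta>" for n
    proof -
      have "(\<integral>x. norm (snd (w n x)) powr p x \<partial>M) \<le> (J (w n) + 3 * \<kappa> * \<mu> + \<delta>') / \<delta>"
        using gradient_bound[OF K[OF w(1)]] by (simp add: J_def \<mu>_def)
      also have "\<dots> \<le> (r + 3 * \<kappa> * \<mu> + \<delta>') / \<delta>"
        using r \<delta>_pos by (intro divide_right_mono) auto
      finally show ?thesis .
    qed
  qed (use pint[OF w(1)] in auto)
  then have GLp: "(\<lambda>x. norm (G x)) \<in> var_Lp \<Omega> p"
    by (simp add: var_Lp_def)
  have W: "W1 \<Omega> p V G"
    unfolding W1_def using grad GLp V01 by (auto intro!: var_Lp_bounded[of _ 1] elim: eventually_mono)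
  \<comment> \<open>The lower order term converges, with the constant majorant
    \<open>3 * \<kappa>\<close>; for the potential only lower semicontinuity is obtained
    below.\<close>
  have dlim: "(\<lambda>n. \<integral>x. dens x (fst (w n x)) \<partial>M) \<longlonglongrightarrow> (\<integral>x. dens x (V x) \<partial>M)"
  proof (rule integral_dominated_convergence)
    show "integrable M (\<lambda>x. 3 * \<kappa>)"
      by (rule integrable_const)
    show "AE x in M. norm (dens x (fst (w n x))) \<le> 3 * \<kappa>" for n
      using w01 g_bounds
    proof eventually_elim
      case (elim x)
      then have "\<bar>fst (w n x)\<bar> \<le> 1" by simp
      then show ?case
        using dens_bound[of x "fst (w n x)" 1] elim by simp
    qed
    show "AE x in M. (\<lambda>n. dens x (fst (w n x))) \<longlonglongrightarrow> dens x (V x)"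
      using aeV unfolding dens_def
      by eventually_elim (intro tendsto_diff tendsto_mult tendsto_power tendsto_const)
    show "(\<lambda>x. dens x (fst (w n x))) \<in> borel_measurable M" for n
      by (intro dens_measurable W1_D(4)[OF K(1)[OF w(1)]])
  qed (intro dens_measurable, measurable)
  \<comment> \<open>The bound in \<open>integral_Fatou\<close> has to hold for every index, hence
    the slack \<open>e\<close> and the shift of the sequence by \<open>N\<close>.\<close>
  have "energy V G \<le> m"
  proof (rule field_le_epsilon)
    fix e :: real assume e: "e > 0"
    have "(\<lambda>n. J (w n) - (\<integral>x. dens x (fst (w n x)) \<partial>M)) \<longlonglongrightarrow> m - (\<integral>x. dens x (V x) \<partial>M)"
      by (intro tendsto_diff w dlim)
    then have "eventually (\<lambda>n. J (w n) - (\<integral>x. dens x (fst (w n x)) \<partial>M) < m - (\<integral>x. dens x (V x) \<partial>M) + e)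
        sequentially"
      using e by (intro order_tendstoD) auto
    then obtain N where N: "\<And>n. n \<ge> N \<Longrightarrow>
        J (w n) - (\<integral>x. dens x (fst (w n x)) \<partial>M) < m - (\<integral>x. dens x (V x) \<partial>M) + e"
      by (auto simp: eventually_sequentially)
    have "(\<integral>x. A_of \<Psi> x (G x) \<partial>M) \<le> m - (\<integral>x. dens x (V x) \<partial>M) + e"
    proof (rule integral_Fatou(2)[where f="\<lambda>n x. A_of \<Psi> x (snd (w (n + N) x))"])
      show "integrable M (\<lambda>x. A_of \<Psi> x (snd (w (n + N) x)))" for n
        by (rule A_integrable[OF W1_D(5,2)[OF K(1)[OF w(1)]]])
      show "AE x in M. 0 \<le> A_of \<Psi> x (snd (w (n + N) x))" for n
        using profile by eventually_elim (rule A_of_nonneg)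
      show "(\<lambda>x. A_of \<Psi> x (G x)) \<in> borel_measurable M"
        using A_integrable[OF _ GLp] by auto
      show "AE x in M. (\<lambda>n. A_of \<Psi> x (snd (w (n + N) x))) \<longlonglongrightarrow> A_of \<Psi> x (G x)"
        using profile aeG
        by eventually_elim (intro A_of_continuous LIMSEQ_ignore_initial_segment)
      show "(\<integral>x. A_of \<Psi> x (snd (w (n + N) x)) \<partial>M) \<le> m - (\<integral>x. dens x (V x) \<partial>M) + e" for n
        using N[of "n + N"] by (simp add: J_def energy_def)
    qed
    then show "energy V G \<le> m + e"
      by (simp add: energy_def)
  qed
  moreover have "m \<le> energy u H" if "W1 \<Omega> p u H" "AE x in M. 0 \<le> u x \<and> u x \<le> 1" for u H
    using m_le[OF KI[OF that]] by (simp add: J_def)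
  ultimately have "\<forall>u H. W1 \<Omega> p u H \<longrightarrow> (AE x in M. 0 \<le> u x \<and> u x \<le> 1) \<longrightarrow>
      energy V G \<le> energy u H"
    using order.trans by blast
  with W V01 show thesis
    by (rule that)
qed

text \<open>The bound \<open>k\<close> makes the quadratic density of the competitor integrable.
  Where truncation kills the gradient, the potential drops to its minimum 0.\<close>

lemma energy_minimizer_unconstrained:
  assumes min: "\<forall>u H. W1 \<Omega> p u H \<longrightarrow> (AE x in M. 0 \<le> u x \<and> u x \<le> 1) \<longrightarrow>
      energy V G \<le> energy u H"
    and u: "W1 \<Omega> p u H" "AE x in M. \<bar>u x\<bar> \<le> k"
  shows "energy V G \<le> energy u H"
proof -
  let ?u = "\<lambda>x. max 0 (min 1 (u x))" and ?H = "\<lambda>x. if 0 \<le> u x \<and> u x \<le> 1 then H x else 0"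
  have W: "W1 \<Omega> p ?u ?H"
    by (rule W1_truncate[OF u(1)]) auto
  have "energy V G \<le> energy ?u ?H"
    by (rule min[rule_format, OF W]) auto
  also have "\<dots> \<le> energy u H"
    unfolding energy_def
  proof (rule add_mono)
    show "(\<integral>x. A_of \<Psi> x (?H x) \<partial>M) \<le> (\<integral>x. A_of \<Psi> x (H x) \<partial>M)"
    proof (rule integral_mono_AE[OF A_integrable[OF W1_D(5,2)[OF W]] A_integrable[OF W1_D(5,2)[OF u(1)]]])
      show "AE x in M. A_of \<Psi> x (?H x) \<le> A_of \<Psi> x (H x)"
        using profile by eventually_elim (auto intro: A_of_nonneg)
    qed
    show "(\<integral>x. dens x (?u x) \<partial>M) \<le> (\<integral>x. dens x (u x) \<partial>M)"
    proof (rule integral_mono_AE)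
      show "integrable M (\<lambda>x. dens x (?u x))"
        by (rule dens_integrable[OF W1_D(4)[OF W], of 1]) auto
      show "integrable M (\<lambda>x. dens x (u x))"
        by (rule dens_integrable[OF W1_D(4)[OF u(1)] u(2)])
      show "AE x in M. dens x (?u x) \<le> dens x (u x)"
        using g_bounds by eventually_elim (auto intro: dens_truncate)
    qed
  qed
  finally show ?thesis .
qed

section \<open>The Euler-Lagrange equation\<close>

lemma g_mult_integrable: "integrable M \<phi> \<Longrightarrow> integrable M (\<lambda>x. g x * \<phi> x)"
  by (rule integrable_bounded_mult_left[OF g_meas, of "2 * \<kappa>"])
     (use g_bounds in \<open>auto elim: eventually_mono\<close>)

lemma residual_bound:
  assumes "AE x in M. 0 \<le> V x \<and> V x \<le> 1"
  shows "AE x in M. \<bar>2 * \<kappa> * V x - g x\<bar> \<le> 2 * \<kappa>"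
  using assms g_bounds
proof eventually_elim
  case (elim x)
  have "0 \<le> 2 * \<kappa> * V x" "2 * \<kappa> * V x \<le> 2 * \<kappa>"
    using elim \<kappa>_pos by (auto intro: mult_left_le)
  with elim show ?case
    unfolding abs_le_iff by linarith
qed

text \<open>The subgradient inequality at the perturbed gradient
  \<open>G x + t n *\<^sub>R H x\<close> bounds the increment of the potential from above by
  \<open>t n\<close> times the flux term. After division by \<open>t n\<close>, the limit uses
  continuity of the flux in its argument and a majorant from the growth assumption.\<close>

lemma euler_lagrange_inequality:
  assumes V: "W1 \<Omega> p V G" "AE x in M. 0 \<le> V x \<and> V x \<le> 1"
    and min: "\<forall>u H k. W1 \<Omega> p u H \<longrightarrow> (AE x in M. \<bar>u x\<bar> \<le> k) \<longrightarrow> energy V G \<le> energy u H"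
    and \<phi>: "W1 \<Omega> p \<phi> H" "AE x in M. \<bar>\<phi> x\<bar> \<le> k"
  shows "0 \<le> (\<integral>x. flux \<Psi> x (G x) \<bullet> H x \<partial>M) + (\<integral>x. (2 * \<kappa> * V x - g x) * \<phi> x \<partial>M)"
proof -
  note VW = W1_D[OF V(1)] and \<phi>W = W1_D[OF \<phi>(1)]
  have V1: "AE x in M. \<bar>V x\<bar> \<le> 1"
    using V(2) by (auto elim: eventually_mono)
  have i1: "integrable M (\<lambda>x. (2 * \<kappa> * V x - g x) * \<phi> x)"
    by (rule integrable_bounded_mult_left[OF _ residual_bound[OF V(2)] \<phi>W(6)])
       (use VW(4) g_meas in measurable)
  have i2: "integrable M (\<lambda>x. \<phi> x * \<phi> x)"
    by (rule integrable_bounded_mult_left[OF \<phi>W(4) \<phi>(2) \<phi>W(6)])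
  define t where "t n = inverse (real (Suc n))" for n
  have t: "t \<longlonglongrightarrow> 0" "\<And>n. t n > 0" "\<And>n. t n \<le> 1"
    unfolding t_def[abs_def] by (rule LIMSEQ_inverse_real_of_nat) (auto simp: field_simps)
  note tW = W1_add_cmult[OF V(1) \<phi>(1)]
  have fi: "integrable M (\<lambda>x. flux \<Psi> x (G x + c *\<^sub>R H x) \<bullet> H x)" for c
    by (rule flux_inner_integrable[OF W1_D(5,2)[OF tW] \<phi>W(5,2)])
  \<comment> \<open>Upper bound for the energy increment divided by \<open>t n\<close>; the last
    summand is the quadratic remainder of \<open>dens\<close>.\<close>
  define X where "X n = (\<integral>x. flux \<Psi> x (G x + t n *\<^sub>R H x) \<bullet> H x \<partial>M) +
      (\<integral>x. (2 * \<kappa> * V x - g x) * \<phi> x \<partial>M) + t n * (\<kappa> * (\<integral>x. \<phi> x * \<phi> x \<partial>M))" for n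
  have X: "0 \<le> X n" for n
  proof -
    have k: "AE x in M. \<bar>V x + t n * \<phi> x\<bar> \<le> 1 + k"
      using V1 \<phi>(2)
    proof eventually_elim
      case (elim x)
      have "\<bar>t n * \<phi> x\<bar> \<le> \<bar>\<phi> x\<bar>"
        using t(2,3)[of n] by (simp add: abs_mult mult_left_le_one_le)
      with elim show ?case by linarith
    qed
    have "energy V G \<le> energy (\<lambda>x. V x + t n * \<phi> x) (\<lambda>x. G x + t n *\<^sub>R H x)"
      using min tW k by blast
    moreover have "(\<integral>x. A_of \<Psi> x (G x + t n *\<^sub>R H x) \<partial>M) - (\<integral>x. A_of \<Psi> x (G x) \<partial>M) \<le>
        t n * (\<integral>x. flux \<Psi> x (G x + t n *\<^sub>R H x) \<bullet> H x \<partial>M)"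
    proof -
      note iA = A_integrable[OF W1_D(5,2)[OF tW, of "t n"]] A_integrable[OF VW(5,2)]
      have "(\<integral>x. A_of \<Psi> x (G x + t n *\<^sub>R H x) \<partial>M) - (\<integral>x. A_of \<Psi> x (G x) \<partial>M) =
          (\<integral>x. A_of \<Psi> x (G x + t n *\<^sub>R H x) - A_of \<Psi> x (G x) \<partial>M)"
        by (rule Bochner_Integration.integral_diff[symmetric, OF iA])
      also have "\<dots> \<le> (\<integral>x. t n * (flux \<Psi> x (G x + t n *\<^sub>R H x) \<bullet> H x) \<partial>M)"
      proof (rule integral_mono_AE)
        show "AE x in M. A_of \<Psi> x (G x + t n *\<^sub>R H x) - A_of \<Psi> x (G x) \<le>
            t n * (flux \<Psi> x (G x + t n *\<^sub>R H x) \<bullet> H x)"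
          using profile
        proof eventually_elim
          case (elim x)
          then show ?case
            using A_of_subgradient[OF elim, of "G x + t n *\<^sub>R H x" "G x"] by simp
        qed
      qed (use iA fi in auto)
      finally show ?thesis by simp
    qed
    moreover have "(\<integral>x. dens x (V x + t n * \<phi> x) \<partial>M) = (\<integral>x. dens x (V x) \<partial>M) +
        (t n * (\<integral>x. (2 * \<kappa> * V x - g x) * \<phi> x \<partial>M) + t n * (t n * (\<kappa> * (\<integral>x. \<phi> x * \<phi> x \<partial>M))))"
    proof -
      have "dens x (V x + t n * \<phi> x) = dens x (V x) +
          (t n * ((2 * \<kappa> * V x - g x) * \<phi> x) + t n * (t n * (\<kappa> * (\<phi> x * \<phi> x))))" for x
        by (simp add: dens_def power2_eq_square algebra_simps)
      then show ?thesis
        using i1 i2 dens_integrable[OF VW(4) V1] by simp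
    qed
    ultimately have "0 \<le> t n * X n"
      unfolding X_def energy_def distrib_left by linarith
    then show ?thesis
      using t(2)[of n] by (simp add: zero_le_mult_iff)
  qed
  have GH: "(\<lambda>x. norm (G x) + norm (H x)) \<in> var_Lp \<Omega> p"
    by (rule var_Lp_add[OF VW(2) \<phi>W(2)])
  have "(\<lambda>n. \<integral>x. flux \<Psi> x (G x + t n *\<^sub>R H x) \<bullet> H x \<partial>M) \<longlonglongrightarrow> (\<integral>x. flux \<Psi> x (G x) \<bullet> H x \<partial>M)"
  proof (rule integral_dominated_convergence)
    \<comment> \<open>Monotonicity of \<open>Phi_of \<Psi> x\<close> and \<open>t n \<le> 1\<close>
      give this majorant for all \<open>n\<close>.\<close>
    show "integrable M (\<lambda>x. Phi_of \<Psi> x (norm (G x) + norm (H x)) * norm (H x))"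
      by (rule var_Lp_pairing[OF growth[OF GH] \<phi>W(2)])
    show "AE x in M. norm (flux \<Psi> x (G x + t n *\<^sub>R H x) \<bullet> H x) \<le>
        Phi_of \<Psi> x (norm (G x) + norm (H x)) * norm (H x)" for n
      using profile
    proof eventually_elim
      case (elim x)
      have "norm (G x + t n *\<^sub>R H x) \<le> norm (G x) + norm (t n *\<^sub>R H x)"
        by (rule norm_triangle_ineq)
      also have "norm (t n *\<^sub>R H x) \<le> norm (H x)"
        using t(2,3)[of n] by (simp add: mult_left_le_one_le)
      finally have "Phi_of \<Psi> x (norm (G x + t n *\<^sub>R H x)) \<le> Phi_of \<Psi> x (norm (G x) + norm (H x))"
        by (intro growth_profile_mono[OF elim]) auto
      then have "norm (flux \<Psi> x (G x + t n *\<^sub>R H x)) \<le> Phi_of \<Psi> x (norm (G x) + norm (H x))"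
        using norm_flux_le[of \<Psi> x "G x + t n *\<^sub>R H x"]
          growth_profile_nonneg[OF elim, of "norm (G x + t n *\<^sub>R H x)"] by simp
      then show ?case
        by (auto intro!: order.trans[OF Cauchy_Schwarz_ineq2] mult_right_mono)
    qed
    show "AE x in M. (\<lambda>n. flux \<Psi> x (G x + t n *\<^sub>R H x) \<bullet> H x) \<longlonglongrightarrow> flux \<Psi> x (G x) \<bullet> H x"
      using profile
    proof eventually_elim
      case (elim x)
      have "(\<lambda>n. G x + t n *\<^sub>R H x) \<longlonglongrightarrow> G x + 0 *\<^sub>R H x"
        by (intro tendsto_add tendsto_scaleR tendsto_const t)
      then show ?case
        by (intro tendsto_inner flux_continuous[OF elim] tendsto_const) simp
    qed
    show "(\<lambda>x. flux \<Psi> x (G x) \<bullet> H x) \<in> borel_measurable M"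
      using fi[of 0] by auto
    show "(\<lambda>x. flux \<Psi> x (G x + t n *\<^sub>R H x) \<bullet> H x) \<in> borel_measurable M" for n
      using fi by auto
  qed
  then have "X \<longlonglongrightarrow> (\<integral>x. flux \<Psi> x (G x) \<bullet> H x \<partial>M) + (\<integral>x. (2 * \<kappa> * V x - g x) * \<phi> x \<partial>M) +
      0 * (\<kappa> * (\<integral>x. \<phi> x * \<phi> x \<partial>M))"
    unfolding X_def[abs_def] by (intro tendsto_add tendsto_mult tendsto_const t)
  then have "X \<longlonglongrightarrow> (\<integral>x. flux \<Psi> x (G x) \<bullet> H x \<partial>M) + (\<integral>x. (2 * \<kappa> * V x - g x) * \<phi> x \<partial>M)"
    by simp
  then show ?thesis
    by (rule LIMSEQ_le_const) (use X in auto)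
qed

text \<open>For a bounded test function the inequality is applied with both signs. The truncations
  of a general one agree with it at each point from some index on, and the residual is bounded, so
  its product with the integrable \<open>\<phi>\<close> is a majorant.\<close>

lemma euler_lagrange:
  assumes V: "W1 \<Omega> p V G" "AE x in M. 0 \<le> V x \<and> V x \<le> 1"
    and min: "\<forall>u H k. W1 \<Omega> p u H \<longrightarrow> (AE x in M. \<bar>u x\<bar> \<le> k) \<longrightarrow> energy V G \<le> energy u H"
    and \<phi>: "W1 \<Omega> p \<phi> H"
  shows "integrable M (\<lambda>x. (2 * \<kappa> * V x - g x) * \<phi> x)"
    "(\<integral>x. flux \<Psi> x (G x) \<bullet> H x \<partial>M) + (\<integral>x. (2 * \<kappa> * V x - g x) * \<phi> x \<partial>M) = 0"
proof -
  have m: "(\<lambda>x. 2 * \<kappa> * V x - g x) \<in> borel_measurable M"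
    using W1_D(4)[OF V(1)] g_meas by measurable
  show i: "integrable M (\<lambda>x. (2 * \<kappa> * V x - g x) * \<phi> x)"
    by (rule integrable_bounded_mult_left[OF m residual_bound[OF V(2)] W1_D(6)[OF \<phi>]])
  define \<phi>k where "\<phi>k n x = max (- real n) (min (real n) (\<phi> x))" for n x
  define Hk where "Hk n x = (if - real n \<le> \<phi> x \<and> \<phi> x \<le> real n then H x else 0)" for n x
  have W: "W1 \<Omega> p (\<phi>k n) (Hk n)" for n
    unfolding \<phi>k_def[abs_def] Hk_def[abs_def] by (rule W1_truncate[OF \<phi>]) auto
  have bnd: "AE x in M. \<bar>\<phi>k n x\<bar> \<le> real n" for n
    by (auto simp: \<phi>k_def)
  have eq: "(\<integral>x. flux \<Psi> x (G x) \<bullet> Hk n x \<partial>M) + (\<integral>x. (2 * \<kappa> * V x - g x) * \<phi>k n x \<partial>M) = 0" for n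
  proof -
    from W1_add_cmult[OF W1_0 W, of "-1" n]
    have W': "W1 \<Omega> p (\<lambda>x. - \<phi>k n x) (\<lambda>x. - Hk n x)"
      by simp
    have bnd': "AE x in M. \<bar>- \<phi>k n x\<bar> \<le> real n"
      using bnd by simp
    show ?thesis
      using euler_lagrange_inequality[OF V min W bnd, of n]
        euler_lagrange_inequality[OF V min W' bnd']
      by simp
  qed
  have fi: "integrable M (\<lambda>x. flux \<Psi> x (G x) \<bullet> H x)" "integrable M (\<lambda>x. flux \<Psi> x (G x) \<bullet> Hk n x)" for n
    by (rule flux_inner_integrable[OF W1_D(5,2)[OF V(1)] W1_D(5,2)[OF \<phi>]])
       (rule flux_inner_integrable[OF W1_D(5,2)[OF V(1)] W1_D(5,2)[OF W]])
  have ev: "eventually (\<lambda>n. \<bar>\<phi> x\<bar> \<le> real n) sequentially" for x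
  proof -
    obtain n0 where "\<bar>\<phi> x\<bar> \<le> real n0"
      using real_arch_simple by blast
    then show ?thesis
      by (intro eventually_sequentiallyI[of n0]) (auto intro: order.trans)
  qed
  have "(\<lambda>n. \<integral>x. flux \<Psi> x (G x) \<bullet> Hk n x \<partial>M) \<longlonglongrightarrow> (\<integral>x. flux \<Psi> x (G x) \<bullet> H x \<partial>M)"
  proof (rule integral_dominated_convergence)
    show "integrable M (\<lambda>x. \<bar>flux \<Psi> x (G x) \<bullet> H x\<bar>)"
      using fi(1) by auto
    show "AE x in M. norm (flux \<Psi> x (G x) \<bullet> Hk n x) \<le> \<bar>flux \<Psi> x (G x) \<bullet> H x\<bar>" for n
      by (auto simp: Hk_def)
    show "AE x in M. (\<lambda>n. flux \<Psi> x (G x) \<bullet> Hk n x) \<longlonglongrightarrow> flux \<Psi> x (G x) \<bullet> H x"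
    proof (rule AE_I2, rule tendsto_eventually)
      fix x
      show "\<forall>\<^sub>F n in sequentially. flux \<Psi> x (G x) \<bullet> Hk n x = flux \<Psi> x (G x) \<bullet> H x"
        using ev[of x] by eventually_elim (auto simp: Hk_def)
    qed
  qed (use fi in auto)
  moreover have "(\<lambda>n. \<integral>x. (2 * \<kappa> * V x - g x) * \<phi>k n x \<partial>M) \<longlonglongrightarrow>
      (\<integral>x. (2 * \<kappa> * V x - g x) * \<phi> x \<partial>M)"
  proof (rule integral_dominated_convergence)
    show "integrable M (\<lambda>x. \<bar>(2 * \<kappa> * V x - g x) * \<phi> x\<bar>)"
      using i by auto
    show "AE x in M. norm ((2 * \<kappa> * V x - g x) * \<phi>k n x) \<le> \<bar>(2 * \<kappa> * V x - g x) * \<phi> x\<bar>" for n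
      unfolding real_norm_def abs_mult
      by (intro AE_I2 mult_left_mono) (auto simp: \<phi>k_def)
    show "AE x in M. (\<lambda>n. (2 * \<kappa> * V x - g x) * \<phi>k n x) \<longlonglongrightarrow> (2 * \<kappa> * V x - g x) * \<phi> x"
    proof (rule AE_I2, rule tendsto_eventually)
      fix x
      show "\<forall>\<^sub>F n in sequentially. (2 * \<kappa> * V x - g x) * \<phi>k n x = (2 * \<kappa> * V x - g x) * \<phi> x"
        using ev[of x] by eventually_elim (auto simp: \<phi>k_def max_def min_def abs_le_iff)
    qed
    show "(\<lambda>x. (2 * \<kappa> * V x - g x) * \<phi>k n x) \<in> borel_measurable M" for n
      using m W1_D(4)[OF W] by (rule borel_measurable_times)
  qed (use i in auto)
  ultimately have "(\<lambda>n. (\<integral>x. flux \<Psi> x (G x) \<bullet> Hk n x \<partial>M) + (\<integral>x. (2 * \<kappa> * V x - g x) * \<phi>k n x \<partial>M))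
      \<longlonglongrightarrow> (\<integral>x. flux \<Psi> x (G x) \<bullet> H x \<partial>M) + (\<integral>x. (2 * \<kappa> * V x - g x) * \<phi> x \<partial>M)"
    by (rule tendsto_add)
  then show "(\<integral>x. flux \<Psi> x (G x) \<bullet> H x \<partial>M) + (\<integral>x. (2 * \<kappa> * V x - g x) * \<phi> x \<partial>M) = 0"
    unfolding eq by (simp add: LIMSEQ_const_iff)
qed

lemma weak_solution_exists:
  obtains V where "weak_solution \<Omega> p \<Psi> (2 * \<kappa>) g V" "AE x in M. 0 \<le> V x \<and> V x \<le> 1"
proof -
  obtain V G where V: "W1 \<Omega> p V G" "AE x in M. 0 \<le> V x \<and> V x \<le> 1"
    and min: "\<forall>u H. W1 \<Omega> p u H \<longrightarrow> (AE x in M. 0 \<le> u x \<and> u x \<le> 1) \<longrightarrow>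
      energy V G \<le> energy u H"
    by (rule energy_minimizer)
  have min': "\<forall>u H k. W1 \<Omega> p u H \<longrightarrow> (AE x in M. \<bar>u x\<bar> \<le> k) \<longrightarrow> energy V G \<le> energy u H"
    using energy_minimizer_unconstrained[OF min] by blast
  have V1: "AE x in M. \<bar>V x\<bar> \<le> 1"
    using V(2) by (auto elim: eventually_mono)
  have "integrable M (\<lambda>x. flux \<Psi> x (G x) \<bullet> H x) \<and> integrable M (\<lambda>x. V x * \<phi> x) \<and>
      integrable M (\<lambda>x. g x * \<phi> x) \<and>
      (\<integral>x. flux \<Psi> x (G x) \<bullet> H x \<partial>M) + 2 * \<kappa> * (\<integral>x. V x * \<phi> x \<partial>M) = (\<integral>x. g x * \<phi> x \<partial>M)"
    if \<phi>: "W1 \<Omega> p \<phi> H" for \<phi> H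
  proof (intro conjI)
    show "integrable M (\<lambda>x. flux \<Psi> x (G x) \<bullet> H x)"
      by (rule flux_inner_integrable[OF W1_D(5,2)[OF V(1)] W1_D(5,2)[OF \<phi>]])
    show iV: "integrable M (\<lambda>x. V x * \<phi> x)"
      by (rule integrable_bounded_mult_left[OF W1_D(4)[OF V(1)] V1 W1_D(6)[OF \<phi>]])
    show ig: "integrable M (\<lambda>x. g x * \<phi> x)"
      by (rule g_mult_integrable[OF W1_D(6)[OF \<phi>]])
    have "(\<integral>x. (2 * \<kappa> * V x - g x) * \<phi> x \<partial>M) = (\<integral>x. 2 * \<kappa> * (V x * \<phi> x) - g x * \<phi> x \<partial>M)"
      by (simp add: algebra_simps)
    also have "\<dots> = 2 * \<kappa> * (\<integral>x. V x * \<phi> x \<partial>M) - (\<integral>x. g x * \<phi> x \<partial>M)"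
      using iV ig by simp
    finally show "(\<integral>x. flux \<Psi> x (G x) \<bullet> H x \<partial>M) + 2 * \<kappa> * (\<integral>x. V x * \<phi> x \<partial>M) = (\<integral>x. g x * \<phi> x \<partial>M)"
      using euler_lagrange(2)[OF V min' \<phi>] by simp
  qed
  with V have "weak_solution \<Omega> p \<Psi> (2 * \<kappa>) g V"
    unfolding weak_solution_def by blast
  with V(2) show thesis
    by (rule that[rotated])
qed

lemma weak_solution_unique:
  assumes U: "weak_solution \<Omega> p \<Psi> (2 * \<kappa>) g U" and V: "weak_solution \<Omega> p \<Psi> (2 * \<kappa>) g V"
  shows "AE x in M. U x = V x"
proof -
  obtain G where G: "W1 \<Omega> p U G" and Us: "\<And>\<phi> H. W1 \<Omega> p \<phi> H \<Longrightarrow>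
      integrable M (\<lambda>x. flux \<Psi> x (G x) \<bullet> H x) \<and> integrable M (\<lambda>x. U x * \<phi> x) \<and>
      (\<integral>x. flux \<Psi> x (G x) \<bullet> H x \<partial>M) + 2 * \<kappa> * (\<integral>x. U x * \<phi> x \<partial>M) = (\<integral>x. g x * \<phi> x \<partial>M)"
    using U unfolding weak_solution_def by blast
  obtain F where F: "W1 \<Omega> p V F" and Vs: "\<And>\<phi> H. W1 \<Omega> p \<phi> H \<Longrightarrow>
      integrable M (\<lambda>x. flux \<Psi> x (F x) \<bullet> H x) \<and> integrable M (\<lambda>x. V x * \<phi> x) \<and>
      (\<integral>x. flux \<Psi> x (F x) \<bullet> H x \<partial>M) + 2 * \<kappa> * (\<integral>x. V x * \<phi> x \<partial>M) = (\<integral>x. g x * \<phi> x \<partial>M)"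
    using V unfolding weak_solution_def by blast
  have W: "W1 \<Omega> p (\<lambda>x. U x - V x) (\<lambda>x. G x - F x)"
    using W1_add_cmult[OF G F, of "-1"] by simp
  note Us = Us[OF W] and Vs = Vs[OF W]
  have mono_eq: "(\<integral>x. (flux \<Psi> x (G x) - flux \<Psi> x (F x)) \<bullet> (G x - F x) \<partial>M) =
      (\<integral>x. flux \<Psi> x (G x) \<bullet> (G x - F x) \<partial>M) - (\<integral>x. flux \<Psi> x (F x) \<bullet> (G x - F x) \<partial>M)"
    using Us Vs by (simp add: inner_diff_left)
  have mono: "0 \<le> (\<integral>x. (flux \<Psi> x (G x) - flux \<Psi> x (F x)) \<bullet> (G x - F x) \<partial>M)"
    using profile by (intro integral_nonneg_AE) (auto elim!: eventually_mono intro: flux_monotone)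
  \<comment> \<open>Integrability of the square comes from the weak formulation itself, which
    asserts it for \<open>U\<close> and for \<open>V\<close> times the test function
    \<open>U - V\<close>.\<close>
  have i: "integrable M (\<lambda>x. (U x - V x) * (U x - V x))"
    and eq: "(\<integral>x. (U x - V x) * (U x - V x) \<partial>M) =
      (\<integral>x. U x * (U x - V x) \<partial>M) - (\<integral>x. V x * (U x - V x) \<partial>M)"
    using Us Vs Bochner_Integration.integrable_diff[of M "\<lambda>x. U x * (U x - V x)" "\<lambda>x. V x * (U x - V x)"]
    by (simp_all only: left_diff_distrib[of "U _" "V _"] Bochner_Integration.integral_diff)
  have "2 * \<kappa> * (\<integral>x. (U x - V x) * (U x - V x) \<partial>M) =
      2 * \<kappa> * (\<integral>x. U x * (U x - V x) \<partial>M) - 2 * \<kappa> * (\<integral>x. V x * (U x - V x) \<partial>M)"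
    unfolding eq by (rule right_diff_distrib)
  then have "2 * \<kappa> * (\<integral>x. (U x - V x) * (U x - V x) \<partial>M) \<le> 0"
    using mono mono_eq Us[THEN conjunct2, THEN conjunct2] Vs[THEN conjunct2, THEN conjunct2]
    by linarith
  then have "(\<integral>x. (U x - V x) * (U x - V x) \<partial>M) \<le> 0"
    using \<kappa>_pos by (simp add: mult_le_0_iff)
  moreover have "0 \<le> (\<integral>x. (U x - V x) * (U x - V x) \<partial>M)"
    by (intro integral_nonneg_AE) auto
  ultimately have "(\<integral>x. (U x - V x) * (U x - V x) \<partial>M) = 0"
    by linarith
  then have "AE x in M. (U x - V x) * (U x - V x) = 0"
    by (subst (asm) integral_nonneg_eq_0_iff_AE[OF i]) auto
  then show ?thesis
    by eventually_elim simp
qed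

end

section \<open>From the standing assumptions to the locale\<close>

lemma loc_abs_cont_pos_isCont:
  assumes f: "loc_abs_cont_pos f" and s: "s > 0"
  shows "isCont f s"
proof -
  \<comment> \<open>A compact interval of positive numbers with \<open>s\<close> in its
    interior.\<close>
  have ac: "abs_cont_on_interval (s / 2) (2 * s) f"
    using f s by (simp add: loc_abs_cont_pos_def)
  show ?thesis
    unfolding continuous_at_eps_delta
  proof (intro allI impI)
    fix e :: real assume e: "e > 0"
    obtain h where h: "h > 0" and D: "\<forall>D. finite D \<and>
        (\<forall>(c, d)\<in>D. s / 2 \<le> c \<and> c \<le> d \<and> d \<le> 2 * s) \<and>
        pairwise (\<lambda>I J. {fst I<..<snd I} \<inter> {fst J<..<snd J} = {}) D \<and>
        (\<Sum>(c, d)\<in>D. d - c) < h \<longrightarrow> (\<Sum>(c, d)\<in>D. \<bar>f d - f c\<bar>) < e"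
      using ac[unfolded abs_cont_on_interval_def, rule_format, OF e] by blast
    show "\<exists>d>0. \<forall>y. dist y s < d \<longrightarrow> dist (f y) (f s) < e"
    proof (intro exI conjI allI impI)
      show "min h (s / 2) > 0"
        using h s by simp
      fix y assume "dist y s < min h (s / 2)"
      then have y: "\<bar>y - s\<bar> < h" "\<bar>y - s\<bar> < s / 2"
        by (simp_all add: dist_real_def)
      \<comment> \<open>Absolute continuity for the single interval between \<open>s\<close> and
        \<open>y\<close>.\<close>
      have "\<bar>f (max y s) - f (min y s)\<bar> < e"
        using D[THEN spec, of "{(min y s, max y s)}"] y s by (auto simp: max_def min_def field_simps split: if_splits)
      then show "dist (f y) (f s) < e"
        by (auto simp: dist_real_def max_def min_def abs_minus_commute split: if_splits)
    qed
  qed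
qed

text \<open>At the endpoint, where \<open>Phi_of\<close> is set to 0, positivity gives monotonicity
  and the limit assumption gives continuity; at positive arguments, continuity comes from absolute
  continuity.\<close>

lemma growth_profile_Phi_of:
  assumes pos: "\<And>s. s > 0 \<Longrightarrow> \<Psi> x s > 0" and ac: "loc_abs_cont_pos (\<Psi> x)"
    and lim: "((\<lambda>s. \<Psi> x s * s) \<longlongrightarrow> 0) (at_right 0)"
    and mono: "strict_mono_on {0<..} (\<lambda>s. \<Psi> x s * s)"
  shows "growth_profile (Phi_of \<Psi> x)"
  unfolding growth_profile_def
proof (intro conjI)
  show "Phi_of \<Psi> x 0 = 0"
    by (simp add: Phi_of_def)
  show "mono_on {0..} (Phi_of \<Psi> x)"
  proof (rule mono_onI)
    fix s t :: real assume st: "s \<in> {0..}" "t \<in> {0..}" "s \<le> t"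
    show "Phi_of \<Psi> x s \<le> Phi_of \<Psi> x t"
    proof (cases "s = 0")
      case True
      then show ?thesis
        using pos[of t] st by (auto simp: Phi_of_def less_imp_le)
    next
      case False
      with st have "\<Psi> x s * s \<le> \<Psi> x t * t"
        using strict_mono_on_leD[OF mono, of s t] by auto
      with False st show ?thesis
        by (simp add: Phi_of_def)
    qed
  qed
  show "continuous_on {0..} (Phi_of \<Psi> x)"
    unfolding continuous_on_eq_continuous_within
  proof
    fix s :: real assume "s \<in> {0..}"
    then consider "s = 0" | "s > 0"
      by force
    then show "continuous (at s within {0..}) (Phi_of \<Psi> x)"
    proof cases
      case 1
      have "(Phi_of \<Psi> x \<longlongrightarrow> 0) (at_right 0)"
        using lim by (rule tendsto_cong[THEN iffD1, rotated])
          (auto simp: Phi_of_def eventually_at_filter)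
      with 1 show ?thesis
        by (simp add: continuous_within Phi_of_def at_within_Ici_at_right)
    next
      case 2
      have "isCont (\<lambda>s. \<Psi> x s * s) s"
        using loc_abs_cont_pos_isCont[OF ac 2] by simp
      moreover have "eventually (\<lambda>s. \<Psi> x s * s = Phi_of \<Psi> x s) (nhds s)"
        using eventually_nhds_in_open[of "{0<..}" s] 2
        by (auto simp: Phi_of_def elim!: eventually_mono)
      ultimately have "isCont (Phi_of \<Psi> x) s"
        by (subst (asm) isCont_cong)
      then show ?thesis
        by (rule continuous_at_imp_continuous_at_within)
    qed
  qed
qed

text \<open>The modulus \<open>C / (- ln d)\<close> tends to 0 with \<open>d\<close>. Both
  alternatives for the exponent thus provide its measurability and its extreme values.\<close>

lemma log_Holder_on_imp_continuous_on:
  assumes "log_Holder_on S p"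
  shows "continuous_on S p"
  unfolding continuous_on_def
proof
  fix x assume x: "x \<in> S"
  obtain C where C: "C > 0" "\<And>y. y \<in> S \<Longrightarrow> 0 < dist y x \<Longrightarrow> dist y x < 1 / 2 \<Longrightarrow>
      \<bar>p y - p x\<bar> \<le> C / (- ln (dist y x))"
    using assms x unfolding log_Holder_on_def by metis
  have "filterlim (\<lambda>y. dist y x) (at_right 0) (at x within S)"
    unfolding filterlim_at
    by (auto simp: eventually_at_filter intro!: tendsto_eq_intros)
  moreover have "((\<lambda>d::real. C / (- ln d)) \<longlongrightarrow> 0) (at_right 0)"
    by real_asymp
  ultimately have "((\<lambda>y. C / (- ln (dist y x))) \<longlongrightarrow> 0) (at x within S)"
    by (rule filterlim_compose[rotated])
  moreover have "eventually (\<lambda>y. norm (p y - p x) \<le> C / (- ln (dist y x))) (at x within S)"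
    unfolding eventually_at using C(2) by (intro exI[of _ "1 / 2"]) auto
  ultimately have "((\<lambda>y. p y - p x) \<longlongrightarrow> 0) (at x within S)"
    by (rule Lim_null_comparison[rotated])
  then show "(p \<longlongrightarrow> p x) (at x within S)"
    by (rule LIM_zero_cancel)
qed

theorem theorem6p2:
  fixes \<Omega> :: "'a::euclidean_space set"
    and p :: "'a \<Rightarrow> real"
    and \<Psi> :: "'a \<Rightarrow> real \<Rightarrow> real"
    and \<delta> \<delta>' \<Lambda> :: real
    and g :: "'a \<Rightarrow> real"
  assumes dim: "DIM('a) \<ge> 2"
    and domain: "lipschitz_domain \<Omega>" "bounded \<Omega>"
    and p_gt_1: "\<forall>x\<in>closure \<Omega>. 1 < p x"
    and p_regular:
      "(log_Holder_on (closure \<Omega>) p \<and>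
          (INF x\<in>closure \<Omega>. p x) \<ge> 2 * real DIM('a) / (real DIM('a) + 2)) \<or>
       (continuous_on (closure \<Omega>) p \<and>
          (INF x\<in>closure \<Omega>. p x) > 2 * real DIM('a) / (real DIM('a) + 2))"
    and Psi_pos: "\<forall>x\<in>closure \<Omega>. \<forall>s>0. \<Psi> x s > 0"
    and Psi_meas: "\<forall>s>0. (\<lambda>x. \<Psi> x s) \<in> borel_measurable (lebesgue_on (closure \<Omega>))"
    and Psi_AC: "AE x in lebesgue_on \<Omega>. loc_abs_cont_pos (\<Psi> x)"
    and Psi_lim: "\<forall>x\<in>\<Omega>. ((\<lambda>s. \<Psi> x s * s) \<longlongrightarrow> 0) (at_right 0)"
    and Psi_mono: "AE x in lebesgue_on \<Omega>. strict_mono_on {0<..} (\<lambda>s. \<Psi> x s * s)"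
    and growth: "\<forall>v\<in>var_Lp \<Omega> p. (\<lambda>x. Phi_of \<Psi> x (v x)) \<in> var_Lp \<Omega> (conj_exponent p)"
    and delta: "\<delta> > 0" "\<delta>' \<ge> 0"
    and coercive: "\<forall>v G. W1 \<Omega> p v G \<longrightarrow>
       (\<integral>x. A_of \<Psi> x (G x) \<partial>lebesgue_on \<Omega>)
         \<ge> \<delta> * (\<integral>x. norm (G x) powr p x \<partial>lebesgue_on \<Omega>) - \<delta>'"
    and lambda_pos: "\<Lambda> > 0"
    and g_Linfty: "g \<in> L_infty \<Omega>"
    and g_bounds: "AE x in lebesgue_on \<Omega>. 0 \<le> g x \<and> g x \<le> \<Lambda>"
  shows "\<exists>V. weak_solution \<Omega> p \<Psi> \<Lambda> g V \<and>
             (AE x in lebesgue_on \<Omega>. 0 \<le> V x \<and> V x \<le> 1) \<and>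
             (\<forall>U. weak_solution \<Omega> p \<Psi> \<Lambda> g U \<longrightarrow> (AE x in lebesgue_on \<Omega>. U x = V x))"
proof -
  have \<Omega>: "open \<Omega>" "\<Omega> \<noteq> {}" "\<Omega> \<subseteq> closure \<Omega>"
    using domain(1) closure_subset by (auto simp: lipschitz_domain_def)
  have compact: "compact (closure \<Omega>)" "closure \<Omega> \<noteq> {}"
    using domain(2) \<Omega> by (auto simp: compact_closure)
  have cont: "continuous_on (closure \<Omega>) p"
    using p_regular log_Holder_on_imp_continuous_on by blast
  \<comment> \<open>The extreme values of \<open>p\<close> serve as \<open>pm\<close> and
    \<open>pP\<close>; the lower one exceeds 1 because it is attained.\<close>
  obtain z where z: "z \<in> closure \<Omega>" "\<And>x. x \<in> closure \<Omega> \<Longrightarrow> p z \<le> p x"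
    using continuous_attains_inf[OF compact cont] by blast
  obtain y where y: "\<And>x. x \<in> closure \<Omega> \<Longrightarrow> p x \<le> p y"
    using continuous_attains_sup[OF compact cont] by blast
  have p_meas: "p \<in> borel_measurable (lebesgue_on \<Omega>)"
    using cont \<Omega> by (intro continuous_imp_measurable_on_sets_lebesgue)
      (auto intro: continuous_on_subset simp: borel_open)
  have profile: "AE x in lebesgue_on \<Omega>. growth_profile (Phi_of \<Psi> x)"
    using Psi_AC Psi_mono AE_space
  proof eventually_elim
    case (elim x)
    then have "x \<in> \<Omega>"
      by simp
    then show ?case
      using elim Psi_pos Psi_lim \<Omega>(3) by (intro growth_profile_Phi_of) auto
  qed
  have g_meas: "g \<in> borel_measurable (lebesgue_on \<Omega>)"
    using g_Linfty by (simp add: L_infty_def)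
  \<comment> \<open>With \<open>\<kappa> = \<Lambda> / 2\<close> the coefficient of the equation
    reads \<open>2 * (\<Lambda> / 2)\<close> until simplification.\<close>
  interpret neumann_problem \<Omega> p "p z" "p y" \<Psi> \<delta> \<delta>' "\<Lambda> / 2" g
    by unfold_locales
       (use \<Omega> domain(2) p_meas p_gt_1 z y profile growth delta coercive lambda_pos g_meas g_bounds
         in \<open>auto simp: subset_iff\<close>)
  obtain V where V: "weak_solution \<Omega> p \<Psi> (2 * (\<Lambda> / 2)) g V" "AE x in lebesgue_on \<Omega>. 0 \<le> V x \<and> V x \<le> 1"
    using weak_solution_exists .
  moreover have "AE x in lebesgue_on \<Omega>. U x = V x" if "weak_solution \<Omega> p \<Psi> \<Lambda> g U" for U
    using weak_solution_unique[of U V] that V(1) by simp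
  ultimately show ?thesis
    by auto
qed

end
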